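(* Let $n\ge1$ and $\mathbf d=\{d_0<\dots<d_l\}\subset[0,n]$ with $d_0=0$, $d_l=n$. Consider $w\in\overline{C(\tilde I^{GT}_{\mathbf d},\tilde I^m_1)}$. There exist partial orders $<_1,\dots,<_m$ on $P_{\mathbf d}$ stronger than $<$ such that the zero set of $\mathrm{in}_w\tilde I^{GT}_{\mathbf d}$ in $\mathbb P_{\mathbf d}$ is semitoric with irreducible components isomorphic to the $H_\lambda(P_{\mathbf d},<_i,<_\varnothing)$ and the polytopes $\mathcal R_\lambda(P_{\mathbf d},<_i,<_\varnothing)$ form a polyhedral subdivision of the Gelfand--Tsetlin polytope $\mathcal R_\lambda(P_{\mathbf d},<,<_\varnothing)$. Here $<_\varnothing$ is the trivial order (no two distinct elements comparable) on $P_{\mathbf d}$.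
   Context: Posets. $\mathcal J(P,<)$ is the set of order ideals (lower sets) of a finite poset. An order $<''$ is stronger than $<$ if $p<q$ implies $p<''q$ (equality allowed). $\mathbf 1_A$ is the indicator vector of $A$. Polytopes. Let $P$ be a finite set with a subset $P^*$, let $<_\varnothing$ be the trivial order on $P$, and let $<$ be an order on $P$ all of whose minimal and maximal elements lie in $P^*$. For $K\in\mathcal J(P^*,<)$ put $\omega_K=\mathbf 1_K\in\mathbb R^{P^*}$ and let $\mathcal R_{\omega_K}(P,<,<_\varnothing)\subset\mathbb R^P$ be the convex hull of the points $\mathbf 1_J$, $J\in\mathcal J(P,<)$, $J\cap P^*=K$. For $\lambda=\sum_i\alpha_i\omega_{K_i}$ with integers $\alpha_i\ge0$ and $\varnothing\ne K_1\subsetneq K_2\subsetneq\cdots$ in $\mathcal J(P^*,<)$ (such an expression is unique), the marked relative poset polytope $\mathcal R_\lambda(P,<,<_\varnothing)$ is the Minkowski sum $\sum_i\alpha_i\mathcal R_{\omega_{K_i}}(P,<,<_\varnothing)$. $H_\lambda(P,<,<_\varnothing)$ is the projective toric variety of this polytope. Flag setting. $\mathbb P_{\mathbf d}=\mathbb P(\wedge^{d_0}\mathbb C^n)\times\dots\times\mathbb P(\wedge^{d_l}\mathbb C^n)$ has multihomogeneous coordinate ring $S_{\mathbf d}$, the polynomial ring in variables $X_{a_1,\dots,a_k}$, $1\le a_1<\dots<a_k\le n$, $k\in\mathbf d$. $\tilde I^{GT}_{\mathbf d}\subset S_{\mathbf d}$ is generated by all binomials $$X_{a_1,\dots,a_k}X_{b_1,\dots,b_m}-X_{\min(a_{k-m+1},b_1),\dots,\min(a_k,b_m)}\,X_{a_1,\dots,a_{k-m},\max(a_{k-m+1},b_1),\dots,\max(a_k,b_m)},\quad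 k\ge m;$$ it is an initial ideal of the Plücker ideal of the partial flag variety of flags of dimensions $d_0,\dots,d_l$ in $\mathbb C^n$. For $0\le k\le n$ let $P_k=\{p_{i,j}:1\le i\le k<j\le n\}$. Let $\tilde p_i=p_{d_{i-1}+1,d_i}$, $1\le i\le l$, and $P_{\mathbf d}=\{\tilde p_1,\dots,\tilde p_l\}\cup\bigcup_{i=1}^{l-1}P_{d_i}$ with $p_{i_1,j_1}\le p_{i_2,j_2}$ iff $i_1\le i_2$ and $j_1\le j_2$. Put $P_{\mathbf d}^*=\{\tilde p_1,\dots,\tilde p_l\}$, $K_i=\{\tilde p_1,\dots,\tilde p_i\}$, $\lambda=\omega_{K_1}+\dots+\omega_{K_l}\in\mathbb R^{P^*_{\mathbf d}}$. $\mathbb C[\mathcal J(P_{\mathbf d},<)]$ is the polynomial ring in variables $X_J$, $J\in\mathcal J(P_{\mathbf d},<)$, and $I^m_{P_{\mathbf d},<}$ is its ideal generated by the $X_{J_1}X_{J_2}$ with $J_1,J_2$ incomparable under inclusion. $\psi_{GT}:S_{\mathbf d}\to\mathbb C[\mathcal J(P_{\mathbf d},<)]$ is the isomorphism $X_{a_1,\dots,a_k}\mapsto X_J$ with $J=\{p_{i,j}\in P_{\mathbf d}:i\le k,\ j\le a_{k+1-i}+i-1\}$, and $\tilde I^m_1=\psi_{GT}^{-1}(I^m_{P_{\mathbf d},<})$. Initial ideals. For $w\in\mathbb R^N$, $\mathrm{in}_wp$ is the sum of the terms of $p$ of minimal $w$-weight; $\mathrm{in}_wI$ is the span of $\{\mathrm{in}_wp:p\in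 I\}$; $C(I,I')=\{w:\mathrm{in}_wI=I'\}$; bar denotes closure. Semitoric: all irreducible components are toric varieties. A polyhedral subdivision of a polytope is a set of polytopes of the same dimension, with union the polytope, which together with their faces form a polyhedral complex. *)

theory Defs
  imports "HOL-Analysis.Analysis" "HOL-Analysis.Finite_Function_Topology"
begin

section \<open>Polynomials in an arbitrary set of variables\<close>

type_synonym 'v monom = "'v \<Rightarrow>\<^sub>0 nat"
type_synonym 'v cpoly = "'v monom \<Rightarrow>\<^sub>0 complex"

definition Var :: "'v \<Rightarrow> 'v cpoly" where
  "Var v = Poly_Mapping.single (Poly_Mapping.single v 1) 1"

definition Const :: "complex \<Rightarrow> 'v cpoly" where
  "Const c = Poly_Mapping.single 0 c"

definition polys :: "'v set \<Rightarrow> 'v cpoly set" where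
  "polys V = {p. \<forall>m \<in> Poly_Mapping.keys p. Poly_Mapping.keys m \<subseteq> V}"

text \<open>Substitution of \<open>f v\<close> for each variable \<open>v\<close>, with coefficients transported by \<open>h\<close>.\<close>

definition poly_subst :: "(complex \<Rightarrow> 'a::comm_ring_1) \<Rightarrow> ('v \<Rightarrow> 'a) \<Rightarrow> 'v cpoly \<Rightarrow> 'a" where
  "poly_subst h f p =
     (\<Sum>m \<in> Poly_Mapping.keys p. h (Poly_Mapping.lookup p m) *
        (\<Prod>v \<in> Poly_Mapping.keys m. f v ^ Poly_Mapping.lookup m v))"

abbreviation poly_eval :: "('v \<Rightarrow> complex) \<Rightarrow> 'v cpoly \<Rightarrow> complex" where
  "poly_eval \<equiv> poly_subst (\<lambda>c. c)"

text \<open>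
  Finite linear combinations of elements of \<open>G\<close> with coefficients in \<open>R\<close>.  For \<open>R = polys V\<close> this is
  the ideal of the polynomial ring \<open>polys V\<close> generated by \<open>G\<close>; for \<open>R = range Const\<close> it is the
  complex linear span.
\<close>

definition lin_combs :: "'a::comm_ring_1 set \<Rightarrow> 'a set \<Rightarrow> 'a set" where
  "lin_combs R G = {(\<Sum>g\<in>F. c g * g) | F c. finite F \<and> F \<subseteq> G \<and> c ` F \<subseteq> R}"

section \<open>Initial ideals\<close>

definition monom_weight :: "('v \<Rightarrow> real) \<Rightarrow> 'v monom \<Rightarrow> real" where
  "monom_weight w m = (\<Sum>v \<in> Poly_Mapping.keys m. real (Poly_Mapping.lookup m v) * w v)"

definition initial_form :: "('v \<Rightarrow> real) \<Rightarrow> 'v cpoly \<Rightarrow> 'v cpoly" where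
  "initial_form w p =
     (\<Sum>m | m \<in> Poly_Mapping.keys p \<and>
             monom_weight w m = Min (monom_weight w ` Poly_Mapping.keys p).
        Poly_Mapping.single m (Poly_Mapping.lookup p m))"

definition initial_ideal :: "('v \<Rightarrow> real) \<Rightarrow> 'v cpoly set \<Rightarrow> 'v cpoly set" where
  "initial_ideal w I = lin_combs (range Const) (initial_form w ` I)"

text \<open>
  Weights are total functions on the type of variable indices.  For ideals of \<open>polys V\<close> with \<open>V\<close>
  finite, membership depends only on the restriction of the weight to \<open>V\<close>, so that \<open>weight_cone\<close> and
  its closure in the product topology are the preimages of the corresponding subsets of
  \<open>\<real>\<^sup>V\<close> under restriction.
\<close>

definition weight_cone :: "'v cpoly set \<Rightarrow> 'v cpoly set \<Rightarrow> ('v \<Rightarrow> real) set" where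
  "weight_cone I I' = {w. initial_ideal w I = I'}"

section \<open>Subvarieties of products of projective spaces\<close>

text \<open>
  A product of projective spaces is given by a finite set \<open>V\<close> of homogeneous coordinates and a map
  \<open>bl\<close> sending each coordinate to the label of its factor.  Its points are classes of coordinate
  vectors, supported on \<open>V\<close> and nonzero in every factor, up to independent rescaling of the factors.
\<close>

definition mproj_vec :: "'v set \<Rightarrow> ('v \<Rightarrow> 'b) \<Rightarrow> ('v \<Rightarrow> complex) set" where
  "mproj_vec V bl =
     {x. (\<forall>v. v \<notin> V \<longrightarrow> x v = 0) \<and> (\<forall>b \<in> bl ` V. \<exists>v\<in>V. bl v = b \<and> x v \<noteq> 0)}"

definition mproj_rel :: "'v set \<Rightarrow> ('v \<Rightarrow> 'b) \<Rightarrow> ('v \<Rightarrow> complex) rel" where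
  "mproj_rel V bl =
     {(x, y). x \<in> mproj_vec V bl \<and> y \<in> mproj_vec V bl \<and>
              (\<exists>c. (\<forall>b. c b \<noteq> 0) \<and> (\<forall>v\<in>V. y v = c (bl v) * x v))}"

definition mproj :: "'v set \<Rightarrow> ('v \<Rightarrow> 'b) \<Rightarrow> ('v \<Rightarrow> complex) set set" where
  "mproj V bl = mproj_vec V bl // mproj_rel V bl"

definition multihom :: "'v set \<Rightarrow> ('v \<Rightarrow> 'b) \<Rightarrow> ('b \<Rightarrow> nat) \<Rightarrow> 'v cpoly \<Rightarrow> bool" where
  "multihom V bl D p \<longleftrightarrow>
     p \<in> polys V \<and>
     (\<forall>m \<in> Poly_Mapping.keys p. \<forall>b.
        (\<Sum>v | v \<in> Poly_Mapping.keys m \<and> bl v = b. Poly_Mapping.lookup m v) = D b)"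

definition zero_set :: "'v set \<Rightarrow> ('v \<Rightarrow> 'b) \<Rightarrow> 'v cpoly set \<Rightarrow> ('v \<Rightarrow> complex) set set" where
  "zero_set V bl F = {c \<in> mproj V bl. \<forall>x\<in>c. \<forall>p\<in>F. poly_eval x p = 0}"

definition zariski_closed :: "'v set \<Rightarrow> ('v \<Rightarrow> 'b) \<Rightarrow> ('v \<Rightarrow> complex) set set \<Rightarrow> bool" where
  "zariski_closed V bl Z \<longleftrightarrow>
     (\<exists>F. (\<forall>p\<in>F. \<exists>D. multihom V bl D p) \<and> Z = zero_set V bl F)"

definition zariski_closure ::
  "'v set \<Rightarrow> ('v \<Rightarrow> 'b) \<Rightarrow> ('v \<Rightarrow> complex) set set \<Rightarrow> ('v \<Rightarrow> complex) set set" where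
  "zariski_closure V bl X = \<Inter>{Z. zariski_closed V bl Z \<and> X \<subseteq> Z}"

definition zariski_irreducible :: "'v set \<Rightarrow> ('v \<Rightarrow> 'b) \<Rightarrow> ('v \<Rightarrow> complex) set set \<Rightarrow> bool" where
  "zariski_irreducible V bl X \<longleftrightarrow>
     X \<noteq> {} \<and> (\<forall>Z Z'. zariski_closed V bl Z \<and> zariski_closed V bl Z' \<and> X \<subseteq> Z \<union> Z'
                    \<longrightarrow> X \<subseteq> Z \<or> X \<subseteq> Z')"

definition irreducible_components ::
  "'v set \<Rightarrow> ('v \<Rightarrow> 'b) \<Rightarrow> ('v \<Rightarrow> complex) set set \<Rightarrow> ('v \<Rightarrow> complex) set set set" where
  "irreducible_components V bl X =
     {Y. Y \<subseteq> X \<and> zariski_irreducible V bl Y \<and>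
         (\<forall>Y'. Y \<subseteq> Y' \<and> Y' \<subseteq> X \<and> zariski_irreducible V bl Y' \<longrightarrow> Y' = Y)}"

text \<open>
  A regular map is one that is given, near every point, by polynomials that are multihomogeneous of a
  common multidegree within each factor of the target.
\<close>

definition regular_map ::
  "'v set \<Rightarrow> ('v \<Rightarrow> 'b) \<Rightarrow> ('v \<Rightarrow> complex) set set \<Rightarrow>
   'u set \<Rightarrow> ('u \<Rightarrow> 'e) \<Rightarrow> ('u \<Rightarrow> complex) set set \<Rightarrow>
   (('v \<Rightarrow> complex) set \<Rightarrow> ('u \<Rightarrow> complex) set) \<Rightarrow> bool" where
  "regular_map V bl X U bl' Y f \<longleftrightarrow>
     f \<in> X \<rightarrow> Y \<and>
     (\<forall>c\<in>X. \<exists>F :: 'u \<Rightarrow> 'v cpoly.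
        (\<forall>b. \<exists>D. \<forall>u\<in>U. bl' u = b \<longrightarrow> multihom V bl D (F u)) \<and>
        (\<forall>x\<in>c. (\<lambda>u. if u \<in> U then poly_eval x (F u) else 0) \<in> mproj_vec U bl') \<and>
        (\<forall>c'\<in>X. \<forall>x\<in>c'.
           (\<lambda>u. if u \<in> U then poly_eval x (F u) else 0) \<in> mproj_vec U bl' \<longrightarrow>
           (\<lambda>u. if u \<in> U then poly_eval x (F u) else 0) \<in> f c'))"

definition isomorphic_varieties ::
  "'v set \<Rightarrow> ('v \<Rightarrow> 'b) \<Rightarrow> ('v \<Rightarrow> complex) set set \<Rightarrow>
   'u set \<Rightarrow> ('u \<Rightarrow> 'e) \<Rightarrow> ('u \<Rightarrow> complex) set set \<Rightarrow> bool" where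
  "isomorphic_varieties V bl X U bl' Y \<longleftrightarrow>
     (\<exists>f. bij_betw f X Y \<and> regular_map V bl X U bl' Y f \<and>
          regular_map U bl' Y V bl X (inv_into X f))"

section \<open>Projective toric varieties\<close>

text \<open>
  For a finite set \<open>A\<close> of lattice points (finitely supported integer vectors), the closure in
  \<open>\<P>\<^sup>A\<close> of the set of all points with homogeneous coordinates \<open>(t\<^sup>a)\<close>, \<open>a \<in> A\<close>, where \<open>t\<close> runs over
  the torus.
\<close>

definition monomial_point :: "('p \<Rightarrow>\<^sub>0 int) set \<Rightarrow> ('p \<Rightarrow> complex) \<Rightarrow> ('p \<Rightarrow>\<^sub>0 int) \<Rightarrow> complex" where
  "monomial_point A t a =
     (if a \<in> A then (\<Prod>p \<in> Poly_Mapping.keys a. t p powi Poly_Mapping.lookup a p) else 0)"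

definition toric_closure :: "('p \<Rightarrow>\<^sub>0 int) set \<Rightarrow> (('p \<Rightarrow>\<^sub>0 int) \<Rightarrow> complex) set set" where
  "toric_closure A =
     zariski_closure A (\<lambda>_. ())
       {mproj_rel A (\<lambda>_. ()) `` {monomial_point A t} | t. \<forall>p. t p \<noteq> 0}"

text \<open>Not necessarily normal projective toric varieties, up to isomorphism.\<close>

definition toric_variety :: "'v set \<Rightarrow> ('v \<Rightarrow> 'b) \<Rightarrow> ('v \<Rightarrow> complex) set set \<Rightarrow> bool" where
  "toric_variety V bl X \<longleftrightarrow>
     (\<exists>A :: (nat \<Rightarrow>\<^sub>0 int) set. finite A \<and> A \<noteq> {} \<and>
        isomorphic_varieties V bl X A (\<lambda>_. ()) (toric_closure A))"

definition semitoric :: "'v set \<Rightarrow> ('v \<Rightarrow> 'b) \<Rightarrow> ('v \<Rightarrow> complex) set set \<Rightarrow> bool" where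
  "semitoric V bl X \<longleftrightarrow> (\<forall>Z \<in> irreducible_components V bl X. toric_variety V bl Z)"

text \<open>
  The toric variety of a lattice polytope \<open>Q\<close> is embedded by the lattice points of a very ample
  dilate of \<open>Q\<close>; its isomorphism class does not depend on the choice of the dilate.  A lattice
  polytope is very ample if at each vertex \<open>v\<close> the semigroup generated by the \<open>a - v\<close>, with \<open>a\<close> a
  lattice point of the polytope, is saturated.
\<close>

definition real_vec :: "('p \<Rightarrow>\<^sub>0 int) \<Rightarrow> ('p \<Rightarrow>\<^sub>0 real)" where
  "real_vec a = Poly_Mapping.map real_of_int a"

definition lattice_points :: "('p \<Rightarrow>\<^sub>0 real) set \<Rightarrow> ('p \<Rightarrow>\<^sub>0 int) set" where
  "lattice_points Q = {a. real_vec a \<in> Q}"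

definition semigroup_gen :: "('p \<Rightarrow>\<^sub>0 int) set \<Rightarrow> ('p \<Rightarrow>\<^sub>0 int) set" where
  "semigroup_gen B = (\<lambda>S. 0 \<in> S \<and> (\<forall>x\<in>S. \<forall>y\<in>S. x + y \<in> S)) hull B"

definition saturated :: "('p \<Rightarrow>\<^sub>0 int) set \<Rightarrow> bool" where
  "saturated S \<longleftrightarrow>
     (\<forall>x. \<forall>k::nat. k > 0 \<longrightarrow> Poly_Mapping.map ((*) (int k)) x \<in> S \<longrightarrow> x \<in> S)"

definition very_ample :: "('p \<Rightarrow>\<^sub>0 real) set \<Rightarrow> bool" where
  "very_ample Q \<longleftrightarrow>
     (\<forall>v. real_vec v extreme_point_of Q \<longrightarrow>
        saturated (semigroup_gen ((\<lambda>a. a - v) ` lattice_points Q)))"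

definition toric_exponents :: "('p \<Rightarrow>\<^sub>0 real) set \<Rightarrow> ('p \<Rightarrow>\<^sub>0 int) set" where
  "toric_exponents Q =
     lattice_points ((*\<^sub>R) (real (LEAST k. k > 0 \<and> very_ample ((*\<^sub>R) (real k) ` Q))) ` Q)"

definition isomorphic_to_toric_variety_of ::
  "'v set \<Rightarrow> ('v \<Rightarrow> 'b) \<Rightarrow> ('v \<Rightarrow> complex) set set \<Rightarrow> ('p \<Rightarrow>\<^sub>0 real) set \<Rightarrow> bool" where
  "isomorphic_to_toric_variety_of V bl X Q \<longleftrightarrow>
     isomorphic_varieties V bl X
       (toric_exponents Q) (\<lambda>_. ()) (toric_closure (toric_exponents Q))"

section \<open>Polyhedral subdivisions\<close>

text \<open>The library's \<open>aff_dim\<close> is restricted to Euclidean spaces.\<close>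

definition affine_dim :: "'a::real_vector set \<Rightarrow> int" where
  "affine_dim S = (if S = {} then - 1 else int (dim {x - y | x y. x \<in> S \<and> y \<in> S}))"

definition polyhedral_complex :: "'a::real_vector set set \<Rightarrow> bool" where
  "polyhedral_complex K \<longleftrightarrow>
     finite K \<and> (\<forall>F\<in>K. polytope F) \<and> (\<forall>F\<in>K. \<forall>G. G face_of F \<longrightarrow> G \<in> K) \<and>
     (\<forall>F\<in>K. \<forall>G\<in>K. F \<inter> G face_of F \<and> F \<inter> G face_of G)"

definition polyhedral_subdivision :: "'a::real_vector set set \<Rightarrow> 'a set \<Rightarrow> bool" where
  "polyhedral_subdivision S Q \<longleftrightarrow>
     (\<forall>C\<in>S. polytope C \<and> affine_dim C = affine_dim Q) \<and> \<Union>S = Q \<and>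
     polyhedral_complex {F. \<exists>C\<in>S. F face_of C}"

section \<open>Marked relative poset polytopes\<close>

text \<open>
  Orders are reflexive relations (\<open>partial_order_on\<close>).  An order on \<open>P\<close> is also used to form ideals of
  a subset of \<open>P\<close> with the induced order.
\<close>

definition order_ideals :: "'p set \<Rightarrow> 'p rel \<Rightarrow> 'p set set" where
  "order_ideals P r = {J. J \<subseteq> P \<and> (\<forall>q\<in>J. \<forall>p\<in>P. (p, q) \<in> r \<longrightarrow> p \<in> J)}"

definition stronger_order :: "'p set \<Rightarrow> 'p rel \<Rightarrow> 'p rel \<Rightarrow> bool" where
  "stronger_order P r r' \<longleftrightarrow> partial_order_on P r' \<and> r \<subseteq> r'"

text \<open>The indicator vector of a finite set.\<close>

definition ind_vec :: "'p set \<Rightarrow> ('p \<Rightarrow>\<^sub>0 real)" where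
  "ind_vec A = (\<Sum>p\<in>A. Poly_Mapping.single p 1)"

definition fund_polytope :: "'p set \<Rightarrow> 'p set \<Rightarrow> 'p rel \<Rightarrow> 'p set \<Rightarrow> ('p \<Rightarrow>\<^sub>0 real) set" where
  "fund_polytope P Pm r K = convex hull (ind_vec ` {J \<in> order_ideals P r. J \<inter> Pm = K})"

text \<open>
  \<open>\<alpha>\<close> records the coefficients of an expression of \<open>lam\<close> as a nonnegative integer combination of
  indicator vectors of a chain of nonempty ideals of \<open>Pm\<close>.
\<close>

definition chain_expression :: "'p set \<Rightarrow> 'p rel \<Rightarrow> ('p \<Rightarrow>\<^sub>0 real) \<Rightarrow> ('p set \<Rightarrow> nat) \<Rightarrow> bool" where
  "chain_expression Pm r lam \<alpha> \<longleftrightarrow>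
     (\<forall>K. \<alpha> K \<noteq> 0 \<longrightarrow> K \<in> order_ideals Pm r \<and> K \<noteq> {}) \<and>
     (\<forall>K L. \<alpha> K \<noteq> 0 \<longrightarrow> \<alpha> L \<noteq> 0 \<longrightarrow> K \<subseteq> L \<or> L \<subseteq> K) \<and>
     lam = (\<Sum>K | \<alpha> K \<noteq> 0. real (\<alpha> K) *\<^sub>R ind_vec K)"

text \<open>
  The marked relative poset polytope of \<open>(P, <, <\<^sub>\<emptyset>)\<close>, where \<open>Pm\<close> is the set of marked elements and
  the second order is trivial.  The sum over \<open>K\<close> is the Minkowski sum of sets.
\<close>

definition marked_polytope :: "'p set \<Rightarrow> 'p set \<Rightarrow> 'p rel \<Rightarrow> ('p \<Rightarrow>\<^sub>0 real) \<Rightarrow> ('p \<Rightarrow>\<^sub>0 real) set" where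
  "marked_polytope P Pm r lam =
     (let \<alpha> = (THE \<alpha>. chain_expression Pm r lam \<alpha>)
      in \<Sum>K | \<alpha> K \<noteq> 0. (*\<^sub>R) (real (\<alpha> K)) ` fund_polytope P Pm r K)"

section \<open>The flag setting\<close>

text \<open>
  The dimensions are \<open>d 0 < \<dots> < d l\<close>.  The index \<open>a\<^sub>1 < \<dots> < a\<^sub>k\<close> of a Pluecker variable is a strictly
  increasing list, so that \<open>a\<^sub>i\<close> is \<open>a ! (i - 1)\<close>, and the poset element with indices \<open>i, j\<close> is the
  pair \<open>(i, j)\<close>.  The product of the projectivized exterior powers of degrees \<open>d 0, \<dots>, d l\<close> of
  \<open>\<complex>\<^sup>n\<close> is \<open>mproj (pl_vars n l d) length\<close>.
\<close>

definition pl_vars :: "nat \<Rightarrow> nat \<Rightarrow> (nat \<Rightarrow> nat) \<Rightarrow> nat list set" where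
  "pl_vars n l d = {a. sorted_wrt (<) a \<and> set a \<subseteq> {1..n} \<and> length a \<in> d ` {0..l}}"

definition gt_binomial :: "nat list \<Rightarrow> nat list \<Rightarrow> nat list cpoly" where
  "gt_binomial a b =
     (let s = length a - length b
      in Var a * Var b
         - Var (map2 min (drop s a) b) * Var (take s a @ map2 max (drop s a) b))"

definition gt_ideal :: "nat \<Rightarrow> nat \<Rightarrow> (nat \<Rightarrow> nat) \<Rightarrow> nat list cpoly set" where
  "gt_ideal n l d =
     lin_combs (polys (pl_vars n l d))
       {gt_binomial a b | a b.
          a \<in> pl_vars n l d \<and> b \<in> pl_vars n l d \<and> length b \<le> length a}"

definition gt_marked_elem :: "(nat \<Rightarrow> nat) \<Rightarrow> nat \<Rightarrow> nat \<times> nat" where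
  "gt_marked_elem d i = (d (i - 1) + 1, d i)"

definition gt_marked :: "nat \<Rightarrow> (nat \<Rightarrow> nat) \<Rightarrow> (nat \<times> nat) set" where
  "gt_marked l d = gt_marked_elem d ` {1..l}"

definition gt_poset :: "nat \<Rightarrow> nat \<Rightarrow> (nat \<Rightarrow> nat) \<Rightarrow> (nat \<times> nat) set" where
  "gt_poset n l d =
     gt_marked l d \<union> (\<Union>r\<in>{1..<l}. {(i, j). 1 \<le> i \<and> i \<le> d r \<and> d r < j \<and> j \<le> n})"

definition gt_order :: "nat \<Rightarrow> nat \<Rightarrow> (nat \<Rightarrow> nat) \<Rightarrow> (nat \<times> nat) rel" where
  "gt_order n l d =
     {(p, q). p \<in> gt_poset n l d \<and> q \<in> gt_poset n l d \<and> fst p \<le> fst q \<and> snd p \<le> snd q}"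

definition gt_weight :: "nat \<Rightarrow> (nat \<Rightarrow> nat) \<Rightarrow> (nat \<times> nat \<Rightarrow>\<^sub>0 real)" where
  "gt_weight l d = (\<Sum>i = 1..l. ind_vec (gt_marked_elem d ` {1..i}))"

definition gt_polytope ::
  "nat \<Rightarrow> nat \<Rightarrow> (nat \<Rightarrow> nat) \<Rightarrow> (nat \<times> nat) rel \<Rightarrow> (nat \<times> nat \<Rightarrow>\<^sub>0 real) set" where
  "gt_polytope n l d r = marked_polytope (gt_poset n l d) (gt_marked l d) r (gt_weight l d)"

definition incomparable_ideal :: "'p set \<Rightarrow> 'p rel \<Rightarrow> 'p set cpoly set" where
  "incomparable_ideal P r =
     lin_combs (polys (order_ideals P r))
       {Var J * Var J' | J J'.
          J \<in> order_ideals P r \<and> J' \<in> order_ideals P r \<and> \<not> J \<subseteq> J' \<and> \<not> J' \<subseteq> J}"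

definition gt_order_ideal ::
  "nat \<Rightarrow> nat \<Rightarrow> (nat \<Rightarrow> nat) \<Rightarrow> nat list \<Rightarrow> (nat \<times> nat) set" where
  "gt_order_ideal n l d a =
     {(i, j) \<in> gt_poset n l d. i \<le> length a \<and> j \<le> a ! (length a - i) + i - 1}"

definition psi_GT ::
  "nat \<Rightarrow> nat \<Rightarrow> (nat \<Rightarrow> nat) \<Rightarrow> nat list cpoly \<Rightarrow> (nat \<times> nat) set cpoly" where
  "psi_GT n l d = poly_subst Const (\<lambda>a. Var (gt_order_ideal n l d a))"

definition gt_monomial_ideal :: "nat \<Rightarrow> nat \<Rightarrow> (nat \<Rightarrow> nat) \<Rightarrow> nat list cpoly set" where
  "gt_monomial_ideal n l d =
     {p \<in> polys (pl_vars n l d).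
        psi_GT n l d p \<in> incomparable_ideal (gt_poset n l d) (gt_order n l d)}"

definition gt_degeneration ::
  "nat \<Rightarrow> nat \<Rightarrow> (nat \<Rightarrow> nat) \<Rightarrow> (nat list \<Rightarrow> real) \<Rightarrow> (nat list \<Rightarrow> complex) set set" where
  "gt_degeneration n l d w =
     zero_set (pl_vars n l d) length (initial_ideal w (gt_ideal n l d))"

end

theory Submission
  imports Defs "HOL-Computational_Algebra.Polynomial"
begin

text \<open>
  The bijection between Pluecker coordinates and order ideals turns the generators of the ideal into the Hibi
  relations \<open>X\<^sub>J X\<^sub>K - X\<^bsub>J \<inter> K\<^esub> X\<^bsub>J \<union> K\<^esub>\<close>, and comparing initial forms of these relations shows that every
  \<open>w\<close> in the closed cone satisfies \<open>w(J) + w(K) \<le> w(J \<inter> K) + w(J \<union> K)\<close>.  For such a function, linear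
  interpolation along any maximal chain of order ideals is a modular majorant.  The order ideals on
  which a majorant of this kind is tight form a sublattice (a cell) containing a maximal chain, hence
  the lattice of order ideals of a stronger order on the same set.  The upper level
  sets of a point of the polytope form a chain of order ideals, and the point lies in the polytope of
  every cell that contains this chain, which gives the subdivision.

  The initial ideal vanishes on the toric locus of each cell, since within a multidegree the weights
  of monomials are bounded by the majorant.  Conversely, at a common zero of the initial ideal, sorting
  the product of all nonvanishing coordinates into a chain by meets and joins yields a nonzero monomial
  of the same weight; a majorant for that chain is tight on all nonvanishing coordinates, so the
  point lies in the toric locus of a cell.  Finally, the polytopes are normal, because a lattice point
  is the sum of the indicators of its level sets, and the Segre embedding identifies each toric locus
  with the toric variety of the polytope.
\<close>

section \<open>Evaluation of polynomials\<close>

text \<open>Only zero sets are compared, so no Groebner basis, radical or saturation is computed.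
  The ideal enters through two facts: it contains a Hibi relation for every pair of order ideals,
  which bounds the zero set of the initial ideal from above, and it vanishes on the monomial
  parametrization, which bounds it from below. Toric pieces are described by binomial equations
  instead of closures. Closedness is then immediate; irreducibility needs a proof and comes from
  restricting to a curve in the torus on which polynomials become univariate. Exponents are extended
  by one degree per projective factor to make the equations multihomogeneous. The other obstacle is
  that the toric variety of a polytope is defined through its least very ample dilate. Normality
  shows that this dilate is the polytope itself. Its lattice points are then the sums of one ideal
  indicator per block, which are precisely the exponents of the Segre coordinates. The block of the
  empty ideal comes from \<open>d 0 = 0\<close>; its factor is a single point and adds nothing to
  the exponents.\<close>

definition monom_of :: "'v list \<Rightarrow> 'v monom" where
  "monom_of us = (\<Sum>v\<leftarrow>us. Poly_Mapping.single v 1)"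

lemma monom_of_simps [simp]:
  "monom_of [] = 0" "monom_of (v # us) = Poly_Mapping.single v 1 + monom_of us"
  "monom_of (us @ us') = monom_of us + monom_of us'"
  by (simp_all add: monom_of_def)

lemma lookup_monom_of: "Poly_Mapping.lookup (monom_of us) v = count_list us v"
  by (induction us) (auto simp: lookup_add lookup_single)

lemma keys_monom_of: "Poly_Mapping.keys (monom_of us) = set us"
  by (auto simp: in_keys_iff lookup_monom_of count_list_0_iff)

text \<open>Presenting a monomial by a list of its variables turns additivity and evaluation
  statements into list inductions.\<close>

lemma ex_monom_of: "\<exists>us. m = monom_of us"
proof -
  obtain us where us: "mset us = Abs_multiset (Poly_Mapping.lookup m)"
    using ex_mset by blast
  have "Poly_Mapping.lookup m v = count_list us v" for v
  proof -
    have "count (mset us) v = Poly_Mapping.lookup m v"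
      unfolding us by (subst count_Abs_multiset) auto
    then show ?thesis by (simp add: count_mset)
  qed
  then show ?thesis
    by (auto intro!: poly_mapping_eqI simp: lookup_monom_of)
qed

definition monom_eval :: "('v \<Rightarrow> 'a::comm_monoid_mult) \<Rightarrow> 'v monom \<Rightarrow> 'a" where
  "monom_eval x m = (\<Prod>v \<in> Poly_Mapping.keys m. x v ^ Poly_Mapping.lookup m v)"

lemma monom_eval_monom_of: "monom_eval x (monom_of us) = prod_list (map x us)"
  using image_prod_mset_multiplicity[of x "mset us"]
  by (simp add: monom_eval_def keys_monom_of lookup_monom_of count_mset flip: prod_mset_prod_list)

lemma monom_eval_add: "monom_eval x (m + m') = monom_eval x m * monom_eval x m'"
proof -
  obtain us us' where "m = monom_of us" "m' = monom_of us'"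
    using ex_monom_of by metis
  then show ?thesis
    using monom_eval_monom_of[of x "us @ us'"] by (simp add: monom_eval_monom_of)
qed

lemma poly_sum_single: "(\<Sum>m\<in>Poly_Mapping.keys p. Poly_Mapping.single m (Poly_Mapping.lookup p m)) = p"
  by (rule poly_mapping_eqI)
    (auto simp: lookup_sum lookup_single when_def in_keys_iff sum.delta' if_distrib cong: if_cong)

lemma poly_subst_altdef:
  "poly_subst h f p = (\<Sum>m \<in> Poly_Mapping.keys p. h (Poly_Mapping.lookup p m) * monom_eval f m)"
  by (simp add: poly_subst_def monom_eval_def)

context
  fixes h :: "complex \<Rightarrow> 'a::comm_ring_1" and f :: "'v \<Rightarrow> 'a"
  assumes h_zero: "h 0 = 0" and h_add: "\<And>a b. h (a + b) = h a + h b"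
begin

lemma poly_subst_add: "poly_subst h f (p + q) = poly_subst h f p + poly_subst h f q"
  unfolding poly_subst_altdef
  by (rule setsum_keys_plus_distrib) (simp_all add: h_zero h_add algebra_simps)

lemma poly_subst_single: "poly_subst h f (Poly_Mapping.single m c) = h c * monom_eval f m"
  by (cases "c = 0") (auto simp: poly_subst_altdef h_zero)

lemma poly_subst_zero: "poly_subst h f 0 = 0"
  by (simp add: poly_subst_altdef)

lemma poly_subst_uminus: "poly_subst h f (- p) = - poly_subst h f p"
  using poly_subst_add[of p "- p"] by (simp add: poly_subst_zero add_eq_0_iff)

lemma poly_subst_diff: "poly_subst h f (p - q) = poly_subst h f p - poly_subst h f q"
  using poly_subst_add[of p "- q"] by (simp add: poly_subst_uminus)

lemma poly_subst_sum: "poly_subst h f (\<Sum>i\<in>A. F i) = (\<Sum>i\<in>A. poly_subst h f (F i))"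
  by (induction A rule: infinite_finite_induct) (simp_all add: poly_subst_zero poly_subst_add)

lemma poly_subst_mult:
  assumes h_mult: "\<And>a b. h (a * b) = h a * h b"
  shows "poly_subst h f (p * q) = poly_subst h f p * poly_subst h f q"
proof -
  let ?s = "\<lambda>p m. Poly_Mapping.single m (Poly_Mapping.lookup p m)"
  have "poly_subst h f (p * q) =
      poly_subst h f ((\<Sum>m\<in>Poly_Mapping.keys p. ?s p m) * (\<Sum>m\<in>Poly_Mapping.keys q. ?s q m))"
    by (simp only: poly_sum_single)
  also have "\<dots> = (\<Sum>m\<in>Poly_Mapping.keys p. \<Sum>m'\<in>Poly_Mapping.keys q.
      (h (Poly_Mapping.lookup p m) * monom_eval f m) * (h (Poly_Mapping.lookup q m') * monom_eval f m'))"
    by (simp add: sum_product mult_single poly_subst_sum poly_subst_single h_mult monom_eval_add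
        ac_simps)
  also have "\<dots> = poly_subst h f p * poly_subst h f q"
    by (simp add: sum_product poly_subst_altdef)
  finally show ?thesis .
qed

end

lemmas poly_eval_ring_hom =
  poly_subst_zero[of "\<lambda>c. c", simplified] poly_subst_add[of "\<lambda>c. c", simplified]
  poly_subst_diff[of "\<lambda>c. c", simplified] poly_subst_uminus[of "\<lambda>c. c", simplified]
  poly_subst_sum[of "\<lambda>c. c", simplified] poly_subst_mult[of "\<lambda>c. c", simplified]
  poly_subst_single[of "\<lambda>c. c", simplified]

lemma monom_eval_single [simp]: "monom_eval x (Poly_Mapping.single v (Suc 0)) = x v"
  by (simp add: monom_eval_def)

lemma monom_eval_zero [simp]: "monom_eval x 0 = 1"
  by (simp add: monom_eval_def)

lemma poly_eval_Var [simp]: "poly_eval x (Var v) = x v"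
  by (simp add: Var_def poly_eval_ring_hom)

lemma poly_eval_Const [simp]: "poly_eval x (Const c) = c"
  by (simp add: Const_def poly_eval_ring_hom)

lemma poly_eval_one [simp]: "poly_eval x 1 = 1"
  using poly_eval_ring_hom(7)[of x 0 1] by simp

lemma poly_eval_lin_combs:
  assumes "p \<in> lin_combs R G" "\<And>g. g \<in> G \<Longrightarrow> poly_eval x g = 0"
  shows "poly_eval x p = 0"
proof -
  obtain F c where F: "p = (\<Sum>g\<in>F. c g * g)" "F \<subseteq> G"
    using assms(1) unfolding lin_combs_def by blast
  show ?thesis
    unfolding F(1) poly_eval_ring_hom using F(2) assms(2) by (intro sum.neutral) auto
qed

text \<open>With this, vanishing of an image under \<open>psi_GT\<close> is tested at a pulled-back
  point, without inverting the isomorphism.\<close>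

lemma poly_eval_poly_subst_Const:
  "poly_eval x (poly_subst Const f p) = poly_eval (\<lambda>v. poly_eval x (f v)) p"
proof -
  have "poly_eval x (monom_eval f m) = monom_eval (\<lambda>v. poly_eval x (f v)) m" for m
  proof -
    obtain us where us: "m = monom_of us" using ex_monom_of by blast
    show ?thesis unfolding us monom_eval_monom_of
      by (induction us) (simp_all add: poly_eval_ring_hom)
  qed
  then show ?thesis
    unfolding poly_subst_altdef[of Const] poly_eval_ring_hom
    by (simp add: poly_subst_altdef[of _ _ p])
qed

section \<open>Kronecker substitution\<close>

text \<open>Mixed-radix encoding: the new index gets a weight \<open>K\<close> larger than every
  value already attained on \<open>T\<close>, so division by \<open>K\<close> recovers the new entry
  and the remainder encodes the others.\<close>

lemma ex_separating_weights:
  fixes T :: "('i \<Rightarrow> nat) set"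
  assumes "finite I" "finite T"
  shows "\<exists>k. \<forall>a\<in>T. \<forall>b\<in>T. (\<Sum>i\<in>I. k i * a i) = (\<Sum>i\<in>I. k i * b i) \<longrightarrow> (\<forall>i\<in>I. a i = b i)"
  using assms(1)
proof (induction I)
  case empty
  then show ?case by simp
next
  case (insert j I)
  then obtain k where
    k: "\<And>a b. \<lbrakk>a \<in> T; b \<in> T; (\<Sum>i\<in>I. k i * a i) = (\<Sum>i\<in>I. k i * b i)\<rbrakk> \<Longrightarrow> \<forall>i\<in>I. a i = b i"
    by blast
  define K where "K = Suc (\<Sum>a\<in>T. \<Sum>i\<in>I. k i * a i)"
  have K: "(\<Sum>i\<in>I. k i * a i) < K" if "a \<in> T" for a
    unfolding K_def less_Suc_eq_le
    using member_le_sum[of a T "\<lambda>a. \<Sum>i\<in>I. k i * a i"] that assms(2) by simp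
  have sum_eq: "(\<Sum>i\<in>insert j I. (k(j := K)) i * a i) = K * a j + (\<Sum>i\<in>I. k i * a i)" for a
    using insert.hyps by (auto intro!: sum.cong)
  have "\<forall>i\<in>insert j I. a i = b i"
    if ab: "a \<in> T" "b \<in> T"
      and eq: "(\<Sum>i\<in>insert j I. (k(j := K)) i * a i) = (\<Sum>i\<in>insert j I. (k(j := K)) i * b i)" for a b
  proof -
    have eq': "K * a j + (\<Sum>i\<in>I. k i * a i) = K * b j + (\<Sum>i\<in>I. k i * b i)"
      using eq by (simp only: sum_eq)
    have "a j = (K * a j + (\<Sum>i\<in>I. k i * a i)) div K" "b j = (K * b j + (\<Sum>i\<in>I. k i * b i)) div K"
      using K[OF ab(1)] K[OF ab(2)] by (simp_all add: div_mult_self4)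
    then have "a j = b j" using eq' by simp
    then show ?thesis using k[OF ab] eq' by simp
  qed
  then show ?case by blast
qed

definition monom_deg :: "('v \<Rightarrow> 'i \<Rightarrow> nat) \<Rightarrow> 'v monom \<Rightarrow> 'i \<Rightarrow> nat" where
  "monom_deg E m i = (\<Sum>v\<in>Poly_Mapping.keys m. Poly_Mapping.lookup m v * E v i)"

lemma monom_deg_monom_of: "monom_deg E (monom_of us) i = (\<Sum>v\<leftarrow>us. E v i)"
  by (simp add: monom_deg_def keys_monom_of lookup_monom_of sum_list_map_eq_sum_count)

definition torus_point :: "'v set \<Rightarrow> 'i set \<Rightarrow> ('v \<Rightarrow> 'i \<Rightarrow> nat) \<Rightarrow> ('i \<Rightarrow> complex) \<Rightarrow> 'v \<Rightarrow> complex" where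
  "torus_point W I E t v = (if v \<in> W then \<Prod>i\<in>I. t i ^ E v i else 0)"

definition fiber :: "'v set \<Rightarrow> 'i set \<Rightarrow> ('v \<Rightarrow> 'i \<Rightarrow> nat) \<Rightarrow> 'v monom \<Rightarrow> 'v monom set" where
  "fiber W I E m0 =
     {m. Poly_Mapping.keys m \<subseteq> W \<and> (\<forall>i\<in>I. monom_deg E m i = monom_deg E m0 i)}"

text \<open>These sums are the coefficients of the polynomial in \<open>t\<close> obtained by
  substituting \<open>torus_point\<close> for the variables, so for finite \<open>I\<close> the
  predicate says that \<open>p\<close> lies in the toric ideal.\<close>

definition fiber_sums_zero :: "'v set \<Rightarrow> 'i set \<Rightarrow> ('v \<Rightarrow> 'i \<Rightarrow> nat) \<Rightarrow> 'v cpoly \<Rightarrow> bool" where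
  "fiber_sums_zero W I E p \<longleftrightarrow>
     (\<forall>m0. (\<Sum>m \<in> Poly_Mapping.keys p \<inter> fiber W I E m0. Poly_Mapping.lookup p m) = 0)"

lemma monom_eval_eq_0:
  fixes x :: "'v \<Rightarrow> complex"
  assumes "\<And>v. v \<notin> W \<Longrightarrow> x v = 0" "\<not> Poly_Mapping.keys m \<subseteq> W"
  shows "monom_eval x m = 0"
  using assms by (auto simp: monom_eval_def in_keys_iff)

lemma monom_eval_torus_point_power:
  assumes "finite I" "Poly_Mapping.keys m \<subseteq> W"
  shows "monom_eval (torus_point W I E (\<lambda>i. s ^ k i)) m = s ^ (\<Sum>i\<in>I. k i * monom_deg E m i)"
proof -
  obtain us where us: "m = monom_of us" using ex_monom_of by blast
  have "set us \<subseteq> W" using assms us by (simp add: keys_monom_of)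
  then show ?thesis
    unfolding us monom_eval_monom_of monom_deg_monom_of
    by (induction us)
      (auto simp: torus_point_def power_add power_sum sum.distrib distrib_left simp flip: power_mult)
qed

text \<open>Primality of the toric ideal. On the curve \<open>t i = s ^ k i\<close>, with
  \<open>k\<close> separating all degrees that occur, both factors become univariate polynomials in
  \<open>s\<close> whose coefficients are the fiber sums; their product has infinitely many roots,
  so one of them is zero.\<close>

lemma torus_product_zero:
  fixes f h :: "'v cpoly"
  assumes "finite I"
    and zero: "\<And>t. (\<forall>i. t i \<noteq> 0) \<Longrightarrow>
      poly_eval (torus_point W I E t) f * poly_eval (torus_point W I E t) h = 0"
  shows "fiber_sums_zero W I E f \<or> fiber_sums_zero W I E h"
proof -
  let ?K = Poly_Mapping.keys and ?L = Poly_Mapping.lookup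
  have "finite (monom_deg E ` (?K f \<union> ?K h))" by (intro finite_imageI finite_UnI finite_keys)
  from ex_separating_weights[OF \<open>finite I\<close> this] obtain k where
    k0: "\<forall>a \<in> monom_deg E ` (?K f \<union> ?K h). \<forall>b \<in> monom_deg E ` (?K f \<union> ?K h).
        (\<Sum>i\<in>I. k i * a i) = (\<Sum>i\<in>I. k i * b i) \<longrightarrow> (\<forall>i\<in>I. a i = b i)"
    by blast
  have k: "\<forall>i\<in>I. monom_deg E m i = monom_deg E m' i"
    if "m \<in> ?K f \<union> ?K h" "m' \<in> ?K f \<union> ?K h"
      "(\<Sum>i\<in>I. k i * monom_deg E m i) = (\<Sum>i\<in>I. k i * monom_deg E m' i)"
    for m m'
    using k0 that by blast
  define enc where "enc m = (\<Sum>i\<in>I. k i * monom_deg E m i)" for m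
  define up where "up p = (\<Sum>m | m \<in> ?K p \<and> ?K m \<subseteq> W. monom (?L p m) (enc m))" for p :: "'v cpoly"
  have ev: "poly_eval (torus_point W I E (\<lambda>i. s ^ k i)) p = poly (up p) s" for p s
  proof -
    let ?x = "torus_point W I E (\<lambda>i. s ^ k i)"
    have "poly_eval ?x p = (\<Sum>m | m \<in> ?K p \<and> ?K m \<subseteq> W. ?L p m * monom_eval ?x m)"
      unfolding poly_subst_altdef
      by (rule sum.mono_neutral_right)
        (auto intro!: monom_eval_eq_0[where W=W] simp: torus_point_def)
    also have "\<dots> = poly (up p) s"
      unfolding up_def poly_sum
      by (rule sum.cong) (auto simp: monom_eval_torus_point_power[OF \<open>finite I\<close>] poly_monom enc_def)
    finally show ?thesis .
  qed
  have "poly (up f * up h) s = 0" if "s \<noteq> 0" for s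
    using zero[of "\<lambda>i. s ^ k i"] that by (simp add: ev)
  then have sub: "- {0} \<subseteq> {s. poly (up f * up h) s = 0}" by auto
  have "infinite (- {0::complex})"
    by (simp add: Compl_eq_Diff_UNIV infinite_UNIV_char_0)
  then have "infinite {s. poly (up f * up h) s = 0}"
    using sub finite_subset by blast
  then have "up f * up h = 0"
    using poly_roots_finite by blast
  then have "up f = 0 \<or> up h = 0" by simp
  moreover have "fiber_sums_zero W I E p" if p: "p = f \<or> p = h" "up p = 0" for p
    unfolding fiber_sums_zero_def
  proof
    fix m0
    show "(\<Sum>m \<in> ?K p \<inter> fiber W I E m0. ?L p m) = 0"
    proof (cases "?K p \<inter> fiber W I E m0 = {}")
      case False
      then obtain m1 where m1: "m1 \<in> ?K p" "m1 \<in> fiber W I E m0" by blast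
      \<comment> \<open>Since \<open>k\<close> separates the occurring degrees, equal exponents of
        \<open>s\<close> mean equal degrees on \<open>I\<close>, so one coefficient of
        \<open>up p\<close> is a complete fiber sum.\<close>
      have eq: "?K p \<inter> fiber W I E m0 = {m \<in> ?K p. ?K m \<subseteq> W \<and> enc m = enc m1}"
      proof (intro equalityI subsetI)
        fix m assume "m \<in> ?K p \<inter> fiber W I E m0"
        then show "m \<in> {m \<in> ?K p. ?K m \<subseteq> W \<and> enc m = enc m1}"
          using m1 by (auto simp: fiber_def enc_def)
      next
        fix m assume m: "m \<in> {m \<in> ?K p. ?K m \<subseteq> W \<and> enc m = enc m1}"
        then have "\<forall>i\<in>I. monom_deg E m i = monom_deg E m1 i"
          using k[of m m1] p(1) m1(1) by (auto simp: enc_def)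
        then show "m \<in> ?K p \<inter> fiber W I E m0"
          using m m1 by (auto simp: fiber_def)
      qed
      have "0 = coeff (up p) (enc m1)" using p by simp
      also have "\<dots> = (\<Sum>m | m \<in> ?K p \<and> ?K m \<subseteq> W. if enc m = enc m1 then ?L p m else 0)"
        by (simp add: up_def coeff_sum)
      also have "\<dots> = (\<Sum>m | m \<in> ?K p \<and> ?K m \<subseteq> W \<and> enc m = enc m1. ?L p m)"
        by (rule sum.mono_neutral_cong_right) auto
      finally show ?thesis by (simp add: eq)
    next
      case True
      show ?thesis unfolding True by (rule sum.empty)
    qed
  qed
  ultimately show ?thesis by blast
qed

text \<open>These are the binomial equations of the affine toric variety with exponents
  \<open>E\<close>. Unlike the parametrization, they also admit boundary points, where some
  coordinates in \<open>W\<close> vanish.\<close>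

definition toric_vec :: "'v set \<Rightarrow> 'i set \<Rightarrow> ('v \<Rightarrow> 'i \<Rightarrow> nat) \<Rightarrow> ('v \<Rightarrow> complex) \<Rightarrow> bool" where
  "toric_vec W I E x \<longleftrightarrow>
     (\<forall>v. v \<notin> W \<longrightarrow> x v = 0) \<and>
     (\<forall>us us'. set us \<subseteq> W \<longrightarrow> set us' \<subseteq> W \<longrightarrow>
        (\<forall>i\<in>I. (\<Sum>v\<leftarrow>us. E v i) = (\<Sum>v\<leftarrow>us'. E v i)) \<longrightarrow>
        prod_list (map x us) = prod_list (map x us'))"

lemma toric_vec_off: "toric_vec W I E x \<Longrightarrow> v \<notin> W \<Longrightarrow> x v = 0"
  by (simp add: toric_vec_def)

lemma toric_vec_prod_eq:
  assumes "toric_vec W I E x" "set us \<subseteq> W" "set us' \<subseteq> W"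
    "\<And>i. i \<in> I \<Longrightarrow> (\<Sum>v\<leftarrow>us. E v i) = (\<Sum>v\<leftarrow>us'. E v i)"
  shows "prod_list (map x us) = prod_list (map x us')"
  using assms unfolding toric_vec_def by blast

lemma toric_vec_monom_eval:
  assumes "toric_vec W I E x" "m \<in> fiber W I E m0" "m' \<in> fiber W I E m0"
  shows "monom_eval x m = monom_eval x m'"
proof -
  obtain us us' where "m = monom_of us" "m' = monom_of us'"
    using ex_monom_of by metis
  note m = this
  have "set us \<subseteq> W" "set us' \<subseteq> W" and
    "\<And>i. i \<in> I \<Longrightarrow> (\<Sum>v\<leftarrow>us. E v i) = (\<Sum>v\<leftarrow>us'. E v i)"
    using assms(2,3) by (auto simp: m fiber_def keys_monom_of monom_deg_monom_of)
  then show ?thesis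
    unfolding m monom_eval_monom_of by (rule toric_vec_prod_eq[OF assms(1)])
qed

text \<open>The binomial equations give all monomials of one fiber the same value at
  \<open>x\<close>, so grouping the terms by degree leaves fiber sums times common values.\<close>

lemma poly_eval_toric_vec:
  assumes "toric_vec W I E x" "fiber_sums_zero W I E p"
  shows "poly_eval x p = 0"
proof -
  let ?K = Poly_Mapping.keys and ?L = Poly_Mapping.lookup
  \<comment> \<open>Restricting the degree to \<open>I\<close> makes it a value by which the terms
    can be grouped, since \<open>fiber\<close> ignores indices outside \<open>I\<close>.\<close>
  let ?S = "{m \<in> ?K p. ?K m \<subseteq> W}" and ?h = "\<lambda>m. restrict (monom_deg E m) I"
  have "poly_eval x p = (\<Sum>m\<in>?S. ?L p m * monom_eval x m)"
    unfolding poly_subst_altdef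
    by (rule sum.mono_neutral_right)
      (auto intro!: monom_eval_eq_0[where W=W] toric_vec_off[OF assms(1)])
  also have "\<dots> = (\<Sum>y\<in>?h ` ?S. \<Sum>m | m \<in> ?S \<and> ?h m = y. ?L p m * monom_eval x m)"
    by (rule sum.group[symmetric]) auto
  also have "\<dots> = 0"
  proof (rule sum.neutral, rule ballI)
    fix y assume "y \<in> ?h ` ?S"
    then obtain m0 where m0: "m0 \<in> ?S" "y = ?h m0" by blast
    have eq: "{m. m \<in> ?S \<and> ?h m = y} = ?K p \<inter> fiber W I E m0"
      unfolding m0(2) fiber_def by (auto simp: fun_eq_iff restrict_def)
    have "(\<Sum>m | m \<in> ?S \<and> ?h m = y. ?L p m * monom_eval x m) =
        (\<Sum>m \<in> ?K p \<inter> fiber W I E m0. ?L p m * monom_eval x m0)"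
      unfolding eq
    proof (rule sum.cong[OF refl])
      fix m assume "m \<in> ?K p \<inter> fiber W I E m0"
      then have "monom_eval x m = monom_eval x m0"
        using m0 by (intro toric_vec_monom_eval[OF assms(1), of _ m0]) (auto simp: fiber_def)
      then show "?L p m * monom_eval x m = ?L p m * monom_eval x m0" by simp
    qed
    also have "\<dots> = 0"
      using assms(2) unfolding fiber_sums_zero_def sum_distrib_right[symmetric] by simp
    finally show "(\<Sum>m | m \<in> ?S \<and> ?h m = y. ?L p m * monom_eval x m) = 0" .
  qed
  finally show ?thesis .
qed

lemma toric_vec_torus_point:
  assumes "finite I" shows "toric_vec W I E (torus_point W I E t)"
proof -
  have eq: "prod_list (map (torus_point W I E t) us) = (\<Prod>i\<in>I. t i ^ (\<Sum>v\<leftarrow>us. E v i))"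
    if "set us \<subseteq> W" for us
    using that
  proof (induction us)
    case (Cons v us)
    then show ?case by (simp add: torus_point_def power_add prod.distrib)
  qed simp
  show ?thesis
    unfolding toric_vec_def
  proof (intro conjI allI impI)
    fix us us'
    assume "set us \<subseteq> W" "set us' \<subseteq> W" "\<forall>i\<in>I. (\<Sum>v\<leftarrow>us. E v i) = (\<Sum>v\<leftarrow>us'. E v i)"
    then show "prod_list (map (torus_point W I E t) us) = prod_list (map (torus_point W I E t) us')"
      unfolding eq[OF \<open>set us \<subseteq> W\<close>] eq[OF \<open>set us' \<subseteq> W\<close>] by (intro prod.cong) auto
  qed (simp add: torus_point_def)
qed

section \<open>Products of projective spaces\<close>

lemma monom_deg_add: "monom_deg E (m + m') i = monom_deg E m i + monom_deg E m' i"
proof -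
  obtain us us' where "m = monom_of us" "m' = monom_of us'"
    using ex_monom_of by metis
  then show ?thesis
    using monom_deg_monom_of[of E "us @ us'" i] by (simp add: monom_deg_monom_of)
qed

text \<open>Writing the multidegree as an instance of \<open>monom_deg\<close> lets it share the
  lemmas on exponents and be adjoined to them later.\<close>

definition block_deg :: "('v \<Rightarrow> 'b) \<Rightarrow> 'v \<Rightarrow> 'b \<Rightarrow> nat" where
  "block_deg bl v b = of_bool (bl v = b)"

lemma multihom_iff:
  "multihom V bl D p \<longleftrightarrow>
     p \<in> polys V \<and> (\<forall>m \<in> Poly_Mapping.keys p. monom_deg (block_deg bl) m = D)"
proof -
  have "(\<Sum>v | v \<in> Poly_Mapping.keys m \<and> bl v = b. Poly_Mapping.lookup m v) =
      monom_deg (block_deg bl) m b" for m b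
    unfolding monom_deg_def block_deg_def
    by (rule sum.mono_neutral_cong_left) auto
  then show ?thesis
    by (simp add: multihom_def fun_eq_iff)
qed

lemma ex_multihom: "multihom V bl D p \<Longrightarrow> \<exists>D. multihom V bl D p"
  by (rule exI[where P="\<lambda>D. multihom V bl D p"])

lemma multihom_zero [simp]: "multihom V bl D 0"
  by (simp add: multihom_iff polys_def)

lemma multihom_single:
  assumes "set us \<subseteq> V"
  shows "multihom V bl (\<lambda>b. \<Sum>v\<leftarrow>us. block_deg bl v b) (Poly_Mapping.single (monom_of us) 1)"
  using assms by (auto simp: multihom_iff polys_def keys_monom_of monom_deg_monom_of)

lemma multihom_Var: "v \<in> V \<Longrightarrow> multihom V bl (block_deg bl v) (Var v)"
  using multihom_single[of "[v]" V bl] by (simp add: Var_def)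

lemma multihom_diff: "multihom V bl D p \<Longrightarrow> multihom V bl D q \<Longrightarrow> multihom V bl D (p - q)"
  using keys_diff[of p q] unfolding multihom_iff polys_def by blast

lemma multihom_mult:
  assumes "multihom V bl D p" "multihom V bl D' q"
  shows "multihom V bl (\<lambda>b. D b + D' b) (p * q)"
  unfolding multihom_iff polys_def
proof (intro conjI CollectI ballI)
  fix m assume "m \<in> Poly_Mapping.keys (p * q)"
  then obtain m1 m2 where m: "m1 \<in> Poly_Mapping.keys p" "m2 \<in> Poly_Mapping.keys q" "m = m1 + m2"
    using keys_mult[of p q] by auto
  then show "Poly_Mapping.keys m \<subseteq> V"
    using assms Poly_Mapping.keys_add[of m1 m2] unfolding multihom_iff polys_def by blast
  have "monom_deg (block_deg bl) m1 = D" "monom_deg (block_deg bl) m2 = D'"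
    using assms m(1,2) unfolding multihom_iff by blast+
  then show "monom_deg (block_deg bl) m = (\<lambda>b. D b + D' b)"
    unfolding m(3) by (simp add: fun_eq_iff monom_deg_add)
qed

lemma prod_list_block_scaling:
  assumes "finite V" "set us \<subseteq> V"
  shows "prod_list (map (\<lambda>v. k (bl v)) us) =
    (\<Prod>b\<in>bl ` V. (k b :: complex) ^ (\<Sum>v\<leftarrow>us. block_deg bl v b))"
  using assms(2)
proof (induction us)
  case (Cons v us)
  have "(\<Prod>b\<in>bl ` V. k b ^ block_deg bl v b) = (\<Prod>b\<in>bl ` V. if b = bl v then k b else 1)"
    by (rule prod.cong) (auto simp: block_deg_def)
  also have "\<dots> = k (bl v)"
    using assms(1) Cons.prems by simp
  finally show ?case
    using Cons by (simp add: power_add prod.distrib)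
qed simp

lemma poly_eval_block_scaling:
  assumes "finite V" "multihom V bl D p"
  shows "poly_eval (\<lambda>v. k (bl v) * x v) p = (\<Prod>b\<in>bl ` V. k b ^ D b) * poly_eval x p"
proof -
  have "monom_eval (\<lambda>v. k (bl v) * x v) m = (\<Prod>b\<in>bl ` V. k b ^ D b) * monom_eval x m"
    if "m \<in> Poly_Mapping.keys p" for m
  proof -
    obtain us where us: "m = monom_of us" using ex_monom_of by blast
    have "set us \<subseteq> V" and D: "(\<Sum>v\<leftarrow>us. block_deg bl v b) = D b" for b
      using assms(2) that keys_monom_of[of us] monom_deg_monom_of[of "block_deg bl" us]
      unfolding multihom_iff us polys_def by auto
    moreover have "prod_list (map (\<lambda>v. k (bl v) * x v) us) =
        prod_list (map (\<lambda>v. k (bl v)) us) * prod_list (map x us)"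
      by (induction us) auto
    ultimately show ?thesis
      using prod_list_block_scaling[OF assms(1), of us k bl]
      by (simp add: us monom_eval_monom_of)
  qed
  then show ?thesis
    by (simp add: poly_subst_altdef sum_distrib_left mult.left_commute)
qed

definition proj_class :: "'v set \<Rightarrow> ('v \<Rightarrow> 'b) \<Rightarrow> ('v \<Rightarrow> complex) \<Rightarrow> ('v \<Rightarrow> complex) set" where
  "proj_class V bl x = mproj_rel V bl `` {x}"

lemma equiv_mproj_rel: "equiv (mproj_vec V bl) (mproj_rel V bl)"
proof (rule equivI)
  show "mproj_rel V bl \<subseteq> mproj_vec V bl \<times> mproj_vec V bl"
    by (auto simp: mproj_rel_def)
  show "refl_on (mproj_vec V bl) (mproj_rel V bl)"
    by (auto simp: refl_on_def mproj_rel_def intro!: exI[of _ "\<lambda>_. 1"])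
  show "sym (mproj_rel V bl)"
  proof (rule symI)
    fix x y assume "(x, y) \<in> mproj_rel V bl"
    then obtain c where "x \<in> mproj_vec V bl" "y \<in> mproj_vec V bl" "\<forall>b. c b \<noteq> 0"
      "\<forall>v\<in>V. y v = c (bl v) * x v"
      by (auto simp: mproj_rel_def)
    then show "(y, x) \<in> mproj_rel V bl"
      by (auto simp: mproj_rel_def intro!: exI[of _ "\<lambda>b. inverse (c b)"])
  qed
  show "trans (mproj_rel V bl)"
  proof (rule transI)
    fix x y z assume "(x, y) \<in> mproj_rel V bl" "(y, z) \<in> mproj_rel V bl"
    then obtain c c' where "x \<in> mproj_vec V bl" "z \<in> mproj_vec V bl" "\<forall>b. c b \<noteq> 0" "\<forall>b. c' b \<noteq> 0"
      "\<forall>v\<in>V. y v = c (bl v) * x v" "\<forall>v\<in>V. z v = c' (bl v) * y v"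
      by (auto simp: mproj_rel_def)
    then show "(x, z) \<in> mproj_rel V bl"
      by (auto simp: mproj_rel_def intro!: exI[of _ "\<lambda>b. c' b * c b"])
  qed
qed

lemma proj_class_in_mproj: "x \<in> mproj_vec V bl \<Longrightarrow> proj_class V bl x \<in> mproj V bl"
  by (auto simp: mproj_def proj_class_def intro: quotientI)

lemma proj_class_self: "x \<in> mproj_vec V bl \<Longrightarrow> x \<in> proj_class V bl x"
  unfolding proj_class_def by (rule equiv_class_self[OF equiv_mproj_rel])

lemma mprojE:
  assumes "c \<in> mproj V bl"
  obtains x where "x \<in> mproj_vec V bl" "x \<in> c" "c = proj_class V bl x"
proof -
  obtain x where "x \<in> mproj_vec V bl" "c = proj_class V bl x"
    using assms unfolding mproj_def proj_class_def by (rule quotientE)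
  then show thesis using that proj_class_self by metis
qed

lemma mproj_rep:
  assumes "c \<in> mproj V bl" "x \<in> c"
  shows "x \<in> mproj_vec V bl" "c = proj_class V bl x"
proof -
  obtain y where y: "y \<in> mproj_vec V bl" "c = proj_class V bl y"
    using assms(1) by (rule mprojE)
  then have yx: "(y, x) \<in> mproj_rel V bl"
    using assms(2) by (simp add: proj_class_def)
  then show "x \<in> mproj_vec V bl" by (auto simp: mproj_rel_def)
  show "c = proj_class V bl x"
    unfolding y(2) proj_class_def using equiv_class_eq[OF equiv_mproj_rel yx] .
qed

lemma proj_class_eqI:
  assumes "x \<in> mproj_vec V bl" "y \<in> mproj_vec V bl" "\<And>b. k b \<noteq> 0"
    "\<And>v. v \<in> V \<Longrightarrow> y v = k (bl v) * x v"
  shows "proj_class V bl x = proj_class V bl y"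
  unfolding proj_class_def
  by (rule equiv_class_eq[OF equiv_mproj_rel]) (use assms in \<open>auto simp: mproj_rel_def\<close>)

lemma proj_class_memD:
  assumes "y \<in> proj_class V bl x"
  obtains k where "\<And>b. k b \<noteq> 0" "y = (\<lambda>v. k (bl v) * x v)"
proof -
  obtain k where k: "\<And>b. k b \<noteq> 0" "\<And>v. v \<in> V \<Longrightarrow> y v = k (bl v) * x v"
    and "x \<in> mproj_vec V bl" "y \<in> mproj_vec V bl"
    using assms by (auto simp: proj_class_def mproj_rel_def)
  then have "y v = k (bl v) * x v" for v
    by (cases "v \<in> V") (auto simp: mproj_vec_def)
  with k show thesis using that by blast
qed

text \<open>Another representative differs by a scalar in each factor, which multiplies a
  multihomogeneous polynomial by a scalar; hence a single representative decides.\<close>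

lemma proj_class_in_zero_set_iff:
  assumes "finite V" "x \<in> mproj_vec V bl" "\<forall>p\<in>F. \<exists>D. multihom V bl D p"
  shows "proj_class V bl x \<in> zero_set V bl F \<longleftrightarrow> (\<forall>p\<in>F. poly_eval x p = 0)"
proof
  assume "proj_class V bl x \<in> zero_set V bl F"
  then show "\<forall>p\<in>F. poly_eval x p = 0"
    using proj_class_self[OF assms(2)] by (auto simp: zero_set_def)
next
  assume *: "\<forall>p\<in>F. poly_eval x p = 0"
  have "poly_eval y p = 0" if y: "y \<in> proj_class V bl x" and p: "p \<in> F" for y p
  proof -
    obtain k where k: "y = (\<lambda>v. k (bl v) * x v)"
      using proj_class_memD[OF y] by blast
    obtain D where "multihom V bl D p" using assms(3) p by blast
    from poly_eval_block_scaling[OF assms(1) this, of k x] show ?thesis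
      using * p by (simp add: k)
  qed
  then show "proj_class V bl x \<in> zero_set V bl F"
    using assms(2) by (auto simp: zero_set_def proj_class_in_mproj)
qed

lemma zariski_closed_Un:
  assumes "finite V" "zariski_closed V bl Z" "zariski_closed V bl Z'"
  shows "zariski_closed V bl (Z \<union> Z')"
proof -
  obtain F F' where F: "\<forall>p\<in>F. \<exists>D. multihom V bl D p" "Z = zero_set V bl F"
    and F': "\<forall>p\<in>F'. \<exists>D. multihom V bl D p" "Z' = zero_set V bl F'"
    using assms(2,3) unfolding zariski_closed_def by blast
  define G where "G = {p * q | p q. p \<in> F \<and> q \<in> F'}"
  have G: "\<forall>p\<in>G. \<exists>D. multihom V bl D p"
  proof
    fix g assume "g \<in> G"
    then obtain p q where "g = p * q" "p \<in> F" "q \<in> F'" by (auto simp: G_def)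
    moreover obtain D D' where "multihom V bl D p" "multihom V bl D' q"
      using bspec[OF F(1) \<open>p \<in> F\<close>] bspec[OF F'(1) \<open>q \<in> F'\<close>] by (elim exE)
    ultimately show "\<exists>D. multihom V bl D g"
      using multihom_mult[of V bl D p D' q] by (intro exI) simp
  qed
  have "c \<in> Z \<union> Z' \<longleftrightarrow> c \<in> zero_set V bl G" for c
  proof (cases "c \<in> mproj V bl")
    case True
    then obtain x where x: "x \<in> mproj_vec V bl" "c = proj_class V bl x" by (rule mprojE)
    have "(\<forall>p\<in>G. poly_eval x p = 0) \<longleftrightarrow>
        (\<forall>p\<in>F. poly_eval x p = 0) \<or> (\<forall>p\<in>F'. poly_eval x p = 0)"
    proof
      assume *: "\<forall>p\<in>G. poly_eval x p = 0"
      show "(\<forall>p\<in>F. poly_eval x p = 0) \<or> (\<forall>p\<in>F'. poly_eval x p = 0)"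
      proof (rule ccontr)
        assume "\<not> ?thesis"
        then obtain p q where pq: "p \<in> F" "q \<in> F'" "poly_eval x p \<noteq> 0" "poly_eval x q \<noteq> 0"
          by blast
        then have "p * q \<in> G" by (auto simp: G_def)
        with * have "poly_eval x (p * q) = 0" by blast
        then show False using pq(3,4) by (simp add: poly_eval_ring_hom)
      qed
    next
      assume *: "(\<forall>p\<in>F. poly_eval x p = 0) \<or> (\<forall>p\<in>F'. poly_eval x p = 0)"
      show "\<forall>p\<in>G. poly_eval x p = 0"
      proof
        fix g assume "g \<in> G"
        then obtain p q where "g = p * q" "p \<in> F" "q \<in> F'" by (auto simp: G_def)
        moreover have "poly_eval x (p * q) = poly_eval x p * poly_eval x q"
          by (rule poly_eval_ring_hom(6))
        ultimately show "poly_eval x g = 0" using * by (metis mult_eq_0_iff)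
      qed
    qed
    then show ?thesis
      unfolding F(2) F'(2) x(2) Un_iff proj_class_in_zero_set_iff[OF assms(1) x(1) F(1)]
        proj_class_in_zero_set_iff[OF assms(1) x(1) F'(1)]
        proj_class_in_zero_set_iff[OF assms(1) x(1) G] by (rule sym)
  next
    case False
    then show ?thesis by (auto simp: F(2) F'(2) zero_set_def)
  qed
  then show ?thesis unfolding zariski_closed_def using G by blast
qed

lemma zariski_closed_empty: "zariski_closed V bl {}"
proof -
  have "multihom V bl (\<lambda>_. 0) 1"
    using multihom_single[of "[]" V bl] by simp
  then have hom: "\<forall>p\<in>{1}. \<exists>D. multihom V bl D p" by blast
  have "c \<notin> zero_set V bl {1}" for c
  proof
    assume c: "c \<in> zero_set V bl {1}"
    then have "c \<in> mproj V bl" unfolding zero_set_def by blast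
    then obtain x where "x \<in> c" by (rule mprojE)
    then have "poly_eval x 1 = 0" using c unfolding zero_set_def by blast
    then show False by simp
  qed
  then show ?thesis unfolding zariski_closed_def using hom by (intro exI[of _ "{1}"]) blast
qed

lemma zariski_closed_UN:
  assumes "finite V" "finite S" "\<And>Z. Z \<in> S \<Longrightarrow> zariski_closed V bl Z"
  shows "zariski_closed V bl (\<Union>S)"
  using assms(2,3)
  by (induction S) (auto simp: zariski_closed_empty intro: zariski_closed_Un[OF assms(1)])

lemma zariski_irreducible_subset_Union:
  assumes "finite V" "finite S" "\<And>Z. Z \<in> S \<Longrightarrow> zariski_closed V bl Z"
    "zariski_irreducible V bl Y" "Y \<subseteq> \<Union>S"
  shows "\<exists>Z\<in>S. Y \<subseteq> Z"
  using assms(2,3,5)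
proof (induction S)
  case empty
  then show ?case using assms(4) by (auto simp: zariski_irreducible_def)
next
  case (insert Z S)
  have "zariski_closed V bl (\<Union>S)"
    using insert.prems(1) by (intro zariski_closed_UN[OF assms(1) insert.hyps(1)]) simp
  moreover have "zariski_closed V bl Z" "Y \<subseteq> Z \<union> \<Union>S"
    using insert.prems by simp_all
  ultimately have "Y \<subseteq> Z \<or> Y \<subseteq> \<Union>S"
    using assms(4) unfolding zariski_irreducible_def by blast
  then show ?case using insert by auto
qed

lemma irreducible_components_Union:
  assumes "finite V" "finite S"
    and closed: "\<And>Z. Z \<in> S \<Longrightarrow> zariski_closed V bl Z"
    and irred: "\<And>Z. Z \<in> S \<Longrightarrow> zariski_irreducible V bl Z"
    and antichain: "\<And>Z Z'. Z \<in> S \<Longrightarrow> Z' \<in> S \<Longrightarrow> Z \<subseteq> Z' \<Longrightarrow> Z = Z'"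
  shows "irreducible_components V bl (\<Union>S) = S"
proof (intro equalityI subsetI)
  fix Y assume "Y \<in> irreducible_components V bl (\<Union>S)"
  then have Y: "Y \<subseteq> \<Union>S" "zariski_irreducible V bl Y"
    "\<And>Y'. Y \<subseteq> Y' \<Longrightarrow> Y' \<subseteq> \<Union>S \<Longrightarrow> zariski_irreducible V bl Y' \<Longrightarrow> Y' = Y"
    by (auto simp: irreducible_components_def)
  obtain Z where "Z \<in> S" "Y \<subseteq> Z"
    using zariski_irreducible_subset_Union[OF assms(1,2) closed Y(2,1)] by blast
  then show "Y \<in> S" using Y(3)[of Z] irred by blast
next
  fix Z assume Z: "Z \<in> S"
  have "Y' = Z" if Y': "Z \<subseteq> Y'" "Y' \<subseteq> \<Union>S" "zariski_irreducible V bl Y'" for Y'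
  proof -
    obtain Z' where "Z' \<in> S" "Y' \<subseteq> Z'"
      using zariski_irreducible_subset_Union[OF assms(1,2) closed Y'(3,2)] by blast
    then show ?thesis using antichain[OF Z, of Z'] Y'(1) by blast
  qed
  then show "Z \<in> irreducible_components V bl (\<Union>S)"
    using Z irred by (auto simp: irreducible_components_def)
qed

section \<open>Toric loci\<close>

text \<open>Adjoining the block degrees to the exponents keeps only those binomials whose two
  monomials have the same multidegree, so the equations make sense on a product of projective
  spaces.\<close>

definition multideg :: "('v \<Rightarrow> 'b) \<Rightarrow> ('v \<Rightarrow> 'i \<Rightarrow> nat) \<Rightarrow> 'v \<Rightarrow> 'i + 'b \<Rightarrow> nat" where
  "multideg bl E v = case_sum (E v) (block_deg bl v)"

lemma multideg_simps [simp]: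
  "multideg bl E v (Inl i) = E v i" "multideg bl E v (Inr b) = block_deg bl v b"
  by (simp_all add: multideg_def)

text \<open>Given by equations, not as a closure, so that points of a degeneration can be recognized
  directly; that torus points are dense in it is shown only where it is needed.\<close>

definition toric_locus ::
  "'v set \<Rightarrow> ('v \<Rightarrow> 'b) \<Rightarrow> 'v set \<Rightarrow> 'i set \<Rightarrow> ('v \<Rightarrow> 'i \<Rightarrow> nat) \<Rightarrow> ('v \<Rightarrow> complex) set set" where
  "toric_locus V bl W I E =
     {c \<in> mproj V bl. \<forall>x\<in>c. toric_vec W (I <+> bl ` V) (multideg bl E) x}"

context
  fixes V :: "'v set" and bl :: "'v \<Rightarrow> 'b" and W :: "'v set" and I :: "'i set"
    and E :: "'v \<Rightarrow> 'i \<Rightarrow> nat"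
  assumes fin: "finite V" "finite I" and WV: "W \<subseteq> V"
begin

definition toric_equations :: "'v cpoly set" where
  "toric_equations = Var ` (V - W) \<union>
     {Poly_Mapping.single (monom_of us) 1 - Poly_Mapping.single (monom_of us') 1 | us us'.
        set us \<subseteq> W \<and> set us' \<subseteq> W \<and>
        (\<forall>i \<in> I <+> bl ` V. (\<Sum>v\<leftarrow>us. multideg bl E v i) = (\<Sum>v\<leftarrow>us'. multideg bl E v i))}"

lemma multihom_toric_equations: "\<forall>p\<in>toric_equations. \<exists>D. multihom V bl D p"
proof
  fix p assume "p \<in> toric_equations"
  then consider v where "v \<in> V" "p = Var v"
    | us us' where "p = Poly_Mapping.single (monom_of us) 1 - Poly_Mapping.single (monom_of us') 1"
      "set us \<subseteq> W" "set us' \<subseteq> W"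
      "\<forall>i \<in> I <+> bl ` V. (\<Sum>v\<leftarrow>us. multideg bl E v i) = (\<Sum>v\<leftarrow>us'. multideg bl E v i)"
    unfolding toric_equations_def by blast
  then show "\<exists>D. multihom V bl D p"
  proof cases
    case 1
    show ?thesis unfolding 1(2) by (rule ex_multihom) (rule multihom_Var[OF 1(1)])
  next
    case 2
    \<comment> \<open>\<open>multihom\<close> compares degrees at every label, whereas the equations
      control only labels in the image of \<open>bl\<close>; at all other labels both degrees are
      zero.\<close>
    have "(\<Sum>v\<leftarrow>us. block_deg bl v b) = (\<Sum>v\<leftarrow>us'. block_deg bl v b)" for b
    proof (cases "b \<in> bl ` V")
      case True
      then have "Inr b \<in> I <+> bl ` V" by blast
      from bspec[OF 2(4) this] show ?thesis by simp
    next
      case False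
      then have zero: "(\<Sum>v\<leftarrow>xs. block_deg bl v b) = 0" if "set xs \<subseteq> W" for xs
        using that WV by (induction xs) (auto simp: block_deg_def)
      show ?thesis unfolding zero[OF 2(2)] zero[OF 2(3)] by (rule refl)
    qed
    then have eq: "(\<lambda>b. \<Sum>v\<leftarrow>us. block_deg bl v b) = (\<lambda>b. \<Sum>v\<leftarrow>us'. block_deg bl v b)"
      by (rule ext)
    have "multihom V bl (\<lambda>b. \<Sum>v\<leftarrow>us. block_deg bl v b) p"
      unfolding 2(1)
    proof (rule multihom_diff)
      show "multihom V bl (\<lambda>b. \<Sum>v\<leftarrow>us. block_deg bl v b) (Poly_Mapping.single (monom_of us) 1)"
        using 2(2) WV by (intro multihom_single) blast
      show "multihom V bl (\<lambda>b. \<Sum>v\<leftarrow>us. block_deg bl v b) (Poly_Mapping.single (monom_of us') 1)"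
        unfolding eq using 2(3) WV by (intro multihom_single) blast
    qed
    then show ?thesis by (rule ex_multihom)
  qed
qed

lemma toric_vec_iff_equations:
  assumes "x \<in> mproj_vec V bl"
  shows "toric_vec W (I <+> bl ` V) (multideg bl E) x \<longleftrightarrow> (\<forall>p\<in>toric_equations. poly_eval x p = 0)"
proof
  assume x: "toric_vec W (I <+> bl ` V) (multideg bl E) x"
  show "\<forall>p\<in>toric_equations. poly_eval x p = 0"
  proof
    fix p assume "p \<in> toric_equations"
    then consider v where "v \<in> V - W" "p = Var v"
      | us us' where "p = Poly_Mapping.single (monom_of us) 1 - Poly_Mapping.single (monom_of us') 1"
        "set us \<subseteq> W" "set us' \<subseteq> W"
        "\<forall>i \<in> I <+> bl ` V. (\<Sum>v\<leftarrow>us. multideg bl E v i) = (\<Sum>v\<leftarrow>us'. multideg bl E v i)"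
      unfolding toric_equations_def by blast
    then show "poly_eval x p = 0"
    proof cases
      case 1
      then show ?thesis using toric_vec_off[OF x] by simp
    next
      case 2
      then show ?thesis using toric_vec_prod_eq[OF x 2(2,3)]
        by (simp add: poly_eval_ring_hom monom_eval_monom_of)
    qed
  qed
next
  assume eqs: "\<forall>p\<in>toric_equations. poly_eval x p = 0"
  show "toric_vec W (I <+> bl ` V) (multideg bl E) x"
    unfolding toric_vec_def
  proof (intro conjI allI impI)
    fix v assume "v \<notin> W"
    show "x v = 0"
    proof (cases "v \<in> V")
      case True
      then have "Var v \<in> toric_equations"
        using \<open>v \<notin> W\<close> by (simp add: toric_equations_def)
      then show ?thesis using eqs by fastforce
    next
      case False
      then show ?thesis using assms by (simp add: mproj_vec_def)
    qed
  next
    fix us us'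
    assume "set us \<subseteq> W" "set us' \<subseteq> W"
      "\<forall>i \<in> I <+> bl ` V. (\<Sum>v\<leftarrow>us. multideg bl E v i) = (\<Sum>v\<leftarrow>us'. multideg bl E v i)"
    then have "Poly_Mapping.single (monom_of us) 1 - Poly_Mapping.single (monom_of us') 1
        \<in> toric_equations"
      unfolding toric_equations_def by blast
    with eqs have "poly_eval x (Poly_Mapping.single (monom_of us) 1 -
        Poly_Mapping.single (monom_of us') 1) = 0" by blast
    then show "prod_list (map x us) = prod_list (map x us')"
      by (simp add: poly_eval_ring_hom monom_eval_monom_of)
  qed
qed

lemma proj_class_in_toric_locus_iff:
  assumes "x \<in> mproj_vec V bl"
  shows "proj_class V bl x \<in> toric_locus V bl W I E \<longleftrightarrow>
    toric_vec W (I <+> bl ` V) (multideg bl E) x"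
  and "proj_class V bl x \<in> toric_locus V bl W I E \<longleftrightarrow>
    proj_class V bl x \<in> zero_set V bl toric_equations"
proof -
  have *: "proj_class V bl x \<in> zero_set V bl toric_equations \<longleftrightarrow>
      toric_vec W (I <+> bl ` V) (multideg bl E) x"
    by (simp add: proj_class_in_zero_set_iff fin assms multihom_toric_equations toric_vec_iff_equations)
  show 1: "proj_class V bl x \<in> toric_locus V bl W I E \<longleftrightarrow>
      proj_class V bl x \<in> zero_set V bl toric_equations"
  proof
    assume "proj_class V bl x \<in> toric_locus V bl W I E"
    then have "toric_vec W (I <+> bl ` V) (multideg bl E) x"
      using proj_class_self[OF assms] unfolding toric_locus_def by blast
    then show "proj_class V bl x \<in> zero_set V bl toric_equations" using * by simp
  next
    assume z: "proj_class V bl x \<in> zero_set V bl toric_equations"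
    have "toric_vec W (I <+> bl ` V) (multideg bl E) y" if "y \<in> proj_class V bl x" for y
    proof -
      have "y \<in> mproj_vec V bl"
        using mproj_rep(1)[OF proj_class_in_mproj[OF assms] that] .
      moreover have "\<forall>p\<in>toric_equations. poly_eval y p = 0"
        using z that unfolding zero_set_def by blast
      ultimately show ?thesis by (simp add: toric_vec_iff_equations)
    qed
    then show "proj_class V bl x \<in> toric_locus V bl W I E"
      using assms by (simp add: toric_locus_def proj_class_in_mproj)
  qed
  show "proj_class V bl x \<in> toric_locus V bl W I E \<longleftrightarrow>
      toric_vec W (I <+> bl ` V) (multideg bl E) x"
    using 1 * by simp
qed

lemma zariski_closed_toric_locus: "zariski_closed V bl (toric_locus V bl W I E)"
proof -
  have "c \<in> toric_locus V bl W I E \<longleftrightarrow> c \<in> zero_set V bl toric_equations" for c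
  proof (cases "c \<in> mproj V bl")
    case True
    then obtain x where "x \<in> mproj_vec V bl" "c = proj_class V bl x" by (rule mprojE)
    then show ?thesis using proj_class_in_toric_locus_iff(2) by simp
  qed (simp_all add: toric_locus_def zero_set_def)
  then show ?thesis
    unfolding zariski_closed_def using multihom_toric_equations by blast
qed

lemma torus_point_in_mproj_vec:
  assumes "\<And>b. b \<in> bl ` V \<Longrightarrow> \<exists>v\<in>W. bl v = b" "\<And>i. t i \<noteq> 0"
  shows "torus_point W J E' t \<in> mproj_vec V bl"
  unfolding mproj_vec_def
proof (intro CollectI conjI ballI allI impI)
  fix b assume "b \<in> bl ` V"
  then obtain v where "v \<in> W" "bl v = b" using assms(1) by blast
  moreover have "torus_point W J E' t v \<noteq> 0"
    using \<open>v \<in> W\<close> assms(2) by (cases "finite J") (auto simp: torus_point_def)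
  ultimately show "\<exists>v\<in>V. bl v = b \<and> torus_point W J E' t v \<noteq> 0" using WV by blast
qed (use WV in \<open>auto simp: torus_point_def\<close>)

lemma finite_multideg_index: "finite (I <+> bl ` V)"
  using fin by simp

lemma torus_point_in_toric_locus:
  assumes "\<And>b. b \<in> bl ` V \<Longrightarrow> \<exists>v\<in>W. bl v = b" "\<And>i. t i \<noteq> 0"
  shows "proj_class V bl (torus_point W (I <+> bl ` V) (multideg bl E) t) \<in> toric_locus V bl W I E"
proof -
  let ?y = "torus_point W (I <+> bl ` V) (multideg bl E) t"
  have "?y \<in> mproj_vec V bl"
    by (rule torus_point_in_mproj_vec) (use assms in auto)
  then show ?thesis
    using proj_class_in_toric_locus_iff(1) toric_vec_torus_point[OF finite_multideg_index] by blast
qed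

text \<open>If neither closed set contains the locus, each has an equation outside the toric ideal.
  By primality some torus point satisfies neither equation, yet it lies in the locus;
  \<open>hit\<close> makes it a legitimate point of the product.\<close>

lemma zariski_irreducible_toric_locus:
  assumes hit: "\<And>b. b \<in> bl ` V \<Longrightarrow> \<exists>v\<in>W. bl v = b"
  shows "zariski_irreducible V bl (toric_locus V bl W I E)"
  unfolding zariski_irreducible_def
proof (intro conjI allI impI)
  show "toric_locus V bl W I E \<noteq> {}"
    using torus_point_in_toric_locus[of "\<lambda>_. 1"] hit by auto
next
  fix Z Z'
  assume *: "zariski_closed V bl Z \<and> zariski_closed V bl Z' \<and> toric_locus V bl W I E \<subseteq> Z \<union> Z'"
  obtain F F' where F: "\<forall>p\<in>F. \<exists>D. multihom V bl D p" "Z = zero_set V bl F"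
    and F': "\<forall>p\<in>F'. \<exists>D. multihom V bl D p" "Z' = zero_set V bl F'"
    using * unfolding zariski_closed_def by blast
  have ex: "\<exists>p\<in>G. \<not> fiber_sums_zero W (I <+> bl ` V) (multideg bl E) p"
    if G: "\<not> toric_locus V bl W I E \<subseteq> zero_set V bl G" for G
  proof -
    obtain c where c: "c \<in> toric_locus V bl W I E" "c \<notin> zero_set V bl G"
      using G by blast
    then have "c \<in> mproj V bl" by (simp add: toric_locus_def)
    with c(2) obtain x p where xp: "x \<in> c" "p \<in> G" "poly_eval x p \<noteq> 0"
      by (auto simp: zero_set_def)
    have "toric_vec W (I <+> bl ` V) (multideg bl E) x"
      using c(1) xp(1) by (simp add: toric_locus_def)
    from poly_eval_toric_vec[OF this] xp(3) show ?thesis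
      using xp(2) by (intro bexI[of _ p]) auto
  qed
  show "toric_locus V bl W I E \<subseteq> Z \<or> toric_locus V bl W I E \<subseteq> Z'"
  proof (rule ccontr)
    assume "\<not> ?thesis"
    then obtain p q where pq: "p \<in> F" "q \<in> F'"
      "\<not> fiber_sums_zero W (I <+> bl ` V) (multideg bl E) p"
      "\<not> fiber_sums_zero W (I <+> bl ` V) (multideg bl E) q"
      using ex F(2) F'(2) by blast
    let ?y = "torus_point W (I <+> bl ` V) (multideg bl E)"
    have "\<exists>t. (\<forall>i. t i \<noteq> 0) \<and> poly_eval (?y t) p * poly_eval (?y t) q \<noteq> 0"
    proof (rule ccontr)
      assume "\<nexists>t. (\<forall>i. t i \<noteq> 0) \<and> poly_eval (?y t) p * poly_eval (?y t) q \<noteq> 0"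
      then have "poly_eval (?y t) p * poly_eval (?y t) q = 0" if "\<forall>i. t i \<noteq> 0" for t
        using that by blast
      from torus_product_zero[OF finite_multideg_index this] show False
        using pq(3,4) by blast
    qed
    then obtain t where t: "\<And>i. t i \<noteq> 0" "poly_eval (?y t) p * poly_eval (?y t) q \<noteq> 0"
      by blast
    have y: "?y t \<in> mproj_vec V bl"
      by (rule torus_point_in_mproj_vec) (use hit t(1) in auto)
    have "proj_class V bl (?y t) \<in> toric_locus V bl W I E"
      by (rule torus_point_in_toric_locus) (use hit t(1) in auto)
    then have "proj_class V bl (?y t) \<in> Z \<union> Z'"
      using * by blast
    then have "(\<forall>p\<in>F. poly_eval (?y t) p = 0) \<or> (\<forall>p\<in>F'. poly_eval (?y t) p = 0)"
      unfolding F(2) F'(2) Un_iff proj_class_in_zero_set_iff[OF fin(1) y F(1)]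
        proj_class_in_zero_set_iff[OF fin(1) y F'(1)] .
    then show False using t(2) pq(1,2) by auto
  qed
qed

end

section \<open>Toric closures as toric loci\<close>

lemma fiber_sums_zero_of_torus_zero:
  fixes f :: "'v cpoly"
  assumes "finite I" "\<And>t. (\<forall>i. t i \<noteq> 0) \<Longrightarrow> poly_eval (torus_point W I E t) f = 0"
  shows "fiber_sums_zero W I E f"
proof -
  \<comment> \<open>The constant 1 is used as the second factor in the primality lemma; its fiber
    sum in degree zero is 1, so that alternative is excluded.\<close>
  have "(\<Sum>m \<in> Poly_Mapping.keys (1::'v cpoly) \<inter> fiber W I E 0. Poly_Mapping.lookup (1::'v cpoly) m) = 1"
  proof -
    have "Poly_Mapping.keys (1::'v cpoly) \<inter> fiber W I E 0 = {0}"
      unfolding fiber_def keys_one by auto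
    then show ?thesis by (simp only: lookup_one_zero sum.insert_if sum.empty finite.emptyI) simp
  qed
  then have "\<not> fiber_sums_zero W I E (1::'v cpoly)"
    unfolding fiber_sums_zero_def using zero_neq_one by metis
  moreover have "fiber_sums_zero W I E f \<or> fiber_sums_zero W I E (1::'v cpoly)"
    by (rule torus_product_zero[OF assms(1)]) (simp add: assms(2))
  ultimately show ?thesis by blast
qed

text \<open>Truncation to natural numbers is harmless here: the exponent vectors to which it is
  applied have nonnegative entries.\<close>

definition lattice_exponent :: "('p \<Rightarrow>\<^sub>0 int) \<Rightarrow> 'p \<Rightarrow> nat" where
  "lattice_exponent a p = nat (Poly_Mapping.lookup a p)"

text \<open>The locus is closed and contains the torus points, which gives one inclusion.
  Conversely, an equation that holds at all torus points has zero fiber sums and therefore vanishes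
  at every solution of the binomial equations.\<close>

lemma toric_closure_eq_toric_locus:
  fixes A :: "('p \<Rightarrow>\<^sub>0 int) set"
  assumes fin: "finite A" "finite I" and "A \<noteq> {}"
    and A: "\<And>a. a \<in> A \<Longrightarrow> Poly_Mapping.keys a \<subseteq> I" "\<And>a p. a \<in> A \<Longrightarrow> Poly_Mapping.lookup a p \<ge> 0"
  shows "toric_closure A = toric_locus A (\<lambda>_. ()) A I lattice_exponent"
proof -
  define u where "u = (\<lambda>_ :: 'p \<Rightarrow>\<^sub>0 int. ())"
  let ?J = "I <+> u ` A" and ?E = "multideg u lattice_exponent"
  define T where "T = {mproj_rel A u `` {monomial_point A t} | t. \<forall>p. t p \<noteq> 0}"
  \<comment> \<open>The additional torus coordinate at \<open>Inr ()\<close> records the degree and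
    acts as a common scalar, so it does not change the projective point.\<close>
  have point: "torus_point A ?J ?E t a = t (Inr ()) * monomial_point A (\<lambda>p. t (Inl p)) a" for t a
  proof (cases "a \<in> A")
    case True
    have "(\<Prod>p\<in>Poly_Mapping.keys a. t (Inl p) powi Poly_Mapping.lookup a p) =
        (\<Prod>p\<in>I. t (Inl p) ^ lattice_exponent a p)"
      by (rule prod.mono_neutral_cong_left)
        (use fin A[OF True] in \<open>auto simp: lattice_exponent_def in_keys_iff power_int_def\<close>)
    moreover have "u ` A = {()}" using assms(3) by auto
    ultimately show ?thesis
      using True fin unfolding \<open>u ` A = {()}\<close>
      by (simp add: torus_point_def monomial_point_def prod.Plus block_deg_def)
  qed (simp add: torus_point_def monomial_point_def)
  have hit: "\<exists>v\<in>A. u v = b" if "b \<in> u ` A" for b using that by blast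
  have mono_pt: "monomial_point A t = torus_point A ?J ?E (case_sum t (\<lambda>_. 1))" for t
    unfolding fun_eq_iff point by simp
  have T_eq: "T = {proj_class A u (torus_point A ?J ?E t) | t. \<forall>i. t i \<noteq> 0}"
  proof (intro equalityI subsetI)
    fix c assume "c \<in> T"
    then obtain t where t: "\<forall>p. t p \<noteq> 0" "c = proj_class A u (monomial_point A t)"
      unfolding T_def proj_class_def by blast
    then have "\<forall>i. case_sum t (\<lambda>_. 1) i \<noteq> 0" by (simp split: sum.split)
    then show "c \<in> {proj_class A u (torus_point A ?J ?E t) | t. \<forall>i. t i \<noteq> 0}"
      unfolding t(2) mono_pt by blast
  next
    fix c assume "c \<in> {proj_class A u (torus_point A ?J ?E t) | t. \<forall>i. t i \<noteq> 0}"
    then obtain t where t: "\<And>i. t i \<noteq> 0" "c = proj_class A u (torus_point A ?J ?E t)" by blast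
    have "proj_class A u (monomial_point A (\<lambda>p. t (Inl p))) = c"
      unfolding t(2)
    proof (rule proj_class_eqI[where k="\<lambda>_. t (Inr ())"])
      show "monomial_point A (\<lambda>p. t (Inl p)) \<in> mproj_vec A u"
        unfolding mono_pt by (rule torus_point_in_mproj_vec) (use t fin in \<open>auto split: sum.split\<close>)
      show "torus_point A ?J ?E t \<in> mproj_vec A u"
        by (rule torus_point_in_mproj_vec) (use t fin in auto)
    qed (use t point in auto)
    then show "c \<in> T" unfolding T_def proj_class_def using t(1) by blast
  qed
  have "toric_closure A = zariski_closure A u T"
    by (simp add: toric_closure_def T_def u_def)
  also have "\<dots> = toric_locus A u A I lattice_exponent"
  proof
    show "zariski_closure A u T \<subseteq> toric_locus A u A I lattice_exponent"
    proof -
      have "T \<subseteq> toric_locus A u A I lattice_exponent"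
        unfolding T_eq
        using torus_point_in_toric_locus[OF fin order_refl, of u _ lattice_exponent, OF hit] by blast
      then show ?thesis
        unfolding zariski_closure_def
        using zariski_closed_toric_locus[OF fin order_refl, of u lattice_exponent] by blast
    qed
  next
    have "c \<in> Z" if c: "c \<in> toric_locus A u A I lattice_exponent"
      and Z: "zariski_closed A u Z" "T \<subseteq> Z" for c Z
    proof -
      obtain F where F: "\<forall>p\<in>F. \<exists>D. multihom A u D p" "Z = zero_set A u F"
        using Z(1) unfolding zariski_closed_def by blast
      have "poly_eval x p = 0" if "x \<in> c" "p \<in> F" for x p
      proof (rule poly_eval_toric_vec)
        show "toric_vec A ?J ?E x" using c that(1) unfolding toric_locus_def by blast
        show "fiber_sums_zero A ?J ?E p"
        proof (rule fiber_sums_zero_of_torus_zero)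
          fix t :: "'p + unit \<Rightarrow> complex" assume t: "\<forall>i. t i \<noteq> 0"
          then have "proj_class A u (torus_point A ?J ?E t) \<in> zero_set A u F"
            using Z(2) F(2) T_eq by blast
          moreover have y: "torus_point A ?J ?E t \<in> mproj_vec A u"
            by (rule torus_point_in_mproj_vec) (use t fin in auto)
          ultimately show "poly_eval (torus_point A ?J ?E t) p = 0"
            unfolding proj_class_in_zero_set_iff[OF fin(1) y F(1)] using that(2) by blast
        qed (use fin in simp)
      qed
      moreover have "c \<in> mproj A u" using c unfolding toric_locus_def by blast
      ultimately show ?thesis unfolding F(2) zero_set_def by blast
    qed
    then show "toric_locus A u A I lattice_exponent \<subseteq> zariski_closure A u T"
      unfolding zariski_closure_def by blast
  qed
  finally show ?thesis by (simp add: u_def)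
qed

lemma mproj_vecD: "x \<in> mproj_vec V bl \<Longrightarrow> b \<in> bl ` V \<Longrightarrow> \<exists>v\<in>V. bl v = b \<and> x v \<noteq> 0"
  unfolding mproj_vec_def by blast

lemma count_map_block_deg: "count (mset (map bl us)) b = (\<Sum>v\<leftarrow>us. block_deg bl v b)"
  by (induction us) (auto simp: block_deg_def)

lemma sum_list_lattice_exponent:
  fixes ev :: "'v \<Rightarrow> ('q \<Rightarrow>\<^sub>0 int)"
  assumes "\<And>v. v \<in> W \<Longrightarrow> Poly_Mapping.lookup (ev v) q \<ge> 0" "set us \<subseteq> W"
  shows "int (\<Sum>v\<leftarrow>us. lattice_exponent (ev v) q) = Poly_Mapping.lookup (\<Sum>v\<leftarrow>us. ev v) q"
  using assms(2)
proof (induction us)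
  case Nil
  show ?case by simp
next
  case (Cons v us)
  have v: "int (lattice_exponent (ev v) q) = Poly_Mapping.lookup (ev v) q"
    unfolding lattice_exponent_def using assms(1)[of v] Cons.prems by simp
  have us: "int (\<Sum>v\<leftarrow>us. lattice_exponent (ev v) q) = Poly_Mapping.lookup (\<Sum>v\<leftarrow>us. ev v) q"
    by (rule Cons.IH) (use Cons.prems in simp)
  show ?case
    unfolding list.map sum_list.Cons of_nat_add lookup_add v us by (rule refl)
qed

text \<open>Restates the equations with sums of exponent vectors and multisets of labels, so that
  Segre relations can be checked by addition and cancellation in a group.\<close>

lemma toric_vec_lattice_iff:
  fixes ev :: "'v \<Rightarrow> ('q \<Rightarrow>\<^sub>0 int)" and x :: "'v \<Rightarrow> complex" and bl :: "'v \<Rightarrow> 'b"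
    and V W :: "'v set" and I :: "'q set"
  assumes "W \<subseteq> V"
    and nonneg: "\<And>v q. v \<in> W \<Longrightarrow> Poly_Mapping.lookup (ev v) q \<ge> 0"
    and keys: "\<And>v. v \<in> W \<Longrightarrow> Poly_Mapping.keys (ev v) \<subseteq> I"
  shows "toric_vec W (I <+> bl ` V) (multideg bl (\<lambda>v. lattice_exponent (ev v))) x \<longleftrightarrow>
    (\<forall>v. v \<notin> W \<longrightarrow> x v = 0) \<and>
    (\<forall>us us'. set us \<subseteq> W \<longrightarrow> set us' \<subseteq> W \<longrightarrow> (\<Sum>v\<leftarrow>us. ev v) = (\<Sum>v\<leftarrow>us'. ev v) \<longrightarrow>
       mset (map bl us) = mset (map bl us') \<longrightarrow> prod_list (map x us) = prod_list (map x us'))"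
proof -
  have deg: "Poly_Mapping.lookup (\<Sum>v\<leftarrow>xs. ev v) q = int (\<Sum>v\<leftarrow>xs. lattice_exponent (ev v) q)"
    if "set xs \<subseteq> W" for xs q
    by (rule sum_list_lattice_exponent[OF _ that, symmetric]) (rule nonneg)
  have iff: "(\<forall>i \<in> I <+> bl ` V. (\<Sum>v\<leftarrow>us. multideg bl (\<lambda>v. lattice_exponent (ev v)) v i) =
        (\<Sum>v\<leftarrow>us'. multideg bl (\<lambda>v. lattice_exponent (ev v)) v i)) \<longleftrightarrow>
      (\<Sum>v\<leftarrow>us. ev v) = (\<Sum>v\<leftarrow>us'. ev v) \<and> mset (map bl us) = mset (map bl us')"
    (is "?L \<longleftrightarrow> ?R") if us: "set us \<subseteq> W" "set us' \<subseteq> W" for us us'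
  proof
    assume L: ?L
    have "Poly_Mapping.lookup (\<Sum>v\<leftarrow>us. ev v) q = Poly_Mapping.lookup (\<Sum>v\<leftarrow>us'. ev v) q" for q
    proof (cases "q \<in> I")
      case True
      from bspec[OF L InlI[OF True]]
      have "(\<Sum>v\<leftarrow>us. lattice_exponent (ev v) q) = (\<Sum>v\<leftarrow>us'. lattice_exponent (ev v) q)"
        unfolding multideg_simps .
      then show ?thesis
        unfolding deg[OF us(1)] deg[OF us(2)] by (rule arg_cong)
    next
      case False
      have zero: "Poly_Mapping.lookup (\<Sum>v\<leftarrow>xs. ev v) q = 0" if "set xs \<subseteq> W" for xs
        using that False keys by (induction xs) (auto simp: lookup_add in_keys_iff subset_iff)
      show ?thesis unfolding zero[OF us(1)] zero[OF us(2)] by (rule refl)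
    qed
    then have "(\<Sum>v\<leftarrow>us. ev v) = (\<Sum>v\<leftarrow>us'. ev v)" by (rule poly_mapping_eqI)
    moreover have "count (mset (map bl us)) b = count (mset (map bl us')) b" for b
    proof (cases "b \<in> bl ` V")
      case True
      from bspec[OF L InrI[OF True]] show ?thesis
        unfolding count_map_block_deg by simp
    next
      case False
      then have "b \<notin># mset (map bl us)" "b \<notin># mset (map bl us')" using us assms(1) by auto
      then show ?thesis by (simp only: not_in_iff)
    qed
    then have "mset (map bl us) = mset (map bl us')" by (rule multiset_eqI)
    ultimately show ?R by blast
  next
    assume R: ?R
    show ?L
    proof
      fix i assume "i \<in> I <+> bl ` V"
      then show "(\<Sum>v\<leftarrow>us. multideg bl (\<lambda>v. lattice_exponent (ev v)) v i) =
        (\<Sum>v\<leftarrow>us'. multideg bl (\<lambda>v. lattice_exponent (ev v)) v i)"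
      proof (elim PlusE)
        fix q assume i: "i = Inl q"
        have "int (\<Sum>v\<leftarrow>us. lattice_exponent (ev v) q) = int (\<Sum>v\<leftarrow>us'. lattice_exponent (ev v) q)"
          unfolding deg[OF us(1), symmetric] deg[OF us(2), symmetric]
          using conjunct1[OF R] by (rule arg_cong)
        then show ?thesis by (simp only: i multideg_simps of_nat_eq_iff)
      next
        fix b assume i: "i = Inr b"
        have "count (mset (map bl us)) b = count (mset (map bl us')) b" using R by simp
        then show ?thesis by (simp only: i multideg_simps count_map_block_deg)
      qed
    qed
  qed
  show ?thesis unfolding toric_vec_def by (simp only: iff imp_conjL cong: imp_cong conj_cong)
qed

section \<open>Segre embeddings\<close>

text \<open>
  The Segre coordinates of a point of the toric locus depend only on the sum of the exponents of
  their factors.  In a neighbourhood of a point where the coordinates \<open>u b\<close> do not vanish, the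
  inverse of the Segre embedding is obtained by replacing one of the factors of the coordinate
  \<open>\<Prod>b. x (u b)\<close>.
\<close>

locale segre =
  fixes V :: "'v set" and bl :: "'v \<Rightarrow> 'b" and W :: "'v set"
    and ev :: "'v \<Rightarrow> ('q \<Rightarrow>\<^sub>0 int)" and I :: "'q set"
  assumes finV: "finite V" and finI: "finite I" and WV: "W \<subseteq> V" and V_ne: "V \<noteq> {}"
    and hit: "\<And>b. b \<in> bl ` V \<Longrightarrow> \<exists>v\<in>W. bl v = b"
    and nonneg: "\<And>v q. v \<in> W \<Longrightarrow> Poly_Mapping.lookup (ev v) q \<ge> 0"
    and keys: "\<And>v. v \<in> W \<Longrightarrow> Poly_Mapping.keys (ev v) \<subseteq> I"
begin

text \<open>A section picks one coordinate from each factor, that is, one Segre coordinate. Its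
  values at labels that do not occur are arbitrary.\<close>

definition sections :: "('b \<Rightarrow> 'v) set" where
  "sections = {u. \<forall>b\<in>bl ` V. u b \<in> W \<and> bl (u b) = b}"

definition section_sum :: "('b \<Rightarrow> 'v) \<Rightarrow> ('q \<Rightarrow>\<^sub>0 int)" where
  "section_sum u = (\<Sum>b\<in>bl ` V. ev (u b))"

definition segre_exponents :: "('q \<Rightarrow>\<^sub>0 int) set" where
  "segre_exponents = section_sum ` sections"

definition labels :: "'b list" where
  "labels = (SOME bs. set bs = bl ` V \<and> distinct bs)"

text \<open>Several sections can have the same exponent. On the toric locus their Segre coordinates
  agree, so an arbitrary choice suffices; see \<open>segre_vec_section_sum\<close>.\<close>

definition section_of :: "('q \<Rightarrow>\<^sub>0 int) \<Rightarrow> 'b \<Rightarrow> 'v" where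
  "section_of a = (SOME u. u \<in> sections \<and> section_sum u = a)"

definition segre_vec :: "('v \<Rightarrow> complex) \<Rightarrow> ('q \<Rightarrow>\<^sub>0 int) \<Rightarrow> complex" where
  "segre_vec x a = (if a \<in> segre_exponents then \<Prod>v\<leftarrow>map (section_of a) labels. x v else 0)"

text \<open>The exponent of the section obtained from \<open>u\<close> by exchanging its factor with
  the label of \<open>v\<close> for \<open>v\<close>; see \<open>section_sum_update\<close>.\<close>

definition shift :: "('b \<Rightarrow> 'v) \<Rightarrow> 'v \<Rightarrow> ('q \<Rightarrow>\<^sub>0 int)" where
  "shift u v = ev v + section_sum u - ev (u (bl v))"

definition segre_inv_vec :: "('b \<Rightarrow> 'v) \<Rightarrow> (('q \<Rightarrow>\<^sub>0 int) \<Rightarrow> complex) \<Rightarrow> 'v \<Rightarrow> complex" where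
  "segre_inv_vec u y v = (if v \<in> W then y (shift u v) else 0)"

abbreviation "tvec \<equiv> toric_vec W (I <+> bl ` V) (multideg bl (\<lambda>v. lattice_exponent (ev v)))"
abbreviation "A \<equiv> segre_exponents"
abbreviation "pt \<equiv> (\<lambda>_ :: 'q \<Rightarrow>\<^sub>0 int. ())"
abbreviation "avec \<equiv> toric_vec A (I <+> pt ` A) (multideg pt lattice_exponent)"

lemma labels: "set labels = bl ` V" "distinct labels"
proof -
  have "\<exists>bs. set bs = bl ` V \<and> distinct bs"
    using finV by (intro finite_distinct_list) simp
  from someI_ex[OF this] show "set labels = bl ` V" "distinct labels"
    unfolding labels_def by blast+
qed

lemma sectionsD: "u \<in> sections \<Longrightarrow> b \<in> bl ` V \<Longrightarrow> u b \<in> W"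
  "u \<in> sections \<Longrightarrow> b \<in> bl ` V \<Longrightarrow> bl (u b) = b"
  unfolding sections_def by blast+

lemma section_of: "a \<in> A \<Longrightarrow> section_of a \<in> sections \<and> section_sum (section_of a) = a"
proof -
  assume "a \<in> A"
  then have "\<exists>u. u \<in> sections \<and> section_sum u = a" unfolding segre_exponents_def by blast
  then show ?thesis unfolding section_of_def by (rule someI_ex)
qed

lemma sections_list:
  assumes "u \<in> sections"
  shows "set (map u labels) \<subseteq> W" "mset (map bl (map u labels)) = mset labels"
    "(\<Sum>v\<leftarrow>map u labels. ev v) = section_sum u"
proof -
  show "set (map u labels) \<subseteq> W" using sectionsD(1)[OF assms] labels(1) by auto
  have "map bl (map u labels) = labels"
    unfolding map_map comp_def
    by (rule map_idI) (rule sectionsD(2)[OF assms], simp only: labels(1))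
  then show "mset (map bl (map u labels)) = mset labels" by simp
  show "(\<Sum>v\<leftarrow>map u labels. ev v) = section_sum u"
    unfolding section_sum_def map_map comp_def labels(1)[symmetric]
    by (rule sum.distinct_set_conv_list[OF labels(2), symmetric])
qed

lemma sections_ne: "\<exists>u. u \<in> sections"
proof -
  have "\<forall>b\<in>bl ` V. \<exists>v. v \<in> W \<and> bl v = b" using hit by blast
  from bchoice[OF this] show ?thesis unfolding sections_def by blast
qed

lemma A_ne: "A \<noteq> {}"
  using sections_ne unfolding segre_exponents_def by blast

lemma finite_A: "finite A"
proof -
  have "A \<subseteq> section_sum ` (bl ` V \<rightarrow>\<^sub>E W)"
  proof
    fix a assume "a \<in> A"
    then obtain u where u: "u \<in> sections" "a = section_sum u" unfolding segre_exponents_def by blast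
    have "section_sum u = section_sum (restrict u (bl ` V))"
      unfolding section_sum_def by (rule sum.cong) simp_all
    moreover have "restrict u (bl ` V) \<in> bl ` V \<rightarrow>\<^sub>E W"
      using sectionsD(1)[OF u(1)] by simp
    ultimately show "a \<in> section_sum ` (bl ` V \<rightarrow>\<^sub>E W)" using u(2) by blast
  qed
  moreover have "finite (bl ` V \<rightarrow>\<^sub>E W)"
    using finV finite_subset[OF WV finV] by (intro finite_PiE) auto
  ultimately show ?thesis using finite_subset by blast
qed

lemma A_nonneg: "a \<in> A \<Longrightarrow> Poly_Mapping.lookup a q \<ge> 0"
  unfolding segre_exponents_def section_sum_def
  using sectionsD(1) nonneg by (auto simp: lookup_sum intro!: sum_nonneg)

lemma A_keys: "a \<in> A \<Longrightarrow> Poly_Mapping.keys a \<subseteq> I"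
proof
  fix q assume "a \<in> A" "q \<in> Poly_Mapping.keys a"
  then obtain u where u: "u \<in> sections" "a = section_sum u" unfolding segre_exponents_def by blast
  have "(\<Sum>b\<in>bl ` V. Poly_Mapping.lookup (ev (u b)) q) \<noteq> 0"
    using \<open>q \<in> Poly_Mapping.keys a\<close> by (simp add: u(2) in_keys_iff section_sum_def lookup_sum)
  then obtain b where "b \<in> bl ` V" "Poly_Mapping.lookup (ev (u b)) q \<noteq> 0"
    by (rule sum.not_neutral_contains_not_neutral)
  then have "u b \<in> W" "q \<in> Poly_Mapping.keys (ev (u b))"
    using sectionsD(1)[OF u(1)] unfolding in_keys_iff by blast+
  then show "q \<in> I" using keys by blast
qed

lemma toric_closure_A: "toric_closure A = toric_locus A pt A I lattice_exponent"
  by (rule toric_closure_eq_toric_locus[OF finite_A finI A_ne]) (use A_keys A_nonneg in auto)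

lemmas tvec_iff = toric_vec_lattice_iff[of W V ev I bl, OF WV]

lemma tvec_prod_eq:
  assumes "tvec x" "set us \<subseteq> W" "set us' \<subseteq> W" "(\<Sum>v\<leftarrow>us. ev v) = (\<Sum>v\<leftarrow>us'. ev v)"
    "mset (map bl us) = mset (map bl us')"
  shows "prod_list (map x us) = prod_list (map x us')"
proof -
  have "tvec x \<longleftrightarrow> (\<forall>v. v \<notin> W \<longrightarrow> x v = 0) \<and>
    (\<forall>us us'. set us \<subseteq> W \<longrightarrow> set us' \<subseteq> W \<longrightarrow> (\<Sum>v\<leftarrow>us. ev v) = (\<Sum>v\<leftarrow>us'. ev v) \<longrightarrow>
       mset (map bl us) = mset (map bl us') \<longrightarrow> prod_list (map x us) = prod_list (map x us'))"
    by (rule tvec_iff) (use nonneg keys in auto)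
  then show ?thesis using assms by blast
qed

lemma tvecI:
  assumes "\<And>v. v \<notin> W \<Longrightarrow> x v = 0"
    "\<And>us us'. \<lbrakk>set us \<subseteq> W; set us' \<subseteq> W; (\<Sum>v\<leftarrow>us. ev v) = (\<Sum>v\<leftarrow>us'. ev v);
      mset (map bl us) = mset (map bl us')\<rbrakk> \<Longrightarrow> prod_list (map x us) = prod_list (map x us')"
  shows "tvec x"
proof -
  have "tvec x \<longleftrightarrow> (\<forall>v. v \<notin> W \<longrightarrow> x v = 0) \<and>
    (\<forall>us us'. set us \<subseteq> W \<longrightarrow> set us' \<subseteq> W \<longrightarrow> (\<Sum>v\<leftarrow>us. ev v) = (\<Sum>v\<leftarrow>us'. ev v) \<longrightarrow>
       mset (map bl us) = mset (map bl us') \<longrightarrow> prod_list (map x us) = prod_list (map x us'))"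
    by (rule tvec_iff) (use nonneg keys in auto)
  then show ?thesis using assms by blast
qed

lemma avec_iff:
  "avec y \<longleftrightarrow> (\<forall>a. a \<notin> A \<longrightarrow> y a = 0) \<and>
    (\<forall>as as'. set as \<subseteq> A \<longrightarrow> set as' \<subseteq> A \<longrightarrow> (\<Sum>a\<leftarrow>as. a) = (\<Sum>a\<leftarrow>as'. a) \<longrightarrow>
       mset (map pt as) = mset (map pt as') \<longrightarrow> prod_list (map y as) = prod_list (map y as'))"
  by (rule toric_vec_lattice_iff[of A A "\<lambda>a. a" I pt, OF order_refl]) (use A_nonneg A_keys in auto)

lemma mset_map_pt: "mset (map pt as) = mset (map pt as') \<longleftrightarrow> length as = length as'"
proof
  show "mset (map pt as) = mset (map pt as') \<Longrightarrow> length as = length as'"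
    by (drule mset_eq_length) simp
qed (simp add: map_replicate_const)

lemma avec_prod_eq:
  assumes "avec y" "set as \<subseteq> A" "set as' \<subseteq> A" "sum_list as = sum_list as'" "length as = length as'"
  shows "prod_list (map y as) = prod_list (map y as')"
proof -
  have "mset (map pt as) = mset (map pt as')" using assms(5) mset_map_pt by blast
  moreover have "(\<Sum>a\<leftarrow>as. a) = (\<Sum>a\<leftarrow>as'. a)" using assms(4) by simp
  ultimately show ?thesis
    using assms(1)[unfolded avec_iff] assms(2,3) by blast
qed

lemma avecI:
  assumes "\<And>a. a \<notin> A \<Longrightarrow> y a = 0"
    "\<And>as as'. \<lbrakk>set as \<subseteq> A; set as' \<subseteq> A; sum_list as = sum_list as'; length as = length as'\<rbrakk> \<Longrightarrow>
      prod_list (map y as) = prod_list (map y as')"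
  shows "avec y"
  unfolding avec_iff
proof (intro conjI allI impI)
  fix as as' assume "set as \<subseteq> A" "set as' \<subseteq> A" "(\<Sum>a\<leftarrow>as. a) = (\<Sum>a\<leftarrow>as'. a)"
    "mset (map pt as) = mset (map pt as')"
  then show "prod_list (map y as) = prod_list (map y as')"
    by (intro assms(2)) (simp_all only: mset_map_pt list.map_ident)
qed (rule assms(1))

lemma segre_vec_section_sum:
  assumes "tvec x" "u \<in> sections"
  shows "segre_vec x (section_sum u) = (\<Prod>b\<in>bl ` V. x (u b))"
proof -
  have A: "section_sum u \<in> A" using assms(2) by (simp add: segre_exponents_def)
  note s = conjunct1[OF section_of[OF A]] conjunct2[OF section_of[OF A]]
  have "segre_vec x (section_sum u) = (\<Prod>v\<leftarrow>map (section_of (section_sum u)) labels. x v)"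
    unfolding segre_vec_def using A by (rule if_P)
  also have "\<dots> = (\<Prod>v\<leftarrow>map u labels. x v)"
    by (rule tvec_prod_eq[OF assms(1)])
      (simp_all only: sections_list[OF s(1)] sections_list[OF assms(2)] s(2))
  also have "\<dots> = (\<Prod>b\<in>bl ` V. x (u b))"
    unfolding map_map comp_def labels(1)[symmetric]
    by (rule prod.distinct_set_conv_list[OF labels(2), symmetric])
  finally show ?thesis .
qed

text \<open>Concatenating the chosen sections expands a relation between lists of equal length in
  \<open>A\<close> into a relation between lists in \<open>W\<close>. Every label then occurs on
  both sides as often as the original lists are long.\<close>

lemma avec_segre_vec:
  assumes x: "tvec x"
  shows "avec (segre_vec x)"
proof (rule avecI)
  show "a \<notin> A \<Longrightarrow> segre_vec x a = 0" for a by (simp add: segre_vec_def)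
next
  fix as as' assume as: "set as \<subseteq> A" "set as' \<subseteq> A" "sum_list as = sum_list as'" "length as = length as'"
  define cc where "cc xs = concat (map (\<lambda>a. map (section_of a) labels) xs)" for xs
  have cc: "prod_list (map (segre_vec x) xs) = prod_list (map x (cc xs))"
    "set (cc xs) \<subseteq> W" "(\<Sum>v\<leftarrow>cc xs. ev v) = sum_list xs"
    "mset (map bl (cc xs)) = repeat_mset (length xs) (mset labels)" if "set xs \<subseteq> A" for xs
    using that
  proof (induction xs)
    case Nil
    { case 1 show ?case by (simp add: cc_def) }
    { case 2 show ?case by (simp add: cc_def) }
    { case 3 show ?case by (simp add: cc_def) }
    { case 4 show ?case by (simp add: cc_def) }
  next
    case (Cons a xs)
    have cc_Cons: "cc (a # xs) = map (section_of a) labels @ cc xs" by (simp add: cc_def)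
    {
      case 1
      then have a: "a \<in> A" "set xs \<subseteq> A" by auto
      show ?case using a Cons.IH(1)[OF a(2)] by (simp add: cc_Cons segre_vec_def)
    next
      case 2
      then have a: "a \<in> A" "set xs \<subseteq> A" by auto
      show ?case using Cons.IH(2)[OF a(2)] sections_list(1)[OF conjunct1[OF section_of[OF a(1)]]]
        by (simp add: cc_Cons)
    next
      case 3
      then have a: "a \<in> A" "set xs \<subseteq> A" by auto
      note s = section_of[OF a(1)]
      show ?case
        using Cons.IH(3)[OF a(2)] sections_list(3)[OF conjunct1[OF s]] conjunct2[OF s]
        unfolding cc_Cons map_append sum_list_append sum_list.Cons by simp
    next
      case 4
      then have a: "a \<in> A" "set xs \<subseteq> A" by auto
      show ?case
        using Cons.IH(4)[OF a(2)] sections_list(2)[OF conjunct1[OF section_of[OF a(1)]]]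
        unfolding cc_Cons map_append mset_append by simp
    }
  qed
  show "prod_list (map (segre_vec x) as) = prod_list (map (segre_vec x) as')"
    unfolding cc(1)[OF as(1)] cc(1)[OF as(2)]
    by (rule tvec_prod_eq[OF x])
      (simp_all only: cc(2-4)[OF as(1)] cc(2-4)[OF as(2)] as(3,4))
qed

lemma sections_update: "u \<in> sections \<Longrightarrow> v \<in> W \<Longrightarrow> u(bl v := v) \<in> sections"
  unfolding sections_def by simp

lemma section_sum_update:
  assumes "v \<in> W"
  shows "section_sum (u(bl v := v)) = shift u v"
proof -
  have b: "bl v \<in> bl ` V" "finite (bl ` V)" using assms WV finV by auto
  have "section_sum (u(bl v := v)) = ev v + (\<Sum>b\<in>bl ` V - {bl v}. ev (u b))"
    unfolding section_sum_def sum.remove[OF b(2,1)] by simp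
  moreover have "section_sum u = ev (u (bl v)) + (\<Sum>b\<in>bl ` V - {bl v}. ev (u b))"
    unfolding section_sum_def sum.remove[OF b(2,1)] by simp
  ultimately show ?thesis by (simp add: shift_def)
qed

lemma shift_in_A: "u \<in> sections \<Longrightarrow> v \<in> W \<Longrightarrow> shift u v \<in> A"
  unfolding section_sum_update[symmetric] segre_exponents_def using sections_update by blast

text \<open>The scalar in front of \<open>x v\<close> depends on \<open>v\<close> only through its
  label, which is the freedom allowed in a product of projective spaces.\<close>

lemma segre_inv_segre_vec:
  assumes "tvec x" "u \<in> sections" "v \<in> W"
  shows "segre_inv_vec u (segre_vec x) v = (\<Prod>b\<in>bl ` V - {bl v}. x (u b)) * x v"
proof -
  have b: "bl v \<in> bl ` V" "finite (bl ` V)" using assms WV finV by auto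
  have "segre_inv_vec u (segre_vec x) v = segre_vec x (section_sum (u(bl v := v)))"
    using assms(3) by (simp add: segre_inv_vec_def section_sum_update)
  also have "\<dots> = (\<Prod>b\<in>bl ` V. x ((u(bl v := v)) b))"
    by (rule segre_vec_section_sum[OF assms(1) sections_update[OF assms(2,3)]])
  also have "\<dots> = (\<Prod>b\<in>bl ` V - {bl v}. x (u b)) * x v"
    unfolding prod.remove[OF b(2,1)] by (simp add: mult.commute)
  finally show ?thesis .
qed

lemma sum_list_eq_if_mset_eq:
  assumes "mset bs = mset bs'" shows "(\<Sum>b\<leftarrow>bs. f b) = (\<Sum>b\<leftarrow>bs'. f b :: 'c::comm_monoid_add)"
proof -
  have eq: "(\<Sum>b\<leftarrow>bs. f b) = sum_mset (image_mset f (mset bs))" for bs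
    unfolding mset_map[symmetric] sum_mset_sum_list by (rule refl)
  show ?thesis unfolding eq assms by (rule refl)
qed

lemma sum_list_shift:
  "(\<Sum>v\<leftarrow>us. shift u v) + (\<Sum>b\<leftarrow>map bl us. ev (u b)) =
    (\<Sum>v\<leftarrow>us. ev v) + (\<Sum>_\<leftarrow>us. section_sum u)"
  by (induction us) (simp_all add: shift_def algebra_simps)

text \<open>Equal label multisets make the subtracted terms \<open>ev (u (bl v))\<close> cancel, and
  equal lengths do the same for the copies of \<open>section_sum u\<close>; hence a relation between
  exponents carries over to the shifts.\<close>

lemma tvec_segre_inv_vec:
  assumes y: "avec y" and u: "u \<in> sections"
  shows "tvec (segre_inv_vec u y)"
proof (rule tvecI)
  show "v \<notin> W \<Longrightarrow> segre_inv_vec u y v = 0" for v by (simp add: segre_inv_vec_def)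
next
  fix us us' assume us: "set us \<subseteq> W" "set us' \<subseteq> W" "(\<Sum>v\<leftarrow>us. ev v) = (\<Sum>v\<leftarrow>us'. ev v)"
    "mset (map bl us) = mset (map bl us')"
  have eq: "prod_list (map (segre_inv_vec u y) xs) = prod_list (map y (map (shift u) xs))"
    if "set xs \<subseteq> W" for xs
    using that by (induction xs) (auto simp: segre_inv_vec_def)
  have len: "length us = length us'" using mset_eq_length[OF us(4)] unfolding length_map .
  have bl_sum: "(\<Sum>b\<leftarrow>map bl us. ev (u b)) = (\<Sum>b\<leftarrow>map bl us'. ev (u b))"
    by (rule sum_list_eq_if_mset_eq[OF us(4)])
  have "(\<Sum>_\<leftarrow>us. section_sum u) = (\<Sum>_\<leftarrow>us'. section_sum u)"
    unfolding map_replicate_const len by (rule refl)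
  then have "(\<Sum>v\<leftarrow>us. shift u v) + (\<Sum>b\<leftarrow>map bl us. ev (u b)) =
      (\<Sum>v\<leftarrow>us'. shift u v) + (\<Sum>b\<leftarrow>map bl us. ev (u b))"
    unfolding sum_list_shift unfolding bl_sum sum_list_shift us(3) by (rule arg_cong)
  then have "(\<Sum>v\<leftarrow>us. shift u v) = (\<Sum>v\<leftarrow>us'. shift u v)" unfolding add_right_cancel .
  then show "prod_list (map (segre_inv_vec u y) us) = prod_list (map (segre_inv_vec u y) us')"
    unfolding eq[OF us(1)] eq[OF us(2)] using us(1,2) shift_in_A[OF u] len
    by (intro avec_prod_eq[OF y]) auto
qed

text \<open>Shifting each factor of a section with exponent \<open>a\<close> gives a list with the
  same length and sum as \<open>a\<close> followed by copies of \<open>section_sum u\<close>, one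
  fewer than there are factors. The equations for \<open>y\<close> then equate the two
  products.\<close>

lemma segre_segre_inv_vec:
  assumes y: "avec y" and u: "u \<in> sections" and a: "a \<in> A"
  shows "segre_vec (segre_inv_vec u y) a = y (section_sum u) ^ (length labels - 1) * y a"
proof -
  let ?s = "section_of a" and ?a0 = "section_sum u"
  note s = conjunct1[OF section_of[OF a]] conjunct2[OF section_of[OF a]]
  have ne: "labels \<noteq> []" using labels(1) V_ne by auto
  have a0: "?a0 \<in> A" using u by (simp add: segre_exponents_def)
  let ?us = "map ?s labels"
  have "segre_vec (segre_inv_vec u y) a = prod_list (map (segre_inv_vec u y) ?us)"
    using a by (simp add: segre_vec_def)
  also have "\<dots> = prod_list (map y (map (shift u) ?us))"
    using sections_list(1)[OF s(1)]
    by (intro arg_cong[where f=prod_list]) (auto simp: segre_inv_vec_def)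
  also have "\<dots> = prod_list (map y (a # replicate (length labels - 1) ?a0))"
  proof (rule avec_prod_eq[OF y])
    show "set (map (shift u) ?us) \<subseteq> A"
      using sections_list(1)[OF s(1)] shift_in_A[OF u] by auto
    show "set (a # replicate (length labels - 1) ?a0) \<subseteq> A"
      using a a0 by auto
    show "length (map (shift u) ?us) = length (a # replicate (length labels - 1) ?a0)"
      using ne by (cases labels) auto
    have "(\<Sum>b\<leftarrow>map bl ?us. ev (u b)) = (\<Sum>b\<leftarrow>labels. ev (u b))"
      by (rule sum_list_eq_if_mset_eq[OF sections_list(2)[OF s(1)]])
    also have "\<dots> = ?a0"
      using sections_list(3)[OF u] unfolding map_map comp_def .
    finally have "(\<Sum>v\<leftarrow>?us. shift u v) + ?a0 = a + (\<Sum>_\<leftarrow>?us. ?a0)"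
      using sum_list_shift[of u ?us] sections_list(3)[OF s(1)] s(2) by simp
    also have "(\<Sum>_\<leftarrow>?us. ?a0) = ?a0 + sum_list (replicate (length labels - 1) ?a0)"
      using ne by (cases labels) (simp_all add: map_replicate_const)
    finally show "sum_list (map (shift u) ?us) = sum_list (a # replicate (length labels - 1) ?a0)"
      by (simp add: algebra_simps)
  qed
  also have "\<dots> = y ?a0 ^ (length labels - 1) * y a"
    by (simp add: prod_list_replicate mult.commute)
  finally show ?thesis .
qed

lemma segre_vec_scale:
  assumes "a \<in> A"
  shows "segre_vec (\<lambda>v. k (bl v) * x v) a = (\<Prod>b\<leftarrow>labels. k b) * segre_vec x a"
proof -
  note s = conjunct1[OF section_of[OF assms]]
  have "(\<Prod>v\<leftarrow>map (section_of a) bs. k (bl v) * x v) =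
      (\<Prod>b\<leftarrow>bs. k b) * (\<Prod>v\<leftarrow>map (section_of a) bs. x v)" if "set bs \<subseteq> bl ` V" for bs
    using that sectionsD(2)[OF s] by (induction bs) (simp_all add: ac_simps)
  then show ?thesis using assms labels(1) by (simp add: segre_vec_def)
qed

lemma ex_section_nonzero:
  assumes "tvec x" "x \<in> mproj_vec V bl"
  shows "\<exists>u\<in>sections. \<forall>b\<in>bl ` V. x (u b) \<noteq> 0"
proof -
  have "\<forall>b\<in>bl ` V. \<exists>v. v \<in> V \<and> bl v = b \<and> x v \<noteq> 0"
    using mproj_vecD[OF assms(2)] by blast
  from bchoice[OF this] obtain u where u: "\<forall>b\<in>bl ` V. u b \<in> V \<and> bl (u b) = b \<and> x (u b) \<noteq> 0"
    by blast
  then have "u \<in> sections"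
    unfolding sections_def using toric_vec_off[OF assms(1)] by blast
  then show ?thesis using u by blast
qed

lemma segre_vec_in_mproj_vec:
  assumes "tvec x" "x \<in> mproj_vec V bl"
  shows "segre_vec x \<in> mproj_vec A pt"
proof -
  obtain u where u: "u \<in> sections" "\<forall>b\<in>bl ` V. x (u b) \<noteq> 0"
    using ex_section_nonzero[OF assms] by blast
  have "segre_vec x (section_sum u) \<noteq> 0"
    unfolding segre_vec_section_sum[OF assms(1) u(1)] using u(2) finV by simp
  moreover have "section_sum u \<in> A" using u(1) by (simp add: segre_exponents_def)
  moreover have "segre_vec x a = 0" if "a \<notin> A" for a using that by (simp add: segre_vec_def)
  ultimately show ?thesis unfolding mproj_vec_def by auto
qed

lemma segre_inv_vec_in_mproj_vec:
  assumes "u \<in> sections" "y (section_sum u) \<noteq> 0"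
  shows "segre_inv_vec u y \<in> mproj_vec V bl"
proof -
  have "segre_inv_vec u y (u b) \<noteq> 0" "u b \<in> V" "bl (u b) = b" if "b \<in> bl ` V" for b
    using sectionsD[OF assms(1) that] WV assms(2) by (auto simp: segre_inv_vec_def shift_def)
  moreover have "segre_inv_vec u y v = 0" if "v \<notin> V" for v
    using that WV by (auto simp: segre_inv_vec_def)
  ultimately show ?thesis unfolding mproj_vec_def by blast
qed

abbreviation "X \<equiv> toric_locus V bl W I (\<lambda>v. lattice_exponent (ev v))"

definition segre_map :: "('v \<Rightarrow> complex) set \<Rightarrow> (('q \<Rightarrow>\<^sub>0 int) \<Rightarrow> complex) set" where
  "segre_map c = proj_class A pt (segre_vec (SOME x. x \<in> c))"

lemma X_rep:
  assumes "c \<in> X" "x \<in> c"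
  shows "tvec x" "x \<in> mproj_vec V bl" "c = proj_class V bl x"
proof -
  have "c \<in> mproj V bl" using assms(1) unfolding toric_locus_def by blast
  from mproj_rep[OF this assms(2)] show "x \<in> mproj_vec V bl" "c = proj_class V bl x" .
  show "tvec x" using assms unfolding toric_locus_def by blast
qed

lemma X_ne: "c \<in> X \<Longrightarrow> \<exists>x. x \<in> c"
  unfolding toric_locus_def using mprojE by blast

lemma segre_map_eq:
  assumes "c \<in> X" "x \<in> c"
  shows "segre_map c = proj_class A pt (segre_vec x)"
proof -
  define x0 where "x0 = (SOME x. x \<in> c)"
  have x0: "x0 \<in> c" unfolding x0_def some_in_eq using assms(2) by blast
  have "x \<in> proj_class V bl x0" using X_rep(3)[OF assms(1) x0] assms(2) by simp
  then obtain k where k: "\<And>b. k b \<noteq> 0" "x = (\<lambda>v. k (bl v) * x0 v)"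
    by (rule proj_class_memD) blast
  show ?thesis
    unfolding segre_map_def x0_def[symmetric]
  proof (rule proj_class_eqI[where k="\<lambda>_. \<Prod>b\<leftarrow>labels. k b"])
    show "segre_vec x0 \<in> mproj_vec A pt" "segre_vec x \<in> mproj_vec A pt"
      using X_rep[OF assms(1) x0] X_rep[OF assms] segre_vec_in_mproj_vec by blast+
    show "(\<Prod>b\<leftarrow>labels. k b) \<noteq> 0" using k(1) by (simp add: prod_list_zero_iff image_iff)
    show "segre_vec x a = (\<Prod>b\<leftarrow>labels. k b) * segre_vec x0 a" if "a \<in> A" for a
      unfolding k(2) by (rule segre_vec_scale[OF that])
  qed
qed

lemma proj_class_in_X:
  assumes "tvec x" "x \<in> mproj_vec V bl"
  shows "proj_class V bl x \<in> X"
  using proj_class_in_toric_locus_iff(1)[OF finV finI WV assms(2), of "\<lambda>v. lattice_exponent (ev v)"]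
    assms(1) by blast

lemma proj_class_in_closure:
  assumes "avec y" "y \<in> mproj_vec A pt"
  shows "proj_class A pt y \<in> toric_closure A"
  unfolding toric_closure_A
  using proj_class_in_toric_locus_iff(1)[OF finite_A finI order_refl assms(2), of lattice_exponent]
    assms(1) by blast

lemma closure_rep:
  assumes "c \<in> toric_closure A" "y \<in> c"
  shows "avec y" "y \<in> mproj_vec A pt" "c = proj_class A pt y"
proof -
  have c: "c \<in> mproj A pt" "\<forall>y\<in>c. avec y"
    using assms(1) unfolding toric_closure_A toric_locus_def by blast+
  from mproj_rep[OF c(1) assms(2)] show "y \<in> mproj_vec A pt" "c = proj_class A pt y" .
  show "avec y" using c(2) assms(2) by blast
qed

lemma ex_section_sum_nonzero:
  assumes "y \<in> mproj_vec A pt"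
  shows "\<exists>u\<in>sections. y (section_sum u) \<noteq> 0"
proof -
  have "() \<in> pt ` A" using A_ne by auto
  from mproj_vecD[OF assms this] obtain a where a: "a \<in> A" "y a \<noteq> 0" by blast
  then obtain u where "u \<in> sections" "a = section_sum u" unfolding segre_exponents_def by blast
  with a(2) show ?thesis by blast
qed

text \<open>The hypothesis \<open>inv\<close> says that the chart belonging to \<open>u\<close> is
  defined at \<open>y\<close>. It forces the scalar \<open>q b\<close> to be nonzero in every
  factor, and so the original point is recovered; injectivity and the regularity of the inverse both
  rest on this.\<close>

lemma segre_inv_of_segre_map:
  assumes x: "tvec x" "x \<in> mproj_vec V bl" and u: "u \<in> sections"
    and y: "y \<in> proj_class A pt (segre_vec x)"
    and inv: "segre_inv_vec u y \<in> mproj_vec V bl"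
  shows "proj_class V bl (segre_inv_vec u y) = proj_class V bl x"
proof -
  obtain k where k: "\<And>b. k b \<noteq> 0" "y = (\<lambda>a. k (pt a) * segre_vec x a)"
    using y by (rule proj_class_memD) blast
  define q where "q b = k () * (\<Prod>b'\<in>bl ` V - {b}. x (u b'))" for b
  have eq: "segre_inv_vec u y v = q (bl v) * x v" if "v \<in> W" for v
    using segre_inv_segre_vec[OF x(1) u that] that
    by (simp add: segre_inv_vec_def k(2) q_def)
  have eqV: "segre_inv_vec u y v = q (bl v) * x v" for v
  proof (cases "v \<in> W")
    case False
    then show ?thesis using toric_vec_off[OF x(1)] by (simp add: segre_inv_vec_def)
  qed (rule eq)
  have q: "q b \<noteq> 0" if "b \<in> bl ` V" for b
  proof -
    from mproj_vecD[OF inv that] obtain v where v: "bl v = b" "segre_inv_vec u y v \<noteq> 0" by blast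
    from v(2) have "q (bl v) * x v \<noteq> 0" unfolding eqV .
    then show ?thesis unfolding v(1) by simp
  qed
  show ?thesis
  \<comment> \<open>Projective equality asks for a nonzero scalar at every label, including those
    that do not occur; there the value 1 is taken.\<close>
  proof (rule proj_class_eqI[where k="\<lambda>b. if b \<in> bl ` V then inverse (q b) else 1"])
    show "(if b \<in> bl ` V then inverse (q b) else 1) \<noteq> 0" for b using q by simp
    fix v assume "v \<in> V"
    then have "bl v \<in> bl ` V" by blast
    with q[OF this] eqV[of v]
    show "x v = (if bl v \<in> bl ` V then inverse (q (bl v)) else 1) * segre_inv_vec u y v"
      by (simp add: field_simps)
  qed (use inv x in auto)
qed

lemma segre_map_in_closure: "c \<in> X \<Longrightarrow> segre_map c \<in> toric_closure A"
proof -
  assume c: "c \<in> X"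
  then obtain x where x: "x \<in> c" using X_ne by blast
  show ?thesis
    unfolding segre_map_eq[OF c x]
    by (intro proj_class_in_closure avec_segre_vec segre_vec_in_mproj_vec X_rep(1,2)[OF c x])
qed

lemma bij_segre_map: "bij_betw segre_map X (toric_closure A)"
  unfolding bij_betw_def
proof
  show "inj_on segre_map X"
  proof (rule inj_onI)
    fix c c' assume c: "c \<in> X" "c' \<in> X" and eq: "segre_map c = segre_map c'"
    obtain x x' where x: "x \<in> c" "x' \<in> c'" using X_ne c by blast
    note r = X_rep[OF c(1) x(1)] and r' = X_rep[OF c(2) x(2)]
    have y: "segre_vec x \<in> proj_class A pt (segre_vec x)"
      by (rule proj_class_self[OF segre_vec_in_mproj_vec[OF r(1,2)]])
    then have y': "segre_vec x \<in> proj_class A pt (segre_vec x')"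
      using eq segre_map_eq[OF c(1) x(1)] segre_map_eq[OF c(2) x(2)] by simp
    obtain u where u: "u \<in> sections" "segre_vec x (section_sum u) \<noteq> 0"
      using ex_section_sum_nonzero[OF segre_vec_in_mproj_vec[OF r(1,2)]] by blast
    have inv: "segre_inv_vec u (segre_vec x) \<in> mproj_vec V bl"
      using u by (rule segre_inv_vec_in_mproj_vec)
    show "c = c'"
      unfolding r(3) r'(3)
      by (rule trans[OF segre_inv_of_segre_map[OF r(1,2) u(1) y inv, symmetric]
        segre_inv_of_segre_map[OF r'(1,2) u(1) y' inv]])
  qed
  show "segre_map ` X = toric_closure A"
  proof (intro equalityI subsetI)
    fix c assume "c \<in> segre_map ` X"
    then show "c \<in> toric_closure A" using segre_map_in_closure by blast
  next
    fix c assume c: "c \<in> toric_closure A"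
    then have "c \<in> mproj A pt" unfolding toric_closure_A toric_locus_def by blast
    then obtain y where y: "y \<in> c" by (rule mprojE)
    note r = closure_rep[OF c y]
    obtain u where u: "u \<in> sections" "y (section_sum u) \<noteq> 0"
      using ex_section_sum_nonzero[OF r(2)] by blast
    let ?x = "segre_inv_vec u y"
    have x: "tvec ?x" "?x \<in> mproj_vec V bl"
      using tvec_segre_inv_vec[OF r(1) u(1)] segre_inv_vec_in_mproj_vec[of u y, OF u] by blast+
    note X = proj_class_in_X[OF x]
    have "segre_map (proj_class V bl ?x) = proj_class A pt (segre_vec ?x)"
      by (rule segre_map_eq[OF X proj_class_self[OF x(2)]])
    also have "\<dots> = proj_class A pt y"
      by (rule proj_class_eqI[where k="\<lambda>_. y (section_sum u) ^ (length labels - 1)", symmetric])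
        (use r(2) segre_vec_in_mproj_vec[OF x] u(2) segre_segre_inv_vec[OF r(1) u(1)] in auto)
    finally show "c \<in> segre_map ` X" using X r(3) by (intro image_eqI) auto
  qed
qed

lemma regular_segre_map: "regular_map V bl X A pt (toric_closure A) segre_map"
  unfolding regular_map_def
proof (intro conjI ballI)
  show "segre_map \<in> X \<rightarrow> toric_closure A" using segre_map_in_closure by blast
  fix c assume c: "c \<in> X"
  define F :: "('q \<Rightarrow>\<^sub>0 int) \<Rightarrow> 'v cpoly"
    where "F a = Poly_Mapping.single (monom_of (map (section_of a) labels)) 1" for a
  have ev_F: "(\<lambda>a. if a \<in> A then poly_eval x (F a) else 0) = segre_vec x" for x
    by (rule ext) (simp add: segre_vec_def F_def poly_eval_ring_hom monom_eval_monom_of)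
  show "\<exists>F :: ('q \<Rightarrow>\<^sub>0 int) \<Rightarrow> 'v cpoly.
      (\<forall>b. \<exists>D. \<forall>a\<in>A. pt a = b \<longrightarrow> multihom V bl D (F a)) \<and>
      (\<forall>x\<in>c. (\<lambda>a. if a \<in> A then poly_eval x (F a) else 0) \<in> mproj_vec A pt) \<and>
      (\<forall>c'\<in>X. \<forall>x\<in>c'. (\<lambda>a. if a \<in> A then poly_eval x (F a) else 0) \<in> mproj_vec A pt \<longrightarrow>
         (\<lambda>a. if a \<in> A then poly_eval x (F a) else 0) \<in> segre_map c')"
  proof (rule exI[of _ F], unfold ev_F, intro conjI allI ballI impI)
    fix b :: unit
    show "\<exists>D. \<forall>a\<in>A. pt a = b \<longrightarrow> multihom V bl D (F a)"
    \<comment> \<open>\<open>labels\<close> lists each factor once, so all Segre coordinates have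
      degree one in every factor.\<close>
    proof (rule exI[where x="count (mset labels)"], intro ballI impI)
      fix a assume "a \<in> A"
      note s = sections_list[OF conjunct1[OF section_of[OF this]]]
      have "set (map (section_of a) labels) \<subseteq> V" using s(1) WV by blast
      from multihom_single[OF this, of bl]
      show "multihom V bl (count (mset labels)) (F a)"
        unfolding F_def count_map_block_deg[symmetric] s(2) .
    qed
  next
    fix x assume "x \<in> c"
    then show "segre_vec x \<in> mproj_vec A pt"
      using X_rep[OF c] segre_vec_in_mproj_vec by blast
  next
    fix c' x assume "c' \<in> X" "x \<in> c'" "segre_vec x \<in> mproj_vec A pt"
    then show "segre_vec x \<in> segre_map c'"
      unfolding segre_map_eq[OF \<open>c' \<in> X\<close> \<open>x \<in> c'\<close>] by (intro proj_class_self)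
  qed
qed

text \<open>The local formula uses a section \<open>u\<close> whose Segre coordinate does not vanish
  at the given point. Wherever the formula defines a point, it agrees with the inverse map up to
  scalars in the factors.\<close>

lemma regular_inv_segre_map:
  "regular_map A pt (toric_closure A) V bl X (inv_into X segre_map)"
  unfolding regular_map_def
proof (intro conjI ballI)
  show "inv_into X segre_map \<in> toric_closure A \<rightarrow> X"
    using bij_betw_inv_into[OF bij_segre_map] unfolding bij_betw_def by blast
  fix c assume c: "c \<in> toric_closure A"
  then have "c \<in> mproj A pt" unfolding toric_closure_A toric_locus_def by blast
  then obtain y0 where y0: "y0 \<in> c" by (rule mprojE)
  obtain u where u: "u \<in> sections" "y0 (section_sum u) \<noteq> 0"
    using ex_section_sum_nonzero[OF closure_rep(2)[OF c y0]] by blast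
  define F :: "'v \<Rightarrow> ('q \<Rightarrow>\<^sub>0 int) cpoly" where "F v = (if v \<in> W then Var (shift u v) else 0)" for v
  have ev_F: "(\<lambda>v. if v \<in> V then poly_eval y (F v) else 0) = segre_inv_vec u y" for y
    by (rule ext) (use WV in \<open>auto simp: segre_inv_vec_def F_def poly_eval_ring_hom\<close>)
  show "\<exists>F :: 'v \<Rightarrow> ('q \<Rightarrow>\<^sub>0 int) cpoly.
      (\<forall>b. \<exists>D. \<forall>v\<in>V. bl v = b \<longrightarrow> multihom A pt D (F v)) \<and>
      (\<forall>y\<in>c. (\<lambda>v. if v \<in> V then poly_eval y (F v) else 0) \<in> mproj_vec V bl) \<and>
      (\<forall>c'\<in>toric_closure A. \<forall>y\<in>c'. (\<lambda>v. if v \<in> V then poly_eval y (F v) else 0) \<in> mproj_vec V bl \<longrightarrow>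
         (\<lambda>v. if v \<in> V then poly_eval y (F v) else 0) \<in> inv_into X segre_map c')"
  proof (rule exI[of _ F], unfold ev_F, intro conjI allI ballI impI)
    fix b
    show "\<exists>D. \<forall>v\<in>V. bl v = b \<longrightarrow> multihom A pt D (F v)"
    proof (rule exI[where x="\<lambda>_. 1"], intro ballI impI)
      fix v
      show "multihom A pt (\<lambda>_. 1) (F v)"
      proof (cases "v \<in> W")
        case True
        have "block_deg pt (shift u v) = (\<lambda>_. 1)" by (simp add: block_deg_def fun_eq_iff)
        then show ?thesis
          using multihom_Var[OF shift_in_A[OF u(1) True], of pt] True by (simp add: F_def)
      qed (simp add: F_def)
    qed
  next
    fix y assume y: "y \<in> c"
    then have "y \<in> proj_class A pt y0" using closure_rep(3)[OF c y0] by simp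
    then obtain k where "\<And>b. k b \<noteq> 0" "y = (\<lambda>a. k (pt a) * y0 a)" by (rule proj_class_memD) blast
    then have "y (section_sum u) \<noteq> 0" using u(2) by simp
    then show "segre_inv_vec u y \<in> mproj_vec V bl" by (rule segre_inv_vec_in_mproj_vec[OF u(1)])
  next
    fix c' y assume c': "c' \<in> toric_closure A" "y \<in> c'" and inv: "segre_inv_vec u y \<in> mproj_vec V bl"
    have im: "c' \<in> segre_map ` X" using bij_segre_map c'(1) unfolding bij_betw_def by blast
    define c0 where "c0 = inv_into X segre_map c'"
    have c0: "c0 \<in> X" "segre_map c0 = c'"
      unfolding c0_def using inv_into_into[OF im] f_inv_into_f[OF im] by blast+
    then obtain x where x: "x \<in> c0" using X_ne by blast
    note r = X_rep[OF c0(1) x]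
    have "y \<in> proj_class A pt (segre_vec x)"
      using c'(2) c0(2) segre_map_eq[OF c0(1) x] by simp
    from segre_inv_of_segre_map[OF r(1,2) u(1) this inv]
    show "segre_inv_vec u y \<in> inv_into X segre_map c'"
      unfolding c0_def[symmetric] r(3) using proj_class_self[OF inv] by simp
  qed
qed

theorem isomorphic_toric_locus:
  "isomorphic_varieties V bl X A pt (toric_closure A)"
  unfolding isomorphic_varieties_def
  using bij_segre_map regular_segre_map regular_inv_segre_map by blast

end

section \<open>Convexity in spaces of finitely supported functions\<close>

lemma lookup_scaleR: "Poly_Mapping.lookup (c *\<^sub>R x) p = c *\<^sub>R Poly_Mapping.lookup x p"
proof -
  have "finite {p. c *\<^sub>R Poly_Mapping.lookup x p \<noteq> 0}"
    by (rule finite_subset[OF _ finite_keys[of x]]) (auto simp: in_keys_iff)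
  then show ?thesis by (simp add: scaleR_poly_mapping_def)
qed

text \<open>Let \<open>D\<close> consist of the hull points that either miss \<open>F\<close> or lie
  in the hull of \<open>F \<inter> V\<close>. The face property makes \<open>D\<close> convex, and
  it contains \<open>V\<close>, hence the whole hull. No topology or finite dimension
  enters.\<close>

lemma face_of_convex_hull_eq:
  fixes V :: "'a::real_vector set"
  assumes F: "F face_of convex hull V"
  shows "F = convex hull (F \<inter> V)"
proof
  have "convex F" using F unfolding face_of_def by blast
  then show "convex hull (F \<inter> V) \<subseteq> F" by (intro hull_minimal) auto
  define D where "D = {x \<in> convex hull V. x \<in> F \<longrightarrow> x \<in> convex hull (F \<inter> V)}"
  have "convex D"
    unfolding convex_alt
  proof (intro ballI allI impI)
    fix x y u assume x: "x \<in> D" and y: "y \<in> D" and u: "(0::real) \<le> u \<and> u \<le> 1"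
    let ?z = "(1 - u) *\<^sub>R x + u *\<^sub>R y"
    have xy: "x \<in> convex hull V" "y \<in> convex hull V" using x y unfolding D_def by blast+
    have z: "?z \<in> convex hull V"
      by (rule convexD_alt[OF convex_convex_hull]) (use xy u in auto)
    moreover have "?z \<in> convex hull (F \<inter> V)" if zF: "?z \<in> F"
    proof -
      consider "u = 0" | "u = 1" | "x = y" | "0 < u" "u < 1" "x \<noteq> y" using u by fastforce
      then show ?thesis
      proof cases
        case 1
        then show ?thesis using x zF by (simp add: D_def)
      next
        case 2
        then show ?thesis using y zF by (simp add: D_def)
      next
        case 3
        then have "?z = x" by (simp add: algebra_simps)
        then show ?thesis using x zF by (simp add: D_def)
      next
        case 4
        then have "?z \<in> open_segment x y" by (auto simp: in_segment)
        from face_ofD[OF F this xy zF] have "x \<in> F" "y \<in> F" by blast+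
        then have "x \<in> convex hull (F \<inter> V)" "y \<in> convex hull (F \<inter> V)"
          using x y unfolding D_def by blast+
        then show ?thesis
          by (rule convexD_alt[OF convex_convex_hull]) (use u in auto)
      qed
    qed
    ultimately show "?z \<in> D" unfolding D_def by blast
  qed
  moreover have "V \<subseteq> D"
  proof
    fix v assume "v \<in> V"
    then have "v \<in> convex hull V" "v \<in> F \<Longrightarrow> v \<in> convex hull (F \<inter> V)" by (simp_all add: hull_inc)
    then show "v \<in> D" unfolding D_def by blast
  qed
  ultimately have "convex hull V \<subseteq> D" by (intro hull_minimal)
  then show "F \<subseteq> convex hull (F \<inter> V)"
    using F face_of_imp_subset unfolding D_def by blast
qed

lemma face_of_convex_hull_polytope:
  assumes "finite V" "F face_of convex hull V"
  shows "polytope F"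
  unfolding polytope_def using face_of_convex_hull_eq[OF assms(2)] assms(1) by blast

lemma finite_faces_convex_hull:
  assumes "finite V"
  shows "finite {F. F face_of convex hull V}"
proof (rule finite_subset)
  show "{F. F face_of convex hull V} \<subseteq> (hull) convex ` Pow V"
    using face_of_convex_hull_eq[of _ V] by blast
qed (use assms in simp)

text \<open>The union of the region \<open>h > 0\<close> with the hull of the zeros in
  \<open>V\<close> is convex: a zero inside a segment between points with nonnegative values forces
  both ends to be zeros. As the union contains \<open>V\<close>, it contains the hull.\<close>

lemma convex_hull_zeros_of_nonneg:
  assumes "linear h" "\<And>v. v \<in> V \<Longrightarrow> h v \<ge> (0::real)" "x \<in> convex hull V" "h x = 0"
  shows "x \<in> convex hull {v \<in> V. h v = 0}"
proof -
  let ?T = "convex hull {v \<in> V. h v = 0}"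
  define D where "D = {x. h x > 0} \<union> ?T"
  have "convex {x. h x = 0}"
    using assms(1) by (simp add: convex_alt linear_add linear_scale)
  then have T0: "?T \<subseteq> {x. h x = 0}" by (intro hull_minimal) auto
  have "convex D"
    unfolding convex_alt
  proof (intro ballI allI impI)
    fix x y u assume x: "x \<in> D" and y: "y \<in> D" and u: "(0::real) \<le> u \<and> u \<le> 1"
    let ?z = "(1 - u) *\<^sub>R x + u *\<^sub>R y"
    have hz: "h ?z = (1 - u) * h x + u * h y"
      using assms(1) by (simp add: linear_add linear_scale)
    have hx: "h x \<ge> 0" "h y \<ge> 0" using x y T0 unfolding D_def by fastforce+
    show "?z \<in> D"
    proof (cases "h ?z > 0")
      case True
      then show ?thesis by (simp add: D_def)
    next
      case False
      then have "(1 - u) * h x = 0" "u * h y = 0"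
        using hx u hz by (smt (verit) mult_nonneg_nonneg)+
      then consider "u = 1" "h y = 0" | "u = 0" "h x = 0" | "h x = 0" "h y = 0" by auto
      then show ?thesis
      proof cases
        case 1
        then show ?thesis using y by simp
      next
        case 2
        then show ?thesis using x by simp
      next
        case 3
        then have "x \<in> ?T" "y \<in> ?T" using x y unfolding D_def by auto
        then have "?z \<in> ?T"
          by (intro convexD_alt[OF convex_convex_hull]) (use u in auto)
        then show ?thesis by (simp add: D_def)
      qed
    qed
  qed
  moreover have "V \<subseteq> D"
  proof
    fix v assume v: "v \<in> V"
    show "v \<in> D"
    proof (cases "h v = 0")
      case True
      then show ?thesis using v hull_inc[of v "{v \<in> V. h v = 0}" convex] unfolding D_def by blast
    next
      case False
      then show ?thesis using assms(2)[OF v] unfolding D_def by simp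
    qed
  qed
  ultimately have "convex hull V \<subseteq> D" by (intro hull_minimal)
  then show ?thesis using assms(3,4) unfolding D_def by auto
qed

lemma nonneg_on_convex_hull:
  assumes "linear h" "\<And>v. v \<in> V \<Longrightarrow> h v \<ge> (0::real)" "x \<in> convex hull V"
  shows "h x \<ge> 0"
proof -
  have "convex {x. h x \<ge> 0}"
    using assms(1) by (auto simp: convex_alt linear_add linear_scale)
  then have "convex hull V \<subseteq> {x. h x \<ge> 0}" using assms(2) by (intro hull_minimal) auto
  then show ?thesis using assms(3) by blast
qed

lemma face_of_zeros_of_nonneg:
  assumes "linear h" "convex S" "\<And>x. x \<in> S \<Longrightarrow> h x \<ge> (0::real)"
  shows "{x \<in> S. h x = 0} face_of S"
  unfolding face_of_def
proof (intro conjI ballI impI)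
  show "convex {x \<in> S. h x = 0}"
    using assms(1,2) by (simp add: convex_alt linear_add linear_scale)
  fix a b x assume ab: "a \<in> S" "b \<in> S" "x \<in> {x \<in> S. h x = 0}" "x \<in> open_segment a b"
  then obtain u where u: "0 < u" "u < 1" "x = (1 - u) *\<^sub>R a + u *\<^sub>R b"
    by (auto simp: in_segment)
  have "(1 - u) * h a + u * h b = 0"
    using ab(3) assms(1) by (simp add: u(3) linear_add linear_scale)
  then have "(1 - u) * h a = 0" "u * h b = 0"
    using assms(3)[OF ab(1)] assms(3)[OF ab(2)] u(1,2) by (smt (verit) mult_nonneg_nonneg)+
  then show "a \<in> {x \<in> S. h x = 0}" "b \<in> {x \<in> S. h x = 0}" using ab(1,2) u(1,2) by simp_all
qed blast

lemma affine_dim_eqI: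
  assumes "S \<noteq> {}" "T \<noteq> {}"
    "span {x - y | x y. x \<in> S \<and> y \<in> S} = span {x - y | x y. x \<in> T \<and> y \<in> T}"
  shows "affine_dim S = affine_dim T"
  unfolding affine_dim_def using assms(1,2) dim_span[of "{x - y | x y. x \<in> S \<and> y \<in> S}"]
    dim_span[of "{x - y | x y. x \<in> T \<and> y \<in> T}"] unfolding assms(3) by simp

section \<open>Marked poset polytopes\<close>

lemma lookup_ind_vec: "finite J \<Longrightarrow> Poly_Mapping.lookup (ind_vec J) p = of_bool (p \<in> J)"
  unfolding ind_vec_def lookup_sum lookup_single when_def by (auto simp: sum.delta)

text \<open>The relabelling \<open>e\<close> is the identity when lattice points of a polytope are
  meant, and an injection into the natural numbers where \<open>toric_variety\<close> asks for
  exponents indexed by them.\<close>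

definition int_ind :: "('p \<Rightarrow> 'q) \<Rightarrow> 'p set \<Rightarrow> ('q \<Rightarrow>\<^sub>0 int)" where
  "int_ind e J = (\<Sum>p\<in>J. Poly_Mapping.single (e p) 1)"

lemma lookup_int_ind:
  assumes "finite J" "inj e"
  shows "Poly_Mapping.lookup (int_ind e J) (e p) = of_bool (p \<in> J)"
  using assms unfolding int_ind_def lookup_sum lookup_single when_def
  by (auto simp: sum.delta inj_eq)

lemma lookup_int_ind_notin:
  "q \<notin> e ` J \<Longrightarrow> Poly_Mapping.lookup (int_ind e J) q = 0"
  unfolding int_ind_def lookup_sum lookup_single when_def by (auto intro!: sum.neutral)

lemma lookup_real_vec: "Poly_Mapping.lookup (real_vec a) p = real_of_int (Poly_Mapping.lookup a p)"
  unfolding real_vec_def by (simp add: map.rep_eq when_def)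

text \<open>Cutting the interval from 0 to \<open>t\<close> into unit slices; this decomposes a
  point of the polytope into one layer per block.\<close>

lemma sum_clamp: "(\<Sum>j<l. min 1 (max 0 (t - real j))) = min (max t 0) (real l)"
  by (induction l) (auto simp: min_def max_def)

text \<open>Abstracts the flag poset: the marked elements form a chain from the least to the
  greatest element. Stronger orders on the same set satisfy the same axioms, so every result proved
  here is available for the cells as well.\<close>

locale marked_poset =
  fixes P :: "'p set" and r :: "'p rel" and l :: nat and mk :: "nat \<Rightarrow> 'p"
  assumes finP: "finite P" and po: "partial_order_on P r" and l_pos: "1 \<le> l"
    and mk_in: "\<And>i. 1 \<le> i \<Longrightarrow> i \<le> l \<Longrightarrow> mk i \<in> P"
    and mk_le: "\<And>i j. 1 \<le> i \<Longrightarrow> i \<le> j \<Longrightarrow> j \<le> l \<Longrightarrow> (mk i, mk j) \<in> r"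
    and mk_inj: "inj_on mk {1..l}"
    and mk_min: "\<And>p. p \<in> P \<Longrightarrow> (mk 1, p) \<in> r"
    and mk_max: "\<And>p. p \<in> P \<Longrightarrow> (p, mk l) \<in> r"
begin

abbreviation "L \<equiv> order_ideals P r"
abbreviation "Pm \<equiv> mk ` {1..l}"
abbreviation "marked_weight \<equiv> \<Sum>i = 1..l. ind_vec (mk ` {1..i})"
abbreviation "Q \<equiv> marked_polytope P Pm r marked_weight"

text \<open>As an ideal meets the marked chain in an initial segment, the block of an ideal is the
  number of its marked elements. In the flag setting it names the projective factor of the
  corresponding coordinate.\<close>

definition in_block :: "nat \<Rightarrow> 'p set \<Rightarrow> bool" where
  "in_block i J \<longleftrightarrow> J \<inter> Pm = mk ` {1..i}"

text \<open>The ideals of a tuple need not be nested, as they index the summands of a Minkowski sum.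
  Values outside \<open>{1..l}\<close> are arbitrary.\<close>

definition tuples :: "(nat \<Rightarrow> 'p set) set" where
  "tuples = {J. \<forall>i\<in>{1..l}. J i \<in> L \<and> in_block i (J i)}"

text \<open>These points generate the polytope; they need not all be extreme.\<close>

definition vertex :: "(nat \<Rightarrow> 'p set) \<Rightarrow> ('p \<Rightarrow>\<^sub>0 real)" where
  "vertex J = (\<Sum>i\<in>{1..l}. ind_vec (J i))"

lemma r_field: "(p, q) \<in> r \<Longrightarrow> p \<in> P" "(p, q) \<in> r \<Longrightarrow> q \<in> P"
  using partial_order_onD(4)[OF po] by auto

lemma r_refl: "p \<in> P \<Longrightarrow> (p, p) \<in> r"
  using partial_order_onD(1)[OF po] by (simp add: refl_on_def)

lemma r_trans: "(p, q) \<in> r \<Longrightarrow> (q, s) \<in> r \<Longrightarrow> (p, s) \<in> r"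
  using partial_order_onD(2)[OF po] by (rule transD)

lemma r_antisym: "(p, q) \<in> r \<Longrightarrow> (q, p) \<in> r \<Longrightarrow> p = q"
  using partial_order_onD(3)[OF po] by (rule antisymD)

lemma L_subset: "J \<in> L \<Longrightarrow> J \<subseteq> P" and L_down: "J \<in> L \<Longrightarrow> (p, q) \<in> r \<Longrightarrow> q \<in> J \<Longrightarrow> p \<in> J"
  unfolding order_ideals_def using r_field by blast+

lemma L_I: "J \<subseteq> P \<Longrightarrow> (\<And>p q. (p, q) \<in> r \<Longrightarrow> q \<in> J \<Longrightarrow> p \<in> J) \<Longrightarrow> J \<in> L"
  unfolding order_ideals_def by blast

lemma L_finite: "J \<in> L \<Longrightarrow> finite J"
  using L_subset finP finite_subset by blast

lemma finite_L: "finite L"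
  by (rule finite_subset[of _ "Pow P"]) (use finP L_subset in auto)

lemma L_Int: "J \<in> L \<Longrightarrow> J' \<in> L \<Longrightarrow> J \<inter> J' \<in> L"
  and L_Un: "J \<in> L \<Longrightarrow> J' \<in> L \<Longrightarrow> J \<union> J' \<in> L"
  unfolding order_ideals_def by blast+

lemma empty_L: "{} \<in> L" and P_L: "P \<in> L"
  unfolding order_ideals_def by blast+

lemma mk_le_iff: "1 \<le> i \<Longrightarrow> i \<le> l \<Longrightarrow> 1 \<le> j \<Longrightarrow> j \<le> l \<Longrightarrow> (mk i, mk j) \<in> r \<longleftrightarrow> i \<le> j"
proof
  assume ij: "1 \<le> i" "i \<le> l" "1 \<le> j" "j \<le> l" and "(mk i, mk j) \<in> r"
  show "i \<le> j"
  proof (rule ccontr)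
    assume "\<not> i \<le> j"
    then have "(mk j, mk i) \<in> r" using ij by (intro mk_le) auto
    then have "mk i = mk j" using \<open>(mk i, mk j) \<in> r\<close> r_antisym by blast
    then have "i = j" using inj_onD[OF mk_inj, of i j] ij by simp
    then show False using \<open>\<not> i \<le> j\<close> by simp
  qed
qed (rule mk_le)

lemma mk_image_mem: "1 \<le> j \<Longrightarrow> j \<le> l \<Longrightarrow> i \<le> l \<Longrightarrow> mk j \<in> mk ` {1..i} \<longleftrightarrow> j \<le> i"
  using inj_onD[OF mk_inj, of j] by fastforce

lemma mk_image_inj: "i \<le> l \<Longrightarrow> j \<le> l \<Longrightarrow> mk ` {1..i} = mk ` {1..j} \<Longrightarrow> i = j"
proof (rule ccontr)
  assume *: "i \<le> l" "j \<le> l" "mk ` {1..i} = mk ` {1..j}" "i \<noteq> j"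
  then consider "i < j" | "j < i" by linarith
  then show False
  proof cases
    case 1
    then have "mk j \<in> mk ` {1..i} \<longleftrightarrow> j \<le> i" using * by (intro mk_image_mem) auto
    moreover have "mk j \<in> mk ` {1..j}" using 1 by auto
    ultimately show False using 1 *(3) by simp
  next
    case 2
    then have "mk i \<in> mk ` {1..j} \<longleftrightarrow> i \<le> j" using * by (intro mk_image_mem) auto
    moreover have "mk i \<in> mk ` {1..j}" unfolding *(3)[symmetric] using 2 by auto
    ultimately show False using 2 by simp
  qed
qed

lemma order_ideal_Pm:
  assumes "K \<subseteq> Pm" "\<And>p q. q \<in> K \<Longrightarrow> p \<in> Pm \<Longrightarrow> (p, q) \<in> r \<Longrightarrow> p \<in> K"
  shows "\<exists>i\<le>l. K = mk ` {1..i}"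
proof (cases "K = {}")
  case True
  then show ?thesis by (intro exI[of _ 0]) simp
next
  case False
  define S where "S = {i \<in> {1..l}. mk i \<in> K}"
  have S: "finite S" "S \<noteq> {}" unfolding S_def using False assms(1) by auto
  have m: "Max S \<in> S" using Max_in[OF S] .
  have "K = mk ` {1..Max S}"
  proof (intro equalityI subsetI)
    fix p assume "p \<in> K"
    then obtain i where i: "i \<in> {1..l}" "p = mk i" using assms(1) by blast
    then have "i \<in> S" using \<open>p \<in> K\<close> by (simp add: S_def)
    then have "i \<le> Max S" using S(1) by simp
    then show "p \<in> mk ` {1..Max S}" using i by auto
  next
    fix p assume "p \<in> mk ` {1..Max S}"
    then obtain i where i: "i \<in> {1..Max S}" "p = mk i" by blast
    have "(mk i, mk (Max S)) \<in> r" using i(1) m by (intro mk_le) (auto simp: S_def)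
    moreover have "mk (Max S) \<in> K" "mk i \<in> Pm" using m i(1) by (auto simp: S_def)
    ultimately show "p \<in> K" using assms(2) i(2) by blast
  qed
  moreover have "Max S \<le> l" using m by (simp add: S_def)
  ultimately show ?thesis by blast
qed

lemma ex_block: "J \<in> L \<Longrightarrow> \<exists>i\<le>l. in_block i J"
  unfolding in_block_def by (rule order_ideal_Pm) (use L_down in auto)

lemma block_unique: "in_block i J \<Longrightarrow> in_block j J \<Longrightarrow> i \<le> l \<Longrightarrow> j \<le> l \<Longrightarrow> i = j"
  unfolding in_block_def by (rule mk_image_inj) auto

lemma in_block_iff: "i \<le> l \<Longrightarrow> in_block i J \<longleftrightarrow> (\<forall>j\<in>{1..l}. mk j \<in> J \<longleftrightarrow> j \<le> i)"
proof
  assume i: "i \<le> l" and b: "in_block i J"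
  show "\<forall>j\<in>{1..l}. mk j \<in> J \<longleftrightarrow> j \<le> i"
  proof
    fix j assume j: "j \<in> {1..l}"
    then have "mk j \<in> J \<longleftrightarrow> mk j \<in> J \<inter> Pm" by blast
    also have "\<dots> \<longleftrightarrow> j \<le> i"
      using b[unfolded in_block_def] mk_image_mem[of j i] j i by simp
    finally show "mk j \<in> J \<longleftrightarrow> j \<le> i" .
  qed
next
  assume i: "i \<le> l" and *: "\<forall>j\<in>{1..l}. mk j \<in> J \<longleftrightarrow> j \<le> i"
  show "in_block i J" unfolding in_block_def
  proof (intro equalityI subsetI)
    fix p assume "p \<in> J \<inter> Pm"
    then obtain j where "j \<in> {1..l}" "p = mk j" "mk j \<in> J" by blast
    then show "p \<in> mk ` {1..i}" using * by auto
  next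
    fix p assume "p \<in> mk ` {1..i}"
    then obtain j where "j \<in> {1..i}" "p = mk j" by blast
    then show "p \<in> J \<inter> Pm" using * i by auto
  qed
qed

lemma block_0: "J \<in> L \<Longrightarrow> in_block 0 J \<longleftrightarrow> J = {}"
proof
  assume J: "J \<in> L" "in_block 0 J"
  then have "mk 1 \<notin> J" using in_block_iff[of 0 J] l_pos by auto
  then show "J = {}" using mk_min L_subset[OF J(1)] L_down[OF J(1)] by blast
qed (simp add: in_block_def)

definition down :: "'p \<Rightarrow> 'p set" where "down p = {q. (q, p) \<in> r}"

lemma down_L: "down p \<in> L"
  by (rule L_I) (auto simp: down_def dest: r_field intro: r_trans)

lemma down_mk_block: "1 \<le> i \<Longrightarrow> i \<le> l \<Longrightarrow> in_block i (down (mk i))"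
  using in_block_iff[of i "down (mk i)"] mk_le_iff by (auto simp: down_def)

text \<open>Completing by principal ideals of marked elements shows that every ideal in a nonzero
  block occurs in a tuple, so facts about generating points yield facts about single ideals.\<close>

lemma ex_tuple:
  assumes "J \<in> L" "in_block i J" "1 \<le> i" "i \<le> l"
  shows "(\<lambda>j. if j = i then J else down (mk j)) \<in> tuples"
  unfolding tuples_def using assms down_L down_mk_block by auto

lemma tuples_ne: "tuples \<noteq> {}"
proof -
  have "in_block 1 (down (mk 1))" using l_pos by (intro down_mk_block) auto
  from ex_tuple[OF down_L this] show ?thesis using l_pos by blast
qed

definition the_coeff :: "'p set \<Rightarrow> nat" where
  "the_coeff K = (if K \<in> (\<lambda>i. mk ` {1..i}) ` {1..l} then 1 else 0)"

lemma inj_mk_image: "inj_on (\<lambda>i. mk ` {1..i}) {1..l}"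
  by (rule inj_onI, rule mk_image_inj) auto

lemma lookup_ind_mk: "j \<in> {1..l} \<Longrightarrow> i \<le> l \<Longrightarrow> Poly_Mapping.lookup (ind_vec (mk ` {1..i})) (mk j) = of_bool (j \<le> i)"
  using mk_image_mem[of j i] by (simp add: lookup_ind_vec)

text \<open>The definition of the polytope picks the coefficients by a definite description, so
  uniqueness must be proved. Only initial segments of the marked chain can occur; the coordinate at
  \<open>mk j\<close> is the sum of the coefficients from \<open>j\<close> on, and consecutive
  differences determine each coefficient.\<close>

lemma chain_expression_iff: "chain_expression Pm r marked_weight \<alpha> \<longleftrightarrow> \<alpha> = the_coeff"
proof
  assume *: "chain_expression Pm r marked_weight \<alpha>"
  have supp: "{K. \<alpha> K \<noteq> 0} \<subseteq> (\<lambda>i. mk ` {1..i}) ` {1..l}"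
  proof
    fix K assume "K \<in> {K. \<alpha> K \<noteq> 0}"
    then have K: "K \<in> order_ideals Pm r" "K \<noteq> {}" using * unfolding chain_expression_def by auto
    have "\<exists>i\<le>l. K = mk ` {1..i}"
      by (rule order_ideal_Pm) (use K(1) in \<open>auto simp: order_ideals_def\<close>)
    then obtain i where i: "i \<le> l" "K = mk ` {1..i}" by blast
    then have "i \<noteq> 0" using K(2) by (intro notI) simp
    then show "K \<in> (\<lambda>i. mk ` {1..i}) ` {1..l}" using i by auto
  qed
  have "marked_weight = (\<Sum>K | \<alpha> K \<noteq> 0. real (\<alpha> K) *\<^sub>R ind_vec K)"
    using * unfolding chain_expression_def by blast
  also have "\<dots> = (\<Sum>K\<in>(\<lambda>i. mk ` {1..i}) ` {1..l}. real (\<alpha> K) *\<^sub>R ind_vec K)"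
    by (rule sum.mono_neutral_left) (use supp in auto)
  also have "\<dots> = (\<Sum>i\<in>{1..l}. real (\<alpha> (mk ` {1..i})) *\<^sub>R ind_vec (mk ` {1..i}))"
    unfolding sum.reindex[OF inj_mk_image] comp_def ..
  finally have eq: "marked_weight = (\<Sum>i\<in>{1..l}. real (\<alpha> (mk ` {1..i})) *\<^sub>R ind_vec (mk ` {1..i}))" .
  have tail: "(\<Sum>i\<in>{j..l}. real (\<alpha> (mk ` {1..i}))) = (\<Sum>i\<in>{j..l}. 1)" if j: "j \<in> {1..l}" for j
  proof -
    have *: "(\<Sum>i\<in>{1..l}. f i * of_bool (j \<le> i)) = (\<Sum>i\<in>{j..l}. f i)" for f :: "nat \<Rightarrow> real"
      by (rule sum.mono_neutral_cong_right) (use j in auto)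
    have "Poly_Mapping.lookup marked_weight (mk j) = (\<Sum>i\<in>{1..l}. 1 * of_bool (j \<le> i))"
      unfolding lookup_sum
    proof (rule sum.cong[OF refl])
      fix i assume "i \<in> {1..l}"
      then have "i \<le> l" by simp
      show "Poly_Mapping.lookup (ind_vec (mk ` {1..i})) (mk j) = 1 * of_bool (j \<le> i)"
        unfolding lookup_ind_mk[OF j \<open>i \<le> l\<close>] by simp
    qed
    moreover have "Poly_Mapping.lookup marked_weight (mk j) =
        (\<Sum>i\<in>{1..l}. real (\<alpha> (mk ` {1..i})) * of_bool (j \<le> i))"
      unfolding eq lookup_sum lookup_scaleR
    proof (rule sum.cong[OF refl])
      fix i assume "i \<in> {1..l}"
      then have "i \<le> l" by simp
      show "real (\<alpha> (mk ` {1..i})) *\<^sub>R Poly_Mapping.lookup (ind_vec (mk ` {1..i})) (mk j) =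
          real (\<alpha> (mk ` {1..i})) * of_bool (j \<le> i)"
        unfolding lookup_ind_mk[OF j \<open>i \<le> l\<close>] by simp
    qed
    ultimately show ?thesis unfolding * by simp
  qed
  have one: "\<alpha> (mk ` {1..j}) = 1" if j: "j \<in> {1..l}" for j
  proof -
    have suc: "(\<Sum>i\<in>{Suc j..l}. real (\<alpha> (mk ` {1..i}))) = (\<Sum>i\<in>{Suc j..l}. 1)"
      using tail[of "Suc j"] j by (cases "j = l") auto
    have split: "(\<Sum>i\<in>{j..l}. f i) = f j + (\<Sum>i\<in>{Suc j..l}. f i)" for f :: "nat \<Rightarrow> real"
      using j by (intro sum.atLeast_Suc_atMost) simp
    have "real (\<alpha> (mk ` {1..j})) + (\<Sum>i\<in>{Suc j..l}. 1) = 1 + (\<Sum>i\<in>{Suc j..l}. 1)"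
      using tail[OF j] unfolding split suc .
    then show ?thesis by simp
  qed
  show "\<alpha> = the_coeff"
  proof
    fix K show "\<alpha> K = the_coeff K"
      using one supp unfolding the_coeff_def by auto
  qed
next
  assume \<alpha>: "\<alpha> = the_coeff"
  have supp: "{K. the_coeff K \<noteq> 0} = (\<lambda>i. mk ` {1..i}) ` {1..l}"
    unfolding the_coeff_def by auto
  have weight: "(\<Sum>K | the_coeff K \<noteq> 0. real (the_coeff K) *\<^sub>R ind_vec K) = marked_weight"
    unfolding supp sum.reindex[OF inj_mk_image] by (rule sum.cong) (auto simp: the_coeff_def)
  have ideals: "mk ` {1..i} \<in> order_ideals Pm r \<and> mk ` {1..i} \<noteq> {}" if i: "i \<in> {1..l}" for i
  proof
    show "mk ` {1..i} \<noteq> {}" using i by simp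
    show "mk ` {1..i} \<in> order_ideals Pm r"
      unfolding order_ideals_def
    proof (intro CollectI conjI ballI impI)
      fix q p assume "q \<in> mk ` {1..i}" "p \<in> Pm" "(p, q) \<in> r"
      then obtain a b where "a \<in> {1..i}" "q = mk a" "b \<in> {1..l}" "p = mk b" by blast
      then have "b \<le> a" using mk_le_iff[of b a] \<open>(p, q) \<in> r\<close> i by auto
      then show "p \<in> mk ` {1..i}" using \<open>a \<in> {1..i}\<close> \<open>b \<in> {1..l}\<close> \<open>p = mk b\<close> by auto
    qed (use i in auto)
  qed
  have chain: "K \<subseteq> K' \<or> K' \<subseteq> K" if "K \<in> (\<lambda>i. mk ` {1..i}) ` {1..l}" "K' \<in> (\<lambda>i. mk ` {1..i}) ` {1..l}" for K K'
  proof -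
    obtain i j where "K = mk ` {1..i}" "K' = mk ` {1..j}" using \<open>K \<in> _\<close> \<open>K' \<in> _\<close> by blast
    then show ?thesis by (cases "i \<le> j") (auto intro!: image_mono)
  qed
  show "chain_expression Pm r marked_weight \<alpha>"
    unfolding chain_expression_def \<alpha>
  proof (intro conjI allI impI)
    show "K \<in> order_ideals Pm r" "K \<noteq> {}" if "the_coeff K \<noteq> 0" for K
    proof -
      have "K \<in> (\<lambda>i. mk ` {1..i}) ` {1..l}" unfolding supp[symmetric] using that by simp
      then obtain i where i: "i \<in> {1..l}" "K = mk ` {1..i}" by (rule imageE)
      then show "K \<in> order_ideals Pm r" "K \<noteq> {}" unfolding i(2) using ideals[OF i(1)] by simp_all
    qed
    show "K \<subseteq> K' \<or> K' \<subseteq> K" if "the_coeff K \<noteq> 0" "the_coeff K' \<noteq> 0" for K K'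
      by (rule chain) (use that supp in blast)+
  qed (rule weight[symmetric])
qed

lemma Q_eq_sum: "Q = (\<Sum>i\<in>{1..l}. convex hull (ind_vec ` {J \<in> L. in_block i J}))"
proof -
  have the: "(THE \<alpha>. chain_expression Pm r marked_weight \<alpha>) = the_coeff"
    unfolding chain_expression_iff by (rule the_equality) auto
  have supp: "{K. the_coeff K \<noteq> 0} = (\<lambda>i. mk ` {1..i}) ` {1..l}"
    unfolding the_coeff_def by auto
  have "Q = (\<Sum>K | the_coeff K \<noteq> 0. (*\<^sub>R) (real (the_coeff K)) ` fund_polytope P Pm r K)"
    unfolding marked_polytope_def Let_def the ..
  also have "\<dots> = (\<Sum>i\<in>{1..l}. convex hull (ind_vec ` {J \<in> L. in_block i J}))"
    unfolding supp sum.reindex[OF inj_mk_image]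
    by (rule sum.cong) (auto simp: the_coeff_def fund_polytope_def in_block_def)
  finally show ?thesis .
qed

lemma Q_eq_hull: "Q = convex hull (vertex ` tuples)"
proof -
  have "(\<Sum>i\<in>{1..l}. ind_vec ` {J \<in> L. in_block i J}) = vertex ` tuples"
    unfolding set_sum_alt[OF finite_atLeastAtMost]
  proof (intro equalityI subsetI)
    fix x assume "x \<in> {sum s {1..l} | s. \<forall>i\<in>{1..l}. s i \<in> ind_vec ` {J \<in> L. in_block i J}}"
    then obtain s where s: "x = sum s {1..l}" "\<forall>i\<in>{1..l}. \<exists>J. s i = ind_vec J \<and> J \<in> L \<and> in_block i J"
      by blast
    from bchoice[OF s(2)] obtain J where J: "\<forall>i\<in>{1..l}. s i = ind_vec (J i) \<and> J i \<in> L \<and> in_block i (J i)"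
      by blast
    then have "J \<in> tuples" "x = vertex J" unfolding tuples_def vertex_def s(1) by auto
    then show "x \<in> vertex ` tuples" by blast
  next
    fix x assume "x \<in> vertex ` tuples"
    then obtain J where J: "J \<in> tuples" "x = vertex J" by blast
    then show "x \<in> {sum s {1..l} | s. \<forall>i\<in>{1..l}. s i \<in> ind_vec ` {J \<in> L. in_block i J}}"
      unfolding tuples_def vertex_def by (intro CollectI exI[of _ "\<lambda>i. ind_vec (J i)"]) auto
  qed
  then show ?thesis unfolding Q_eq_sum convex_hull_set_sum[symmetric] by simp
qed

lemma finite_vertices: "finite (vertex ` tuples)"
proof -
  have "vertex ` tuples \<subseteq> vertex ` ({1..l} \<rightarrow>\<^sub>E L)"
  proof
    fix x assume "x \<in> vertex ` tuples"
    then obtain J where J: "J \<in> tuples" "x = vertex J" by blast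
    have "vertex J = vertex (restrict J {1..l})" unfolding vertex_def by (rule sum.cong) auto
    moreover have "restrict J {1..l} \<in> {1..l} \<rightarrow>\<^sub>E L" using J(1) unfolding tuples_def by auto
    ultimately show "x \<in> vertex ` ({1..l} \<rightarrow>\<^sub>E L)" using J(2) by blast
  qed
  moreover have "finite ({1..l} \<rightarrow>\<^sub>E L)" using finite_L by (intro finite_PiE) auto
  ultimately show ?thesis using finite_subset by blast
qed

lemma polytope_Q: "polytope Q"
  unfolding polytope_def Q_eq_hull using finite_vertices by blast

lemma Q_ne: "Q \<noteq> {}"
  unfolding Q_eq_hull using tuples_ne by simp

lemma lookup_vertex: "J \<in> tuples \<Longrightarrow> Poly_Mapping.lookup (vertex J) p = (\<Sum>i\<in>{1..l}. of_bool (p \<in> J i))"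
  unfolding vertex_def lookup_sum
  by (rule sum.cong) (use L_finite in \<open>auto simp: lookup_ind_vec tuples_def\<close>)

section \<open>Inequalities and lattice points of the marked polytope\<close>

definition order_reversing :: "('p \<Rightarrow>\<^sub>0 'a::linordered_idom) \<Rightarrow> bool" where
  "order_reversing x \<longleftrightarrow> Poly_Mapping.keys x \<subseteq> P \<and>
     (\<forall>p q. (p, q) \<in> r \<longrightarrow> Poly_Mapping.lookup x q \<le> Poly_Mapping.lookup x p)"

text \<open>The mark \<open>mk i\<close> lies in the ideals of the blocks \<open>i\<close> to
  \<open>l\<close>, which accounts for \<open>l + 1 - i\<close>. The factor \<open>m\<close> covers
  the dilates needed for normality.\<close>

definition marks_eq :: "('p \<Rightarrow>\<^sub>0 'a::linordered_idom) \<Rightarrow> nat \<Rightarrow> bool" where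
  "marks_eq x m \<longleftrightarrow> (\<forall>i\<in>{1..l}. Poly_Mapping.lookup x (mk i) = of_nat (m * (l + 1 - i)))"

text \<open>Induction on the number of values strictly between 0 and 1. With \<open>v\<close> the
  largest such value and \<open>J1\<close> the set where \<open>y\<close> is 1, the point
  \<open>y\<close> lies on the segment from the indicator of \<open>J1\<close> to \<open>z\<close>,
  which is \<open>y / v\<close> cut off at 1; in \<open>z\<close> the value \<open>v\<close> has
  become 1, so one intermediate value is lost.\<close>

lemma ideal_hull:
  fixes y :: "'p \<Rightarrow>\<^sub>0 real"
  assumes "order_reversing y" "\<And>p. 0 \<le> Poly_Mapping.lookup y p" "\<And>p. Poly_Mapping.lookup y p \<le> 1"
    "i \<le> l" "\<And>j. j \<in> {1..l} \<Longrightarrow> Poly_Mapping.lookup y (mk j) = of_bool (j \<le> i)"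
  shows "y \<in> convex hull (ind_vec ` {J \<in> L. in_block i J})"
  using assms(1-3,5)
proof (induction "card ({x. 0 < x \<and> x < 1} \<inter> Poly_Mapping.lookup y ` P)" arbitrary: y rule: less_induct)
  case less
  let ?l = "Poly_Mapping.lookup"
  let ?C = "convex hull (ind_vec ` {J \<in> L. in_block i J})"
  let ?fr = "\<lambda>y. {x. 0 < x \<and> x < 1} \<inter> ?l y ` P"
  have fin: "finite (?fr y)" for y :: "'p \<Rightarrow>\<^sub>0 real" using finP by simp
  have off: "?l y p = 0" if "p \<notin> P" for p
    using less.prems(1) that unfolding order_reversing_def by (auto simp: in_keys_iff)
  define J1 where "J1 = {p \<in> P. ?l y p = 1}"
  have J1: "J1 \<in> L"
  proof (rule L_I)
    fix p q assume pq: "(p, q) \<in> r" "q \<in> J1"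
    then have "?l y q \<le> ?l y p" using less.prems(1) unfolding order_reversing_def by blast
    then have "?l y p = 1" using pq(2) less.prems(3)[of p] unfolding J1_def by simp
    then show "p \<in> J1" using r_field pq(1) by (simp add: J1_def)
  qed (auto simp: J1_def)
  have J1b: "in_block i J1"
    unfolding in_block_iff[OF assms(4)] using less.prems(4) mk_in by (auto simp: J1_def)
  have "ind_vec J1 \<in> ind_vec ` {J \<in> L. in_block i J}" using J1 J1b by blast
  then have J1C: "ind_vec J1 \<in> ?C" by (rule hull_inc)
  have lJ1: "?l (ind_vec J1) p = of_bool (p \<in> J1)" for p
    using L_finite[OF J1] by (rule lookup_ind_vec)
  show ?case
  proof (cases "?fr y = {}")
    case True
    have "y = ind_vec J1"
    proof (rule poly_mapping_eqI)
      fix p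
      have "?l y p = 0 \<or> ?l y p = 1"
      proof (cases "p \<in> P")
        case pP: True
        then have "\<not> (0 < ?l y p \<and> ?l y p < 1)" using True by blast
        then show ?thesis using less.prems(2)[of p] less.prems(3)[of p] by linarith
      qed (simp add: off)
      then show "?l y p = ?l (ind_vec J1) p"
        unfolding lJ1 using off[of p] by (auto simp: J1_def)
    qed
    then show ?thesis using J1C by simp
  next
    case False
    define v where "v = Max (?fr y)"
    have v: "v \<in> ?fr y" unfolding v_def using Max_in[OF fin False] .
    then have v01: "0 < v" "v < 1" by auto
    have vmax: "?l y p \<le> v" if "?l y p < 1" for p
    proof (cases "p \<in> P \<and> 0 < ?l y p")
      case True
      then have "?l y p \<in> ?fr y" using that by auto
      then show ?thesis unfolding v_def using fin by (rule Max_ge[rotated])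
    next
      case False
      then have "?l y p = 0" using off[of p] less.prems(2)[of p] by fastforce
      then show ?thesis using v01 by simp
    qed
    define z where "z = Abs_poly_mapping (\<lambda>p. min 1 (?l y p / v))"
    have "{p. min 1 (?l y p / v) \<noteq> 0} \<subseteq> Poly_Mapping.keys y" by (auto simp: in_keys_iff)
    then have lz: "?l z p = min 1 (?l y p / v)" for p
      unfolding z_def using finite_subset[OF _ finite_keys[of y]] by (simp add: lookup_Abs_poly_mapping)
    have zC: "z \<in> ?C"
    proof (rule less.hyps)
      have im: "?fr z \<subseteq> (\<lambda>t. t / v) ` (?fr y - {v})"
      proof
        fix t assume "t \<in> ?fr z"
        then obtain p where p: "p \<in> P" "t = ?l z p" "0 < t" "t < 1" by auto
        then have t: "t = ?l y p / v" "?l y p / v < 1" unfolding lz by (auto simp: min_def split: if_splits)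
        then have "?l y p < v" using v01 by simp
        moreover have "0 < ?l y p" using p(3) t(1) v01 by (simp add: zero_less_divide_iff)
        ultimately have "?l y p \<in> ?fr y - {v}" using p(1) v01 by auto
        then show "t \<in> (\<lambda>t. t / v) ` (?fr y - {v})" using t(1) by blast
      qed
      have "card (?fr z) \<le> card (?fr y - {v})"
        using card_mono[OF _ im] card_image_le[of "?fr y - {v}" "\<lambda>t. t / v"] fin[of y]
        by (meson finite_Diff finite_imageI le_trans)
      also have "\<dots> < card (?fr y)" using v fin[of y] by (rule card_Diff1_less[rotated])
      finally show "card (?fr z) < card (?fr y)" .
      show "order_reversing z"
        unfolding order_reversing_def
      proof (intro conjI allI impI)
        show "Poly_Mapping.keys z \<subseteq> P"
        proof
          fix p assume "p \<in> Poly_Mapping.keys z"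
          then have "?l y p \<noteq> 0" by (auto simp: in_keys_iff lz)
          then show "p \<in> P" using off by blast
        qed
        fix p q assume "(p, q) \<in> r"
        then have "?l y q \<le> ?l y p" using less.prems(1) unfolding order_reversing_def by blast
        then show "?l z q \<le> ?l z p" unfolding lz using v01 by (intro min.mono divide_right_mono) auto
      qed
      show "0 \<le> ?l z p" for p unfolding lz using less.prems(2)[of p] v01 by simp
      show "?l z p \<le> 1" for p unfolding lz by simp
      show "?l z (mk j) = of_bool (j \<le> i)" if "j \<in> {1..l}" for j
        unfolding lz less.prems(4)[OF that] using v01 by (simp add: min_def)
    qed
    have "y = (1 - v) *\<^sub>R ind_vec J1 + v *\<^sub>R z"
    proof (rule poly_mapping_eqI)
      fix p
      show "?l y p = ?l ((1 - v) *\<^sub>R ind_vec J1 + v *\<^sub>R z) p"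
      proof (cases "?l y p = 1")
        case True
        then have "p \<in> J1" using off[of p] unfolding J1_def by fastforce
        then show ?thesis using True v01 by (simp add: lookup_add lookup_scaleR lJ1 lz min_def)
      next
        case False
        then have "p \<notin> J1" "?l y p \<le> v" using vmax[of p] less.prems(3)[of p] by (auto simp: J1_def)
        moreover from this have "?l y p / v \<le> 1" using v01 by simp
        ultimately show ?thesis using v01 by (simp add: lookup_add lookup_scaleR lJ1 lz min_def)
      qed
    qed
    moreover have "(1 - v) *\<^sub>R ind_vec J1 + v *\<^sub>R z \<in> ?C"
      by (rule convexD_alt[OF convex_convex_hull J1C zC]) (use v01 in auto)
    ultimately show ?thesis by simp
  qed
qed

lemma lookup_bounds:
  assumes "order_reversing x" "marks_eq x m" "p \<in> P"
  shows "of_nat m \<le> Poly_Mapping.lookup x p" "Poly_Mapping.lookup x p \<le> of_nat (m * l)"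
proof -
  have "Poly_Mapping.lookup x (mk l) \<le> Poly_Mapping.lookup x p"
    "Poly_Mapping.lookup x p \<le> Poly_Mapping.lookup x (mk 1)"
    using assms(1) mk_min[OF assms(3)] mk_max[OF assms(3)] unfolding order_reversing_def by blast+
  then show "of_nat m \<le> Poly_Mapping.lookup x p" "Poly_Mapping.lookup x p \<le> of_nat (m * l)"
    using assms(2) l_pos unfolding marks_eq_def by simp_all
qed

text \<open>The inequalities are convex conditions that hold at the generating points. Conversely, a
  point satisfying them is cut into horizontal layers, and each layer lies in the polytope of one
  block.\<close>

theorem Q_iff: "x \<in> Q \<longleftrightarrow> order_reversing x \<and> marks_eq x 1"
proof
  assume "x \<in> Q"
  moreover have "convex {x :: 'p \<Rightarrow>\<^sub>0 real. order_reversing x \<and> marks_eq x 1}"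
    unfolding convex_alt
  proof (intro ballI allI impI)
    fix x y :: "'p \<Rightarrow>\<^sub>0 real" and u :: real
    assume x: "x \<in> {x :: 'p \<Rightarrow>\<^sub>0 real. order_reversing x \<and> marks_eq x 1}" and y: "y \<in> {x :: 'p \<Rightarrow>\<^sub>0 real. order_reversing x \<and> marks_eq x 1}"
      and u: "0 \<le> u \<and> u \<le> 1"
    have lz: "Poly_Mapping.lookup ((1 - u) *\<^sub>R x + u *\<^sub>R y) p =
        (1 - u) * Poly_Mapping.lookup x p + u * Poly_Mapping.lookup y p" for p
      by (simp add: lookup_add lookup_scaleR)
    have xy: "Poly_Mapping.keys x \<subseteq> P" "Poly_Mapping.keys y \<subseteq> P"
      "\<And>p q. (p, q) \<in> r \<Longrightarrow> Poly_Mapping.lookup x q \<le> Poly_Mapping.lookup x p"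
      "\<And>p q. (p, q) \<in> r \<Longrightarrow> Poly_Mapping.lookup y q \<le> Poly_Mapping.lookup y p"
      using x y by (auto simp: order_reversing_def)
    have 1: "order_reversing ((1 - u) *\<^sub>R x + u *\<^sub>R y)"
      unfolding order_reversing_def lz
    proof (intro conjI allI impI)
      show "Poly_Mapping.keys ((1 - u) *\<^sub>R x + u *\<^sub>R y) \<subseteq> P"
      proof
        fix p assume "p \<in> Poly_Mapping.keys ((1 - u) *\<^sub>R x + u *\<^sub>R y)"
        then have "p \<in> Poly_Mapping.keys x \<or> p \<in> Poly_Mapping.keys y"
          unfolding in_keys_iff lz by auto
        then show "p \<in> P" using xy(1,2) by blast
      qed
    next
      fix p q assume "(p, q) \<in> r"
      then show "(1 - u) * Poly_Mapping.lookup x q + u * Poly_Mapping.lookup y q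
          \<le> (1 - u) * Poly_Mapping.lookup x p + u * Poly_Mapping.lookup y p"
        using xy(3,4) u by (intro add_mono mult_left_mono) auto
    qed
    have 2: "marks_eq ((1 - u) *\<^sub>R x + u *\<^sub>R y) 1"
      unfolding marks_eq_def lz
    proof
      fix i assume i: "i \<in> {1..l}"
      have "Poly_Mapping.lookup x (mk i) = real (1 * (l + 1 - i))"
        "Poly_Mapping.lookup y (mk i) = real (1 * (l + 1 - i))"
        using x y i unfolding marks_eq_def by blast+
      then show "(1 - u) * Poly_Mapping.lookup x (mk i) + u * Poly_Mapping.lookup y (mk i) =
          real (1 * (l + 1 - i))"
        by (simp only: left_diff_distrib)
    qed
    show "(1 - u) *\<^sub>R x + u *\<^sub>R y \<in> {x :: 'p \<Rightarrow>\<^sub>0 real. order_reversing x \<and> marks_eq x 1}" using 1 2 by blast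
  qed
  moreover have "vertex ` tuples \<subseteq> {x :: 'p \<Rightarrow>\<^sub>0 real. order_reversing x \<and> marks_eq x 1}"
  proof
    fix x assume "x \<in> vertex ` tuples"
    then obtain J where J: "J \<in> tuples" "x = vertex J" by blast
    have JL: "J i \<in> L" "in_block i (J i)" if "i \<in> {1..l}" for i using J(1) that unfolding tuples_def by blast+
    note lx = lookup_vertex[OF J(1)]
    have "order_reversing x"
      unfolding order_reversing_def J(2) lx
    proof (intro conjI allI impI)
      show "Poly_Mapping.keys (vertex J) \<subseteq> P"
      proof
        fix p assume "p \<in> Poly_Mapping.keys (vertex J)"
        then have "(\<Sum>i\<in>{1..l}. of_bool (p \<in> J i)) \<noteq> (0::real)" unfolding in_keys_iff lx .
        then obtain i where "i \<in> {1..l}" "of_bool (p \<in> J i) \<noteq> (0::real)"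
          by (rule sum.not_neutral_contains_not_neutral)
        then show "p \<in> P" using L_subset[OF JL(1)] by auto
      qed
      fix p q assume "(p, q) \<in> r"
      then show "(\<Sum>i\<in>{1..l}. of_bool (q \<in> J i)) \<le> (\<Sum>i\<in>{1..l}. of_bool (p \<in> J i) :: real)"
        using L_down[OF JL(1)] by (intro sum_mono) auto
    qed
    moreover have "marks_eq x 1"
      unfolding marks_eq_def J(2) lx
    proof
      fix j assume j: "j \<in> {1..l}"
      have "(\<Sum>i\<in>{1..l}. of_bool (mk j \<in> J i)) = (\<Sum>i\<in>{j..l}. 1 :: real)"
      proof (rule sum.mono_neutral_cong_right)
        show "\<forall>i\<in>{1..l} - {j..l}. of_bool (mk j \<in> J i) = (0::real)"
          using JL(2) in_block_iff j by auto
        show "\<And>x. x \<in> {j..l} \<Longrightarrow> of_bool (mk j \<in> J x) = (1::real)"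
          using JL(2) in_block_iff j by auto
      qed (use j in auto)
      then show "(\<Sum>i\<in>{1..l}. of_bool (mk j \<in> J i)) = real (1 * (l + 1 - j))"
        using j by simp
    qed
    ultimately show "x \<in> {x :: 'p \<Rightarrow>\<^sub>0 real. order_reversing x \<and> marks_eq x 1}" by blast
  qed
  ultimately show "order_reversing x \<and> marks_eq x 1"
    unfolding Q_eq_hull using hull_minimal[of "vertex ` tuples" _ convex] by blast
next
  assume x: "order_reversing x \<and> marks_eq x 1"
  let ?l = "Poly_Mapping.lookup"
  have off: "?l x p = 0" if "p \<notin> P" for p
    using x that unfolding order_reversing_def by (auto simp: in_keys_iff)
  have bd: "1 \<le> ?l x p" "?l x p \<le> real l" if "p \<in> P" for p
    using lookup_bounds[of x 1 p] x that by auto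
  \<comment> \<open>The layer between the heights \<open>l - i\<close> and \<open>l - i + 1\<close>.
    Since \<open>mk j\<close> has height \<open>l + 1 - j\<close>, this layer is 1 at the marks up
    to \<open>i\<close> and 0 at later ones.\<close>
  define y where "y i = Abs_poly_mapping (\<lambda>p. min 1 (max 0 (?l x p - real (l - i))))" for i
  have ly: "?l (y i) p = min 1 (max 0 (?l x p - real (l - i)))" for i p
  proof -
    have "{p. min 1 (max 0 (?l x p - real (l - i))) \<noteq> 0} \<subseteq> P"
    proof
      fix p assume "p \<in> {p. min 1 (max 0 (?l x p - real (l - i))) \<noteq> 0}"
      then have "?l x p \<noteq> 0" by (auto simp: min_def max_def split: if_splits)
      then show "p \<in> P" using off by blast
    qed
    then have "finite {p. min 1 (max 0 (?l x p - real (l - i))) \<noteq> 0}" using finP finite_subset by blast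
    then show ?thesis unfolding y_def by (simp add: lookup_Abs_poly_mapping)
  qed
  have "x = (\<Sum>i\<in>{1..l}. y i)"
  proof (rule poly_mapping_eqI)
    fix p
    have "?l (\<Sum>i\<in>{1..l}. y i) p = (\<Sum>i\<in>{1..l}. min 1 (max 0 (?l x p - real (l - i))))"
      by (simp add: lookup_sum ly)
    also have "\<dots> = (\<Sum>j<l. min 1 (max 0 (?l x p - real j)))"
      by (rule sum.reindex_bij_witness[where i="\<lambda>j. l - j" and j="\<lambda>i. l - i"]) auto
    also have "\<dots> = min (max (?l x p) 0) (real l)" by (rule sum_clamp)
    also have "\<dots> = ?l x p"
    proof (cases "p \<in> P")
      case True
      then show ?thesis using bd[of p] by simp
    qed (simp add: off)
    finally show "?l x p = ?l (\<Sum>i\<in>{1..l}. y i) p" by (rule sym)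
  qed
  moreover have "y i \<in> convex hull (ind_vec ` {J \<in> L. in_block i J})" if i: "i \<in> {1..l}" for i
  proof (rule ideal_hull)
    show "order_reversing (y i)"
      unfolding order_reversing_def
    proof (intro conjI allI impI)
      show "Poly_Mapping.keys (y i) \<subseteq> P"
      proof
        fix p assume "p \<in> Poly_Mapping.keys (y i)"
        then have "?l x p \<noteq> 0" by (auto simp: in_keys_iff ly min_def max_def split: if_splits)
        then show "p \<in> P" using off by blast
      qed
      fix p q assume "(p, q) \<in> r"
      then have "?l x q \<le> ?l x p" using x unfolding order_reversing_def by blast
      then show "?l (y i) q \<le> ?l (y i) p" unfolding ly by (intro min.mono max.mono) auto
    qed
    show "?l (y i) (mk j) = of_bool (j \<le> i)" if j: "j \<in> {1..l}" for j
    proof -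
      have "?l x (mk j) = real (1 * (l + 1 - j))" using x j unfolding marks_eq_def by blast
      then show ?thesis unfolding ly using i j by (auto simp: of_nat_diff min_def max_def)
    qed
  qed (use i in \<open>auto simp: ly\<close>)
  ultimately show "x \<in> Q"
    unfolding Q_eq_sum set_sum_alt[OF finite_atLeastAtMost] by blast
qed

definition int_vertex :: "('p \<Rightarrow> 'q) \<Rightarrow> (nat \<Rightarrow> 'p set) \<Rightarrow> ('q \<Rightarrow>\<^sub>0 int)" where
  "int_vertex e J = (\<Sum>i\<in>{1..l}. int_ind e (J i))"

lemma lookup_int_vertex:
  assumes "J \<in> tuples"
  shows "Poly_Mapping.lookup (int_vertex (\<lambda>p. p) J) p = (\<Sum>i\<in>{1..l}. of_bool (p \<in> J i))"
  unfolding int_vertex_def lookup_sum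
proof (rule sum.cong[OF refl])
  fix i assume "i \<in> {1..l}"
  then have "finite (J i)" using assms L_finite unfolding tuples_def by blast
  from lookup_int_ind[OF this, of "\<lambda>p. p" p]
  show "Poly_Mapping.lookup (int_ind (\<lambda>p. p) (J i)) p = of_bool (p \<in> J i)" by simp
qed

lemma real_vec_int_vertex: "J \<in> tuples \<Longrightarrow> real_vec (int_vertex (\<lambda>p. p) J) = vertex J"
  by (rule poly_mapping_eqI) (simp add: lookup_real_vec lookup_int_vertex lookup_vertex)

lemma keys_real_vec: "Poly_Mapping.keys (real_vec a) = Poly_Mapping.keys a"
  by (auto simp: in_keys_iff lookup_real_vec)

lemma real_vec_in_Q_iff: "real_vec a \<in> Q \<longleftrightarrow> order_reversing a \<and> marks_eq a 1"
proof -
  have "real_of_int x = of_nat m \<longleftrightarrow> x = of_nat m" for x m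
    using of_int_eq_iff[of x "int m", where 'a=real] by simp
  then show ?thesis
    unfolding Q_iff order_reversing_def marks_eq_def keys_real_vec lookup_real_vec of_int_le_iff
    by (simp only:)
qed

lemma lattice_points_Q_iff: "a \<in> lattice_points Q \<longleftrightarrow> order_reversing a \<and> marks_eq a 1"
  unfolding lattice_points_def mem_Collect_eq by (rule real_vec_in_Q_iff)

text \<open>For integral points the layers are already indicators: block \<open>i\<close> receives
  the level set at \<open>l + 1 - i\<close>, and a coordinate with value \<open>t\<close> belongs to
  exactly the last \<open>t\<close> of these sets.\<close>

lemma lattice_points_Q: "lattice_points Q = int_vertex (\<lambda>p. p) ` tuples"
proof (intro equalityI subsetI)
  fix a assume "a \<in> int_vertex (\<lambda>p. p) ` tuples"
  then obtain J where J: "J \<in> tuples" "a = int_vertex (\<lambda>p. p) J" by blast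
  have "vertex J \<in> Q" unfolding Q_eq_hull by (rule hull_inc) (use J(1) in blast)
  then show "a \<in> lattice_points Q" using J by (simp add: lattice_points_def real_vec_int_vertex)
next
  let ?l = "Poly_Mapping.lookup"
  fix a assume "a \<in> lattice_points Q"
  then have a: "order_reversing a" "marks_eq a 1"
    unfolding lattice_points_Q_iff by blast+
  have off: "?l a p = 0" if "p \<notin> P" for p
    using a(1) that unfolding order_reversing_def by (auto simp: in_keys_iff)
  have bd: "1 \<le> ?l a p" "?l a p \<le> int l" if "p \<in> P" for p
    using lookup_bounds[OF a that] by auto
  define J where "J i = {p \<in> P. int (l + 1 - i) \<le> ?l a p}" for i
  have J: "J \<in> tuples"
    unfolding tuples_def
  proof (intro CollectI ballI conjI)
    fix i assume i: "i \<in> {1..l}"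
    show "J i \<in> L"
    proof (rule L_I)
      fix p q assume pq: "(p, q) \<in> r" "q \<in> J i"
      then have "?l a q \<le> ?l a p" using a(1) unfolding order_reversing_def by blast
      then show "p \<in> J i" using pq r_field(1)[OF pq(1)] by (auto simp: J_def)
    qed (auto simp: J_def)
    have "i \<le> l" using i by simp
    show "in_block i (J i)"
      unfolding in_block_iff[OF \<open>i \<le> l\<close>]
    proof
      fix j assume j: "j \<in> {1..l}"
      then have "?l a (mk j) = of_nat (1 * (l + 1 - j))" using a(2) unfolding marks_eq_def by blast
      then show "mk j \<in> J i \<longleftrightarrow> j \<le> i" using i j mk_in[of j] by (auto simp: J_def)
    qed
  qed
  have "a = int_vertex (\<lambda>p. p) J"
  proof (rule poly_mapping_eqI)
    fix p
    show "?l a p = ?l (int_vertex (\<lambda>p. p) J) p"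
    proof (cases "p \<in> P")
      case True
      define t where "t = nat (?l a p)"
      have t: "?l a p = int t" "1 \<le> t" "t \<le> l" using bd[OF True] by (auto simp: t_def)
      have "(\<Sum>i\<in>{1..l}. of_bool (p \<in> J i)) = (\<Sum>i\<in>{l + 1 - t..l}. 1 :: int)"
        by (rule sum.mono_neutral_cong_right) (use t True in \<open>auto simp: J_def\<close>)
      also have "\<dots> = int t" using t by simp
      finally show ?thesis unfolding lookup_int_vertex[OF J] t(1) by simp
    next
      case False
      then show ?thesis unfolding lookup_int_vertex[OF J] by (simp add: off J_def)
    qed
  qed
  then show "a \<in> int_vertex (\<lambda>p. p) ` tuples" using J by blast
qed

end

subsection \<open>Normality\<close>

text \<open>Hermite's identity. Passing from \<open>x\<close> to \<open>x + 1\<close> shifts the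
  summands by one place, and the term that enters exceeds the one that leaves by 1.\<close>

lemma sum_floor_shift:
  fixes x :: int
  assumes "0 < m"
  shows "(\<Sum>j<m. (x + int j) div int m) = x"
proof -
  define f where "f x = (\<Sum>j<m. (x + int j) div int m)" for x
  have step: "f (x + 1) = f x + 1" for x
  proof -
    let ?g = "\<lambda>j. (x + int j) div int m"
    have "f (x + 1) = (\<Sum>j<m. ?g (Suc j))"
      unfolding f_def by (rule sum.cong) (simp_all add: algebra_simps)
    moreover have "?g 0 + (\<Sum>j<m. ?g (Suc j)) = (\<Sum>j<m. ?g j) + ?g m"
      using sum.lessThan_Suc_shift[of ?g m] sum.lessThan_Suc[of ?g m] by simp
    moreover have "?g m = ?g 0 + 1" using assms by simp
    ultimately show ?thesis unfolding f_def by linarith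
  qed
  have "f x = x"
  proof (induction x rule: int_induct[where k=0])
    case base
    show ?case unfolding f_def by (rule sum.neutral) auto
  next
    case (step1 i)
    then show ?case using step[of i] by simp
  next
    case (step2 i)
    then show ?case using step[of "i - 1"] by simp
  qed
  then show ?thesis by (simp add: f_def)
qed

lemma semigroup_gen_iff: "x \<in> semigroup_gen B \<longleftrightarrow> (\<exists>bs. set bs \<subseteq> B \<and> x = sum_list bs)"
proof
  let ?T = "{x. \<exists>bs. set bs \<subseteq> B \<and> x = sum_list bs}"
  assume "x \<in> semigroup_gen B"
  moreover have "semigroup_gen B \<subseteq> ?T"
    unfolding semigroup_gen_def
  proof (rule hull_minimal)
    show "B \<subseteq> ?T"
    proof
      fix b assume "b \<in> B"
      then show "b \<in> ?T" by (intro CollectI exI[of _ "[b]"]) simp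
    qed
    show "0 \<in> ?T \<and> (\<forall>x\<in>?T. \<forall>y\<in>?T. x + y \<in> ?T)"
    proof (intro conjI ballI)
      show "0 \<in> ?T" by (intro CollectI exI[of _ "[]"]) simp
      fix x y assume "x \<in> ?T" "y \<in> ?T"
      then obtain bs bs' where "set bs \<subseteq> B" "x = sum_list bs" "set bs' \<subseteq> B" "y = sum_list bs'" by blast
      then show "x + y \<in> ?T" by (intro CollectI exI[of _ "bs @ bs'"]) simp
    qed
  qed
  ultimately show "\<exists>bs. set bs \<subseteq> B \<and> x = sum_list bs" by blast
next
  assume "\<exists>bs. set bs \<subseteq> B \<and> x = sum_list bs"
  then obtain bs where bs: "set bs \<subseteq> B" "x = sum_list bs" by blast
  have "sum_list bs \<in> T" if T: "0 \<in> T" "\<forall>x\<in>T. \<forall>y\<in>T. x + y \<in> T" "B \<subseteq> T" for T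
    using bs(1) by (induction bs) (use T in auto)
  then show "x \<in> semigroup_gen B"
    unfolding semigroup_gen_def hull_def bs(2) by blast
qed

context marked_poset
begin

text \<open>The summands are the rounded quotients of \<open>a + j\<close> by \<open>m\<close> for
  \<open>j < m\<close>. Rounding preserves the order inequalities, the marks are multiples of
  \<open>m\<close> so that adding \<open>j\<close> does not affect them, and Hermite's identity
  gives the sum.\<close>

lemma lattice_point_decomposition:
  fixes a :: "'p \<Rightarrow>\<^sub>0 int"
  assumes a: "order_reversing a" "marks_eq a m" and m: "0 < m"
  shows "\<exists>as. length as = m \<and> set as \<subseteq> lattice_points Q \<and> sum_list as = a"
proof -
  let ?l = "Poly_Mapping.lookup"
  have off: "?l a p = 0" if "p \<notin> P" for p
    using a(1) that unfolding order_reversing_def by (auto simp: in_keys_iff)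
  define b where "b j = Abs_poly_mapping (\<lambda>p. if p \<in> P then (?l a p + int j) div int m else 0)" for j
  have lb: "?l (b j) p = (if p \<in> P then (?l a p + int j) div int m else 0)" for j p
  proof -
    have "finite {p. (if p \<in> P then (?l a p + int j) div int m else 0) \<noteq> 0}"
      by (rule finite_subset[OF _ finP]) auto
    then show ?thesis unfolding b_def by (simp add: lookup_Abs_poly_mapping)
  qed
  have b: "b j \<in> lattice_points Q" if j: "j < m" for j
    unfolding lattice_points_def mem_Collect_eq real_vec_in_Q_iff order_reversing_def marks_eq_def
  proof (intro conjI allI impI ballI)
    show "Poly_Mapping.keys (b j) \<subseteq> P" by (auto simp: in_keys_iff lb split: if_splits)
    fix p q assume pq: "(p, q) \<in> r"
    then have "?l a q \<le> ?l a p" using a(1) unfolding order_reversing_def by blast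
    then show "?l (b j) q \<le> ?l (b j) p"
      using r_field[OF pq] m by (simp add: lb zdiv_mono1)
  next
    fix i assume i: "i \<in> {1..l}"
    then have "?l a (mk i) = of_nat (m * (l + 1 - i))" using a(2) unfolding marks_eq_def by blast
    then have "?l a (mk i) + int j = int (m * (l + 1 - i) + j)" by simp
    moreover have "(m * (l + 1 - i) + j) div m = l + 1 - i" using m j by simp
    ultimately show "?l (b j) (mk i) = of_nat (1 * (l + 1 - i))"
      using mk_in[of i] i unfolding lb by (metis atLeastAtMost_iff mult_1 of_nat_div)
  qed
  have "sum_list (map b [0..<m]) = a"
  proof (rule poly_mapping_eqI)
    fix p
    have "?l (sum_list (map b [0..<m])) p = (\<Sum>j<m. ?l (b j) p)"
      by (simp add: interv_sum_list_conv_sum_set_nat lookup_sum atLeast0LessThan)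
    also have "\<dots> = ?l a p"
      using sum_floor_shift[OF m, of "?l a p"] off[of p] by (cases "p \<in> P") (simp_all add: lb)
    finally show "?l (sum_list (map b [0..<m])) p = ?l a p" .
  qed
  moreover have "set (map b [0..<m]) \<subseteq> lattice_points Q" using b by auto
  ultimately show ?thesis by (intro exI[of _ "map b [0..<m]"]) simp
qed

lemma sum_list_lattice_points:
  assumes "set as \<subseteq> lattice_points Q"
  shows "order_reversing (sum_list as)" "marks_eq (sum_list as) (length as)"
proof -
  let ?l = "Poly_Mapping.lookup"
  have "order_reversing (sum_list as) \<and> marks_eq (sum_list as) (length as)"
    using assms
  proof (induction as)
    case Nil
    show ?case by (simp add: order_reversing_def marks_eq_def)
  next
    case (Cons a as)
    have a: "order_reversing a" "marks_eq a 1"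
      using Cons.prems lattice_points_Q_iff[of a] by auto
    have as: "order_reversing (sum_list as)" "marks_eq (sum_list as) (length as)"
      using Cons by simp_all
    have "order_reversing (a + sum_list as)"
      unfolding order_reversing_def lookup_add
    proof (intro conjI allI impI)
      show "Poly_Mapping.keys (a + sum_list as) \<subseteq> P"
        using Poly_Mapping.keys_add[of a "sum_list as"] a(1) as(1) unfolding order_reversing_def by blast
      fix p q assume "(p, q) \<in> r"
      then show "?l a q + ?l (sum_list as) q \<le> ?l a p + ?l (sum_list as) p"
        using a(1) as(1) unfolding order_reversing_def by (intro add_mono) blast+
    qed
    moreover have "marks_eq (a + sum_list as) (Suc (length as))"
      unfolding marks_eq_def lookup_add
    proof
      fix i assume i: "i \<in> {1..l}"
      have "?l a (mk i) = of_nat (1 * (l + 1 - i))" "?l (sum_list as) (mk i) = of_nat (length as * (l + 1 - i))"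
        using a(2) as(2) i unfolding marks_eq_def by blast+
      then show "?l a (mk i) + ?l (sum_list as) (mk i) = of_nat (Suc (length as) * (l + 1 - i))"
        by (simp only: mult_Suc of_nat_add mult_1)
    qed
    ultimately show ?case by simp
  qed
  then show "order_reversing (sum_list as)" "marks_eq (sum_list as) (length as)" by blast+
qed

text \<open>If a multiple of \<open>x\<close> is a sum of \<open>m\<close> differences of lattice
  points with \<open>v\<close>, then \<open>y\<close>, which is \<open>x\<close> plus
  \<open>m\<close> copies of \<open>v\<close>, satisfies the inequalities of the \<open>m\<close>-th
  dilate. It is therefore a sum of \<open>m\<close> lattice points, and subtracting \<open>v\<close>
  from each gives \<open>x\<close>.\<close>

lemma very_ample_Q: "very_ample Q"
  unfolding very_ample_def
proof (intro allI impI)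
  let ?l = "Poly_Mapping.lookup"
  fix v assume "real_vec v extreme_point_of Q"
  then have v: "v \<in> lattice_points Q"
    unfolding extreme_point_of_def lattice_points_def by blast
  let ?B = "(\<lambda>a. a - v) ` lattice_points Q"
  have shift: "\<exists>as. set as \<subseteq> lattice_points Q \<and> bs = map (\<lambda>a. a - v) as" if "set bs \<subseteq> ?B" for bs
    using that
  proof (induction bs)
    case Nil
    show ?case by simp
  next
    case (Cons b bs)
    then obtain as a where "set as \<subseteq> lattice_points Q" "bs = map (\<lambda>a. a - v) as"
      "a \<in> lattice_points Q" "b = a - v" by auto
    then show ?case by (intro exI[of _ "a # as"]) simp
  qed
  have sum_shift: "?l (\<Sum>a\<leftarrow>as. a - v) p = ?l (sum_list as) p - int (length as) * ?l v p" for as p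
    by (induction as) (simp_all add: lookup_add lookup_minus algebra_simps)
  have lv: "order_reversing v" "marks_eq v 1"
    using v unfolding lattice_points_Q_iff by blast+
  show "saturated (semigroup_gen ?B)"
    unfolding saturated_def
  proof (intro allI impI)
    fix x :: "'p \<Rightarrow>\<^sub>0 int" and k :: nat
    assume k: "0 < k" and "Poly_Mapping.map ((*) (int k)) x \<in> semigroup_gen ?B"
    then obtain bs where bs: "set bs \<subseteq> ?B" "Poly_Mapping.map ((*) (int k)) x = sum_list bs"
      unfolding semigroup_gen_iff by blast
    from shift[OF bs(1)] obtain as0 where
      as0: "set as0 \<subseteq> lattice_points Q" "bs = map (\<lambda>a. a - v) as0" by blast
    \<comment> \<open>Prepending \<open>v\<close> adds the difference 0, and guarantees that the
      number of summands is positive, as the decomposition requires.\<close>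
    define as where "as = v # as0"
    have as: "set as \<subseteq> lattice_points Q" using as0(1) v by (simp add: as_def)
    have "Poly_Mapping.map ((*) (int k)) x = (\<Sum>a\<leftarrow>as. a - v)"
      unfolding bs(2) as0(2) as_def by simp
    moreover have "?l (Poly_Mapping.map ((*) (int k)) x) p = int k * ?l x p" for p
      by (simp add: map.rep_eq when_def)
    ultimately have kx: "int k * ?l x p = ?l (sum_list as) p - int (length as) * ?l v p" for p
      using sum_shift[of as p] by metis
    define m where "m = length as"
    have m: "0 < m" by (simp add: m_def as_def)
    define y where "y = x + (\<Sum>_\<leftarrow>replicate m v. v)"
    have ly: "?l y p = ?l x p + int m * ?l v p" for p
    proof -
      have "?l (\<Sum>_\<leftarrow>replicate n v. v) p = int n * ?l v p" for n
        by (induction n) (simp_all add: lookup_add algebra_simps)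
      then show ?thesis by (simp add: y_def lookup_add)
    qed
    \<comment> \<open>The right-hand side combines points satisfying the inequalities with
      nonnegative coefficients; since \<open>k\<close> is positive, it can be cancelled from
      them.\<close>
    have ky: "int k * ?l y p = ?l (sum_list as) p + (int k - 1) * int m * ?l v p" for p
      unfolding ly using kx[of p] by (simp add: algebra_simps m_def)
    note sas = sum_list_lattice_points[OF as]
    have "order_reversing y"
      unfolding order_reversing_def
    proof (intro conjI allI impI)
      show "Poly_Mapping.keys y \<subseteq> P"
      proof
        fix p assume p: "p \<in> Poly_Mapping.keys y"
        show "p \<in> P"
        proof (rule ccontr)
          assume "p \<notin> P"
          then have "?l (sum_list as) p = 0" "?l v p = 0"
            using sas(1) lv(1) unfolding order_reversing_def by (auto simp: in_keys_iff)
          then have "?l y p = 0" using ky[of p] k by simp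
          then show False using p by (simp add: in_keys_iff)
        qed
      qed
      fix p q assume pq: "(p, q) \<in> r"
      have "?l (sum_list as) q \<le> ?l (sum_list as) p" "?l v q \<le> ?l v p"
        using sas(1) lv(1) pq unfolding order_reversing_def by blast+
      then have "int k * ?l y q \<le> int k * ?l y p"
        unfolding ky using k by (intro add_mono mult_left_mono) auto
      then show "?l y q \<le> ?l y p" using k by simp
    qed
    moreover have "marks_eq y m"
      unfolding marks_eq_def
    proof
      fix i assume i: "i \<in> {1..l}"
      have "?l (sum_list as) (mk i) = of_nat (m * (l + 1 - i))" "?l v (mk i) = of_nat (1 * (l + 1 - i))"
        using sas(2) lv(2) i unfolding marks_eq_def m_def by blast+
      then have "int k * ?l y (mk i) = int k * int (m * (l + 1 - i))"
        unfolding ky of_nat_mult by (simp only: left_diff_distrib mult_1)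
      then show "?l y (mk i) = of_nat (m * (l + 1 - i))" using k by simp
    qed
    ultimately obtain cs where cs: "length cs = m" "set cs \<subseteq> lattice_points Q" "sum_list cs = y"
      using lattice_point_decomposition[OF _ _ m] by blast
    have "x = (\<Sum>a\<leftarrow>cs. a - v)"
      by (rule poly_mapping_eqI) (simp add: sum_shift cs ly)
    moreover have "set (map (\<lambda>a. a - v) cs) \<subseteq> ?B" using cs(2) by auto
    ultimately show "x \<in> semigroup_gen ?B" unfolding semigroup_gen_iff by blast
  qed
qed

theorem toric_exponents_Q: "toric_exponents Q = int_vertex (\<lambda>p. p) ` tuples"
proof -
  have id: "(*\<^sub>R) (real 1) ` Q = Q" by simp
  have "(LEAST k. k > 0 \<and> very_ample ((*\<^sub>R) (real k) ` Q)) = 1"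
  proof (rule Least_equality)
    show "1 > (0::nat) \<and> very_ample ((*\<^sub>R) (real 1) ` Q)" unfolding id using very_ample_Q by simp
  qed auto
  then show ?thesis unfolding toric_exponents_def using id lattice_points_Q by simp
qed

text \<open>The right-hand side does not mention the order, so all cells have the dimension of the
  whole polytope. The unit vector at an unmarked \<open>p\<close> arises by deleting
  \<open>p\<close> from its principal ideal in one entry of a tuple, which keeps the block.\<close>

lemma span_differences_Q:
  "span {x - y | x y. x \<in> Q \<and> y \<in> Q} = span ((\<lambda>p. Poly_Mapping.single p (1::real)) ` (P - Pm))"
proof
  let ?l = "Poly_Mapping.lookup"
  let ?S = "span ((\<lambda>p. Poly_Mapping.single p (1::real)) ` (P - Pm))"
  show "span {x - y | x y. x \<in> Q \<and> y \<in> Q} \<subseteq> ?S"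
  proof (rule span_minimal)
    show "subspace ?S" by (rule subspace_span)
    show "{x - y | x y. x \<in> Q \<and> y \<in> Q} \<subseteq> ?S"
    proof
      fix z assume "z \<in> {x - y | x y. x \<in> Q \<and> y \<in> Q}"
      then obtain x y where z: "z = x - y" "x \<in> Q" "y \<in> Q" by blast
      have xy: "order_reversing x" "marks_eq x 1" "order_reversing y" "marks_eq y 1"
        using z(2,3) Q_iff by blast+
      have zero: "?l z p = 0" if "p \<notin> P - Pm" for p
      proof (cases "p \<in> Pm")
        case True
        then obtain i where "i \<in> {1..l}" "p = mk i" by blast
        then have "?l x p = of_nat (1 * (l + 1 - i))" "?l y p = of_nat (1 * (l + 1 - i))"
          using xy(2,4) unfolding marks_eq_def by blast+
        then show ?thesis by (simp add: z(1) lookup_minus)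
      next
        case False
        then have "p \<notin> P" using that by blast
        then have "?l x p = 0" "?l y p = 0"
          using xy(1,3) unfolding order_reversing_def by (auto simp: in_keys_iff)
        then show ?thesis by (simp add: z(1) lookup_minus)
      qed
      have "z = (\<Sum>p\<in>P - Pm. ?l z p *\<^sub>R Poly_Mapping.single p 1)"
      proof (rule poly_mapping_eqI)
        fix q
        have "?l (\<Sum>p\<in>P - Pm. ?l z p *\<^sub>R Poly_Mapping.single p 1) q =
            (\<Sum>p\<in>P - Pm. if p = q then ?l z p else 0)"
          unfolding lookup_sum lookup_scaleR lookup_single when_def by (rule sum.cong) auto
        also have "\<dots> = ?l z q" using finP zero[of q] by (simp add: sum.delta)
        finally show "?l z q = ?l (\<Sum>p\<in>P - Pm. ?l z p *\<^sub>R Poly_Mapping.single p 1) q" by (rule sym)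
      qed
      also have "\<dots> \<in> ?S" by (intro span_sum span_scale span_base) blast
      finally show "z \<in> ?S" .
    qed
  qed
next
  let ?D = "{x - y | x y. x \<in> Q \<and> y \<in> Q}"
  show "span ((\<lambda>p. Poly_Mapping.single p (1::real)) ` (P - Pm)) \<subseteq> span ?D"
  proof (rule span_mono, rule subsetI)
    fix z assume "z \<in> (\<lambda>p. Poly_Mapping.single p (1::real)) ` (P - Pm)"
    then obtain p where p: "p \<in> P" "p \<notin> Pm" "z = Poly_Mapping.single p 1" by blast
    have J1: "down p \<in> L" by (rule down_L)
    have J2: "down p - {p} \<in> L"
    proof (rule L_I)
      fix a b assume ab: "(a, b) \<in> r" "b \<in> down p - {p}"
      then have "(a, p) \<in> r" "a \<noteq> p" using r_trans r_antisym unfolding down_def by blast+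
      then show "a \<in> down p - {p}" by (simp add: down_def)
    qed (use L_subset[OF J1] in blast)
    obtain i where i: "i \<le> l" "in_block i (down p)" using ex_block[OF J1] by blast
    have "i \<noteq> 0"
      using i(2) block_0[OF J1] r_refl[OF p(1)] unfolding down_def by (intro notI) auto
    then have i1: "1 \<le> i" by simp
    have "(down p - {p}) \<inter> Pm = down p \<inter> Pm" using p(2) by blast
    then have i2: "in_block i (down p - {p})" using i(2) by (simp only: in_block_def)
    let ?J1 = "\<lambda>j. if j = i then down p else down (mk j)"
    let ?J2 = "\<lambda>j. if j = i then down p - {p} else down (mk j)"
    have t: "?J1 \<in> tuples" "?J2 \<in> tuples"
      using ex_tuple[OF J1 i(2) i1 i(1)] ex_tuple[OF J2 i2 i1 i(1)] by blast+
    have "vertex ?J1 - vertex ?J2 = z"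
    proof (rule poly_mapping_eqI)
      fix q
      have iI: "i \<in> {1..l}" using i1 i(1) by simp
      have "Poly_Mapping.lookup (vertex ?J1 - vertex ?J2) q =
          (\<Sum>j\<in>{1..l}. of_bool (q \<in> ?J1 j) - of_bool (q \<in> ?J2 j))"
        unfolding lookup_minus lookup_vertex[OF t(1)] lookup_vertex[OF t(2)] by (rule sum_subtractf[symmetric])
      also have "\<dots> = (\<Sum>j\<in>{1..l}. if j = i then of_bool (q = p) else 0)"
        by (rule sum.cong) (use r_refl[OF p(1)] in \<open>auto simp: down_def\<close>)
      also have "\<dots> = of_bool (q = p)" using iI by simp
      finally show "Poly_Mapping.lookup (vertex ?J1 - vertex ?J2) q = Poly_Mapping.lookup z q"
        unfolding p(3) by (auto simp: lookup_single when_def)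
    qed
    moreover have "vertex ?J1 \<in> Q" "vertex ?J2 \<in> Q"
      unfolding Q_eq_hull by (rule hull_inc[OF imageI[OF t(1)]], rule hull_inc[OF imageI[OF t(2)]])
    ultimately show "z \<in> ?D" by blast
  qed
qed

end

section \<open>Linear extensions\<close>

text \<open>Induction removes an element of least \<open>x\<close> that is maximal among such
  elements. Elements above it have no larger \<open>x\<close>, so it is maximal in all of
  \<open>P\<close> and can be put last; upper level sets thereby become initial segments of the
  list.\<close>

lemma ex_linear_extension:
  fixes x :: "'p \<Rightarrow> real"
  assumes "finite P" "antisym r" "trans r"
    "\<And>p q. p \<in> P \<Longrightarrow> q \<in> P \<Longrightarrow> (p, q) \<in> r \<Longrightarrow> x q \<le> x p"
  shows "\<exists>ps. distinct ps \<and> set ps = P \<and> (\<forall>k. set (take k ps) \<in> order_ideals P r) \<and>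
    (\<forall>t. \<exists>k. {p \<in> P. t \<le> x p} = set (take k ps))"
  using assms(1,4)
proof (induction "card P" arbitrary: P)
  case 0
  then have "P = {}" by simp
  then show ?case by (intro exI[of _ "[]"]) (simp add: order_ideals_def)
next
  case (Suc n)
  then have P_ne: "P \<noteq> {}" by auto
  define m0 where "m0 = Min (x ` P)"
  have m0: "m0 \<le> x p" if "p \<in> P" for p using Suc.prems(1) that by (simp add: m0_def)
  define S where "S = {p \<in> P. x p = m0}"
  have "m0 \<in> x ` P" unfolding m0_def using Suc.prems(1) P_ne by (intro Min_in) auto
  then have S: "finite S" "S \<noteq> {}" using Suc.prems(1) by (auto simp: S_def)
  \<comment> \<open>Counting strict predecessors turns the choice of a maximal element of
    \<open>S\<close> into the choice of a maximal number.\<close>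
  define f where "f p = card {q \<in> P. (q, p) \<in> r \<and> q \<noteq> p}" for p
  have "Max (f ` S) \<in> f ` S" using S by (intro Max_in) auto
  then obtain m where m: "m \<in> S" "f m = Max (f ` S)" by (metis imageE)
  have maxf: "f q \<le> f m" if "q \<in> S" for q using m(2) S(1) that by simp
  have mP: "m \<in> P" "x m = m0" using m(1) by (auto simp: S_def)
  have top: "q = m" if q: "q \<in> P" "(m, q) \<in> r" for q
  proof (rule ccontr)
    assume "q \<noteq> m"
    have "x q \<le> x m" using Suc.prems(2)[OF mP(1) q] .
    then have "q \<in> S" using m0[OF q(1)] mP(2) q(1) by (simp add: S_def)
    have qm: "(q, m) \<notin> r" using antisymD[OF assms(2) q(2)] \<open>q \<noteq> m\<close> by blast
    have "{q' \<in> P. (q', m) \<in> r \<and> q' \<noteq> m} \<subset> {q' \<in> P. (q', q) \<in> r \<and> q' \<noteq> q}"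
    proof
      show "{q' \<in> P. (q', m) \<in> r \<and> q' \<noteq> m} \<subseteq> {q' \<in> P. (q', q) \<in> r \<and> q' \<noteq> q}"
        using transD[OF assms(3) _ q(2)] qm by blast
      show "{q' \<in> P. (q', m) \<in> r \<and> q' \<noteq> m} \<noteq> {q' \<in> P. (q', q) \<in> r \<and> q' \<noteq> q}"
        using q mP(1) \<open>q \<noteq> m\<close> by blast
    qed
    then have "f m < f q" unfolding f_def using Suc.prems(1) by (intro psubset_card_mono) auto
    then show False using maxf[OF \<open>q \<in> S\<close>] by simp
  qed
  define P' where "P' = P - {m}"
  have "n = card P'" using Suc.hyps(2) mP(1) Suc.prems(1) by (simp add: P'_def)
  moreover have "finite P'" using Suc.prems(1) by (simp add: P'_def)
  moreover have "x q \<le> x p" if "p \<in> P'" "q \<in> P'" "(p, q) \<in> r" for p q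
    using Suc.prems(2) that by (simp add: P'_def)
  ultimately obtain ps where ps: "distinct ps" "set ps = P'"
    "\<forall>k. set (take k ps) \<in> order_ideals P' r" "\<forall>t. \<exists>k. {p \<in> P'. t \<le> x p} = set (take k ps)"
    using Suc.hyps(1)[of P'] by blast
  have P_eq: "P = insert m P'" "m \<notin> P'" using mP(1) by (auto simp: P'_def)
  show ?case
  proof (intro exI[of _ "ps @ [m]"] conjI allI)
    show "distinct (ps @ [m])" using ps(1,2) P_eq(2) by simp
    show "set (ps @ [m]) = P" using ps(2) P_eq(1) by simp
    fix k
    show "set (take k (ps @ [m])) \<in> order_ideals P r"
    proof (cases "k \<le> length ps")
      case True
      have k: "set (take k ps) \<in> order_ideals P' r" using ps(3) by blast
      show ?thesis
        unfolding order_ideals_def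
      proof (intro CollectI conjI ballI impI)
        show "set (take k (ps @ [m])) \<subseteq> P"
          using set_take_subset[of k "ps @ [m]"] ps(2) P_eq(1) by auto
        fix q p assume q: "q \<in> set (take k (ps @ [m]))" "p \<in> P" "(p, q) \<in> r"
        then have qk: "q \<in> set (take k ps)" using True by simp
        then have "q \<in> P'" using k by (auto simp: order_ideals_def)
        then have "p \<noteq> m" using top[of q] q(3) P_eq by blast
        then have "p \<in> P'" using q(2) P_eq(1) by blast
        then have "p \<in> set (take k ps)" using k qk q(3) unfolding order_ideals_def by blast
        then show "p \<in> set (take k (ps @ [m]))" using True by simp
      qed
    next
      case False
      then have "set (take k (ps @ [m])) = P" using ps(2) P_eq(1) by simp
      then show ?thesis by (simp add: order_ideals_def)
    qed
  next
    fix t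
    show "\<exists>k. {p \<in> P. t \<le> x p} = set (take k (ps @ [m]))"
    proof (cases "t \<le> m0")
      case True
      then have "{p \<in> P. t \<le> x p} = P" using m0 order_trans by blast
      then show ?thesis using ps(2) P_eq(1) by (intro exI[of _ "length (ps @ [m])"]) simp
    next
      case False
      then have eq: "{p \<in> P. t \<le> x p} = {p \<in> P'. t \<le> x p}" using mP(2) P_eq by auto
      obtain k where k: "{p \<in> P'. t \<le> x p} = set (take k ps)" using ps(4) by blast
      show ?thesis unfolding eq k by (intro exI[of _ "min k (length ps)"]) (auto simp: min_def)
    qed
  qed
qed

section \<open>Sorting lists of sets into chains\<close>

definition count_in :: "'p set list \<Rightarrow> 'p \<Rightarrow> nat" where
  "count_in Js p = (\<Sum>J\<leftarrow>Js. of_bool (p \<in> J))"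

text \<open>Each step replaces two sets by their union and intersection. Length and the multiplicity
  of every element are invariant, and these two data determine the resulting chain.\<close>

fun chain_insert :: "'p set \<Rightarrow> 'p set list \<Rightarrow> 'p set list" where
  "chain_insert J [] = [J]"
| "chain_insert J (C # Cs) = (J \<union> C) # chain_insert (J \<inter> C) Cs"

definition chain_sort :: "'p set list \<Rightarrow> 'p set list" where
  "chain_sort Js = foldr chain_insert Js []"

lemma count_in_Cons [simp]: "count_in (J # Js) p = of_bool (p \<in> J) + count_in Js p"
  and count_in_Nil [simp]: "count_in [] p = 0"
  by (simp_all add: count_in_def)

lemma chain_sort_simps [simp]: "chain_sort [] = []" "chain_sort (J # Js) = chain_insert J (chain_sort Js)"
  by (simp_all add: chain_sort_def)

lemma length_chain_insert: "length (chain_insert J Cs) = Suc (length Cs)"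
  by (induction Cs arbitrary: J) auto

lemma length_chain_sort: "length (chain_sort Js) = length Js"
  by (induction Js) (auto simp: length_chain_insert)

lemma count_in_chain_insert: "count_in (chain_insert J Cs) p = of_bool (p \<in> J) + count_in Cs p"
  by (induction Cs arbitrary: J) auto

lemma count_in_chain_sort: "count_in (chain_sort Js) p = count_in Js p"
  by (induction Js) (auto simp: count_in_chain_insert)

lemma chain_insert_subset: "C \<in> set (chain_insert J Cs) \<Longrightarrow> C \<subseteq> J \<union> \<Union>(set Cs)"
proof (induction Cs arbitrary: J)
  case (Cons D Cs)
  from Cons.prems consider "C = J \<union> D" | "C \<in> set (chain_insert (J \<inter> D) Cs)" by auto
  then show ?case
  proof cases
    case 2
    then show ?thesis using Cons.IH[OF 2] by auto
  qed auto
qed simp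

lemma sorted_chain_insert: "sorted_wrt (\<supseteq>) Cs \<Longrightarrow> sorted_wrt (\<supseteq>) (chain_insert J Cs)"
proof (induction Cs arbitrary: J)
  case (Cons C Cs)
  have "D \<subseteq> J \<union> C" if "D \<in> set (chain_insert (J \<inter> C) Cs)" for D
    using chain_insert_subset[OF that] Cons.prems by auto
  then show ?case using Cons by simp
qed simp

lemma sorted_chain_sort: "sorted_wrt (\<supseteq>) (chain_sort Js)"
  by (induction Js) (auto intro: sorted_chain_insert)

text \<open>The head of a decreasing chain consists of the elements with nonzero count. The length
  has to be prescribed because trailing empty sets do not contribute to the counts.\<close>

lemma chain_unique:
  assumes "sorted_wrt (\<supseteq>) Cs" "sorted_wrt (\<supseteq>) Ds" "length Cs = length Ds" "\<And>p. count_in Cs p = count_in Ds p"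
  shows "Cs = Ds"
  using assms(3,1,2,4)
proof (induction Cs Ds rule: list_induct2)
  case (Cons C Cs D Ds)
  have head: "p \<in> E \<longleftrightarrow> count_in (E # Es) p \<noteq> 0" if "sorted_wrt (\<supseteq>) (E # Es)" for E Es and p :: 'a
  proof -
    have "\<forall>F\<in>set Es. F \<subseteq> E" using that by simp
    then have "p \<notin> E \<Longrightarrow> count_in Es p = 0" by (induction Es) auto
    then show ?thesis by (cases "p \<in> E") simp_all
  qed
  have "C = D"
  proof (rule set_eqI)
    fix p show "p \<in> C \<longleftrightarrow> p \<in> D"
      unfolding head[OF Cons.prems(1)] head[OF Cons.prems(2)] Cons.prems(3)[of p] ..
  qed
  moreover have "Cs = Ds"
  proof (rule Cons.IH)
    show "count_in Cs p = count_in Ds p" for p using Cons.prems(3)[of p] \<open>C = D\<close> by simp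
  qed (use Cons.prems in simp_all)
  ultimately show ?case by simp
qed simp

text \<open>Identifies the members of a sorted chain as level sets of one function, so that a
  majorant tight on all level sets is tight on the chain.\<close>

lemma chain_levels:
  assumes "sorted_wrt (\<supseteq>) Cs" "C \<in> set Cs"
  shows "\<exists>t\<ge>1. C = {p. t \<le> count_in Cs p}"
  using assms
proof (induction Cs)
  case (Cons D Cs)
  have sub: "\<forall>F\<in>set Cs. F \<subseteq> D" using Cons.prems(1) by simp
  show ?case
  proof (cases "C = D")
    case True
    have "count_in Cs p = 0" if "p \<notin> D" for p using sub that by (induction Cs) auto
    then show ?thesis using True by (intro exI[of _ 1]) auto
  next
    case False
    then have C: "C \<in> set Cs" using Cons.prems(2) by simp
    then obtain t where t: "t \<ge> 1" "C = {p. t \<le> count_in Cs p}" using Cons by auto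
    have "C \<subseteq> D" using sub C by blast
    then have "C = {p. Suc t \<le> count_in (D # Cs) p}" using t by auto
    then show ?thesis by (intro exI[of _ "Suc t"]) simp
  qed
qed simp

context
  fixes M :: "'p set set" and F :: "'p set \<Rightarrow> 'a::comm_monoid_mult"
  assumes Int: "\<And>J J'. J \<in> M \<Longrightarrow> J' \<in> M \<Longrightarrow> J \<inter> J' \<in> M"
    and Un: "\<And>J J'. J \<in> M \<Longrightarrow> J' \<in> M \<Longrightarrow> J \<union> J' \<in> M"
    and F: "\<And>J J'. J \<in> M \<Longrightarrow> J' \<in> M \<Longrightarrow> F J * F J' = F (J \<inter> J') * F (J \<union> J')"
begin

lemma chain_insert_M: "J \<in> M \<Longrightarrow> set Cs \<subseteq> M \<Longrightarrow> set (chain_insert J Cs) \<subseteq> M"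
  by (induction Cs arbitrary: J) (auto simp: Int Un)

lemma chain_sort_M: "set Js \<subseteq> M \<Longrightarrow> set (chain_sort Js) \<subseteq> M"
  by (induction Js) (simp_all add: chain_insert_M)

lemma prod_chain_insert:
  "J \<in> M \<Longrightarrow> set Cs \<subseteq> M \<Longrightarrow> prod_list (map F (chain_insert J Cs)) = F J * prod_list (map F Cs)"
proof (induction Cs arbitrary: J)
  case (Cons C Cs)
  have C: "C \<in> M" "set Cs \<subseteq> M" using Cons.prems by auto
  have "prod_list (map F (chain_insert J (C # Cs))) = F (J \<union> C) * (F (J \<inter> C) * prod_list (map F Cs))"
    using Cons.IH[OF Int[OF Cons.prems(1) C(1)] C(2)] by simp
  also have "\<dots> = (F (J \<inter> C) * F (J \<union> C)) * prod_list (map F Cs)" by (simp only: ac_simps)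
  also have "\<dots> = F J * prod_list (map F (C # Cs))"
    unfolding F[OF Cons.prems(1) C(1), symmetric] by (simp add: ac_simps)
  finally show ?case .
qed simp

lemma prod_chain_sort: "set Js \<subseteq> M \<Longrightarrow> prod_list (map F (chain_sort Js)) = prod_list (map F Js)"
  by (induction Js) (simp_all add: prod_chain_insert chain_sort_M)

text \<open>The straightening argument: a function compatible with meets and joins has the same
  product over both lists, because they sort to the same chain. Thus the quadratic relations imply
  all binomial relations.\<close>

lemma prod_eq_if_count_eq:
  assumes "set Js \<subseteq> M" "set Js' \<subseteq> M" "length Js = length Js'" "\<And>p. count_in Js p = count_in Js' p"
  shows "prod_list (map F Js) = prod_list (map F Js')"
proof -
  have "chain_sort Js = chain_sort Js'"
    by (rule chain_unique) (simp_all add: sorted_chain_sort length_chain_sort count_in_chain_sort assms)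
  then show ?thesis using prod_chain_sort[OF assms(1)] prod_chain_sort[OF assms(2)] by simp
qed

end

section \<open>Linearity domains of a supermodular function\<close>

locale supermodular_poset = marked_poset +
  fixes w :: "'a set \<Rightarrow> real"
  assumes supermodular: "\<And>J J'. J \<in> L \<Longrightarrow> J' \<in> L \<Longrightarrow> w J + w J' \<le> w (J \<inter> J') + w (J \<union> J')"
begin

definition lin :: "('a \<Rightarrow> real) \<Rightarrow> 'a set \<Rightarrow> real" where
  "lin g J = w {} + sum g J"

definition cell :: "('a \<Rightarrow> real) \<Rightarrow> 'a set set" where
  "cell g = {J \<in> L. w J = lin g J}"

text \<open>Being tight along a full flag of ideals determines \<open>g\<close> on \<open>P\<close>.
  This selects the majorants whose cells have full dimension.\<close>

definition supporting :: "('a \<Rightarrow> real) \<Rightarrow> bool" where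
  "supporting g \<longleftrightarrow> (\<forall>J\<in>L. w J \<le> lin g J) \<and>
     (\<exists>ps. distinct ps \<and> set ps = P \<and> (\<forall>k. set (take k ps) \<in> cell g))"

definition cells :: "'a set set set" where
  "cells = cell ` {g. supporting g}"

text \<open>Birkhoff's construction: the order in which \<open>p\<close> is below \<open>q\<close>
  when every member of the sublattice containing \<open>q\<close> contains \<open>p\<close>.\<close>

definition cell_order :: "'a set set \<Rightarrow> 'a rel" where
  "cell_order M = {(p, q) \<in> P \<times> P. \<forall>J\<in>M. q \<in> J \<longrightarrow> p \<in> J}"

lemma lin_modular: "J \<in> L \<Longrightarrow> J' \<in> L \<Longrightarrow> lin g J + lin g J' = lin g (J \<inter> J') + lin g (J \<union> J')"
  unfolding lin_def using sum.union_inter[of J J' g] L_finite by simp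

text \<open>The greedy algorithm: interpolating \<open>w\<close> linearly along a maximal chain yields an upper bound.\<close>

lemma ex_supporting:
  assumes ps: "distinct ps" "set ps = P" "\<And>k. set (take k ps) \<in> L"
  shows "\<exists>g. supporting g \<and> (\<forall>k. set (take k ps) \<in> cell g)"
proof -
  define T where "T k = set (take k ps)" for k
  \<comment> \<open>The gain of \<open>w\<close> when \<open>q\<close> joins its predecessors in the
    list; \<open>takeWhile\<close> expresses it through the element instead of its position.\<close>
  define g where "g q = (let J = set (takeWhile (\<lambda>p. p \<noteq> q) ps) in w (insert q J) - w J)" for q
  have T_Suc: "T (Suc k) = insert (ps ! k) (T k)" if "k < length ps" for k
    using that by (simp add: T_def take_Suc_conv_app_nth)
  have notin: "ps ! k \<notin> T k" if "k < length ps" for k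
    using that ps(1) by (auto simp: T_def in_set_conv_nth nth_eq_iff_index_eq)
  have g: "g (ps ! k) = w (T (Suc k)) - w (T k)" if k: "k < length ps" for k
  proof -
    have "takeWhile (\<lambda>p. p \<noteq> ps ! k) ps = take k ps"
      by (rule takeWhile_eq_take_P_nth) (use k ps(1) in \<open>auto simp: nth_eq_iff_index_eq\<close>)
    then show ?thesis unfolding g_def Let_def T_Suc[OF k] by (simp add: T_def)
  qed
  have TL: "T k \<in> L" for k using ps(3) by (simp add: T_def)
  have T0: "T 0 = {}" by (simp add: T_def)
  have on_T: "w (T k) = lin g (T k)" if "k \<le> length ps" for k
    using that
  proof (induction k)
    case 0
    show ?case by (simp add: T0 lin_def)
  next
    case (Suc k)
    then have k: "k < length ps" by simp
    have "lin g (T (Suc k)) = g (ps ! k) + lin g (T k)"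
      unfolding lin_def T_Suc[OF k] using notin[OF k] L_finite[OF TL[of k]] by simp
    then show ?case using Suc g[OF k] by simp
  qed
  have T_ge: "T k = T (length ps)" if "length ps \<le> k" for k using that by (simp add: T_def)
  have "w (J \<inter> T k) \<le> lin g (J \<inter> T k)" if "J \<in> L" "k \<le> length ps" for J k
    using that(2)
  proof (induction k)
    case 0
    show ?case by (simp add: T0 lin_def)
  next
    case (Suc k)
    then have k: "k < length ps" by simp
    have IH: "w (J \<inter> T k) \<le> lin g (J \<inter> T k)" using Suc by simp
    show ?case
    proof (cases "ps ! k \<in> J")
      case True
      let ?A = "J \<inter> T (Suc k)"
      have A: "?A = insert (ps ! k) (J \<inter> T k)" unfolding T_Suc[OF k] using True by blast
      \<comment> \<open>Supermodularity bounds the gain from adding \<open>ps ! k\<close> to the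
        smaller set by the gain along the chain, which is \<open>g (ps ! k)\<close>.\<close>
      have "w ?A + w (T k) \<le> w (?A \<inter> T k) + w (?A \<union> T k)"
        by (rule supermodular[OF L_Int[OF that(1) TL] TL])
      moreover have "?A \<inter> T k = J \<inter> T k" "?A \<union> T k = T (Suc k)"
        unfolding T_Suc[OF k] using True by blast+
      ultimately have "w ?A \<le> w (J \<inter> T k) + g (ps ! k)" using g[OF k] by simp
      moreover have "lin g ?A = g (ps ! k) + lin g (J \<inter> T k)"
        unfolding lin_def A using notin[OF k] L_finite[OF that(1)] by simp
      ultimately show ?thesis using IH by linarith
    next
      case False
      then have "J \<inter> T (Suc k) = J \<inter> T k" unfolding T_Suc[OF k] by blast
      then show ?thesis using IH by simp
    qed
  qed
  then have le: "w J \<le> lin g J" if "J \<in> L" for J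
  proof -
    have "J \<inter> T (length ps) = J" using L_subset[OF that] ps(2) by (auto simp: T_def)
    then show ?thesis using \<open>\<And>J k. J \<in> L \<Longrightarrow> k \<le> length ps \<Longrightarrow> w (J \<inter> T k) \<le> lin g (J \<inter> T k)\<close>[OF that, of "length ps"] by simp
  qed
  have "T k \<in> cell g" for k
    using on_T[of k] on_T[of "length ps"] T_ge[of k] TL[of k] unfolding cell_def by (cases "k \<le> length ps") auto
  then have "\<forall>k. set (take k ps) \<in> cell g" unfolding T_def by blast
  then show ?thesis unfolding supporting_def using le ps(1,2) by blast
qed

lemma finite_cells: "finite cells"
  by (rule finite_subset[of _ "Pow L"]) (use finite_L in \<open>auto simp: cells_def cell_def\<close>)

section \<open>Cells as sublattices and their orders\<close>

context
  fixes g assumes g: "supporting g"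
begin

lemma cell_subset: "cell g \<subseteq> L" unfolding cell_def by blast

lemma cell_w: "J \<in> cell g \<Longrightarrow> w J = lin g J" unfolding cell_def by blast

lemma supporting_le: "J \<in> L \<Longrightarrow> w J \<le> lin g J" using g unfolding supporting_def by blast

text \<open>Squeezing: \<open>w\<close> is supermodular, \<open>lin g\<close> is modular and
  dominates \<open>w\<close>, so tightness at two ideals forces tightness at their meet and
  join.\<close>

lemma cell_Int_Un:
  assumes "J \<in> cell g" "J' \<in> cell g"
  shows "J \<inter> J' \<in> cell g" "J \<union> J' \<in> cell g"
proof -
  have J: "J \<in> L" "J' \<in> L" using assms cell_subset by blast+
  note IU = L_Int[OF J] L_Un[OF J]
  have "w (J \<inter> J') = lin g (J \<inter> J') \<and> w (J \<union> J') = lin g (J \<union> J')"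
    using supermodular[OF J] lin_modular[OF J, of g] cell_w[OF assms(1)] cell_w[OF assms(2)]
      supporting_le[OF IU(1)] supporting_le[OF IU(2)] by linarith
  then show "J \<inter> J' \<in> cell g" "J \<union> J' \<in> cell g" using IU by (simp_all add: cell_def)
qed

lemma cell_modular: "J \<in> cell g \<Longrightarrow> J' \<in> cell g \<Longrightarrow> w J + w J' = w (J \<inter> J') + w (J \<union> J')"
  using cell_w cell_Int_Un lin_modular[of J J' g] cell_subset by (metis subsetD)

lemma cell_chain: "\<exists>ps. distinct ps \<and> set ps = P \<and> (\<forall>k. set (take k ps) \<in> cell g)"
  using g unfolding supporting_def by blast

lemma cell_empty: "{} \<in> cell g" and cell_P: "P \<in> cell g"
proof -
  obtain ps where ps: "distinct ps" "set ps = P" "\<And>k. set (take k ps) \<in> cell g" using cell_chain by blast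
  show "{} \<in> cell g" using ps(3)[of 0] by simp
  show "P \<in> cell g" using ps(3)[of "length ps"] ps(2) by simp
qed

text \<open>Antisymmetry is the only point that needs the full flag in the cell: one of its initial
  segments separates any two elements of \<open>P\<close>.\<close>

lemma stronger_cell_order: "stronger_order P r (cell_order (cell g))"
proof -
  let ?s = "cell_order (cell g)"
  obtain ps where ps: "distinct ps" "set ps = P" "\<And>k. set (take k ps) \<in> cell g" using cell_chain by blast
  have sub: "r \<subseteq> ?s"
    using r_field L_down cell_subset unfolding cell_order_def by blast
  have "antisym ?s"
  proof (rule antisymI)
    fix p q assume pq: "(p, q) \<in> ?s" "(q, p) \<in> ?s"
    then have iff: "p \<in> J \<longleftrightarrow> q \<in> J" if "J \<in> cell g" for J using that unfolding cell_order_def by blast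
    have "p \<in> P" "q \<in> P" using pq unfolding cell_order_def by blast+
    then obtain i j where ij: "i < length ps" "ps ! i = p" "j < length ps" "ps ! j = q"
      using ps(2) by (metis in_set_conv_nth)
    have mem: "ps ! i' \<in> set (take (Suc i') ps)" if "i' < length ps" for i'
      using that by (simp add: take_Suc_conv_app_nth)
    have notmem: "ps ! j' \<notin> set (take (Suc i') ps)" if "i' < j'" "j' < length ps" for i' j'
      using that ps(1) by (auto simp: in_set_conv_nth nth_eq_iff_index_eq)
    show "p = q"
    proof (rule ccontr)
      assume "p \<noteq> q"
      then have "i \<noteq> j" using ij by auto
      then consider "i < j" | "j < i" by linarith
      then show False
      proof cases
        case 1
        then show False using iff[OF ps(3)[of "Suc i"]] mem[OF ij(1)] notmem[OF 1 ij(3)] ij by simp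
      next
        case 2
        then show False using iff[OF ps(3)[of "Suc j"]] mem[OF ij(3)] notmem[OF 2 ij(1)] ij by simp
      qed
    qed
  qed
  moreover have "?s \<subseteq> P \<times> P" "refl_on P ?s" "trans ?s"
    unfolding cell_order_def refl_on_def trans_def by blast+
  ultimately show ?thesis
    unfolding stronger_order_def partial_order_on_def preorder_on_def using sub by blast
qed

text \<open>An ideal of the new order is the union of the sets \<open>H q\<close> for its elements
  \<open>q\<close>, where \<open>H q\<close> is the least member of the cell containing
  \<open>q\<close>; finite unions stay in the cell.\<close>

lemma order_ideals_cell_order: "order_ideals P (cell_order (cell g)) = cell g"
proof (intro equalityI subsetI)
  fix J assume "J \<in> cell g"
  then show "J \<in> order_ideals P (cell_order (cell g))"
    using cell_subset L_subset unfolding order_ideals_def cell_order_def by blast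
next
  fix J assume J: "J \<in> order_ideals P (cell_order (cell g))"
  then have JP: "J \<subseteq> P" unfolding order_ideals_def by blast
  have fin: "finite (cell g)" using cell_subset finite_L finite_subset by blast
  define H where "H q = \<Inter>{J' \<in> cell g. q \<in> J'}" for q
  have Hq: "H q \<in> cell g" "q \<in> H q" if q: "q \<in> P" for q
  proof -
    have "\<Inter>A \<in> cell g" if "finite A" "A \<noteq> {}" "A \<subseteq> cell g" for A
      using that
    proof (induction A rule: finite_ne_induct)
      case (insert J A)
      then show ?case using cell_Int_Un(1)[of J "\<Inter>A"] by simp
    qed simp
    moreover have "{J' \<in> cell g. q \<in> J'} \<noteq> {}" using cell_P q by blast
    moreover have "finite {J' \<in> cell g. q \<in> J'}" using fin by simp
    ultimately show "H q \<in> cell g" unfolding H_def by blast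
    show "q \<in> H q" unfolding H_def by blast
  qed
  have "H q \<subseteq> J" if q: "q \<in> J" for q
  proof
    fix p assume p: "p \<in> H q"
    have "q \<in> P" using q JP by blast
    then have "p \<in> P" using p Hq(1) cell_subset L_subset by blast
    then have "(p, q) \<in> cell_order (cell g)"
      using p \<open>q \<in> P\<close> unfolding cell_order_def H_def by blast
    then show "p \<in> J" using J q \<open>p \<in> P\<close> unfolding order_ideals_def by blast
  qed
  then have eq: "J = \<Union>(H ` J)" using Hq(2) JP by blast
  have "\<Union>A \<in> cell g" if "finite A" "A \<subseteq> cell g" for A
    using that
  proof (induction A)
    case empty
    show ?case using cell_empty by simp
  next
    case (insert J A)
    then show ?case using cell_Int_Un(2)[of J "\<Union>A"] by simp
  qed
  moreover have "finite (H ` J)" "H ` J \<subseteq> cell g" using Hq(1) JP finP finite_subset by blast+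
  ultimately show "J \<in> cell g" using eq by metis
qed

lemma marked_poset_cell: "marked_poset P (cell_order (cell g)) l mk"
proof -
  have "partial_order_on P (cell_order (cell g))" "r \<subseteq> cell_order (cell g)"
    using stronger_cell_order unfolding stronger_order_def by blast+
  then show ?thesis
    using finP l_pos mk_in mk_le mk_inj mk_min mk_max unfolding marked_poset_def by blast
qed

abbreviation "cell_tuples \<equiv> marked_poset.tuples P (cell_order (cell g)) l mk"
abbreviation "cell_Q \<equiv> marked_polytope P Pm (cell_order (cell g)) marked_weight"

lemma cell_tuples_iff: "J \<in> cell_tuples \<longleftrightarrow> (\<forall>i\<in>{1..l}. J i \<in> cell g \<and> in_block i (J i))"
  unfolding marked_poset.tuples_def[OF marked_poset_cell] order_ideals_cell_order by blast

lemma cell_Q_eq_hull: "cell_Q = convex hull (vertex ` cell_tuples)"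
  by (rule marked_poset.Q_eq_hull[OF marked_poset_cell])

lemma cell_tuples_subset: "cell_tuples \<subseteq> tuples"
  using cell_tuples_iff cell_subset unfolding tuples_def by blast

lemma cell_Q_subset: "cell_Q \<subseteq> Q"
  unfolding cell_Q_eq_hull Q_eq_hull using cell_tuples_subset by (intro hull_mono) blast

end

text \<open>Both majorants are tight on a full flag of the smaller cell. Successive differences
  along it give every value on \<open>P\<close>, so the two functions agree there.\<close>

lemma cell_mono_eq:
  assumes g: "supporting g" "supporting g'" and sub: "cell g \<subseteq> cell g'"
  shows "cell g = cell g'"
proof -
  obtain ps where ps: "distinct ps" "set ps = P" "\<And>k. set (take k ps) \<in> cell g"
    using cell_chain[OF g(1)] by blast
  have eq: "g p = g' p" if "p \<in> P" for p
  proof -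
    have "p \<in> set ps" using that ps(2) by simp
    then obtain i where i: "i < length ps" "ps ! i = p" unfolding in_set_conv_nth by blast
    have t: "set (take (Suc i) ps) = insert p (set (take i ps))"
      using i by (auto simp: take_Suc_conv_app_nth)
    have n: "p \<notin> set (take i ps)"
      using i ps(1) by (auto simp: in_set_conv_nth nth_eq_iff_index_eq)
    have "lin f (set (take (Suc i) ps)) = f p + lin f (set (take i ps))" for f
      unfolding t lin_def using n by simp
    moreover have same: "lin g (set (take k ps)) = lin g' (set (take k ps))" for k
      using cell_w[OF g(1) ps(3)[of k]] cell_w[OF g(2) subsetD[OF sub ps(3)[of k]]] by simp
    ultimately show ?thesis using same[of i] same[of "Suc i"] by simp
  qed
  have "lin g J = lin g' J" if "J \<in> L" for J
    unfolding lin_def using L_subset[OF that] eq by (intro arg_cong2[where f="(+)"] sum.cong) auto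
  then show ?thesis unfolding cell_def by auto
qed

text \<open>A linear extension adapted to \<open>x\<close> has all upper level sets among its
  initial segments; the greedy majorant of that flag is tight on them.\<close>

lemma ex_cell_levels:
  fixes x :: "'a \<Rightarrow> real"
  assumes "\<And>p q. (p, q) \<in> r \<Longrightarrow> x q \<le> x p"
  shows "\<exists>g. supporting g \<and> (\<forall>t. {p \<in> P. t \<le> x p} \<in> cell g)"
proof -
  have "\<exists>ps. distinct ps \<and> set ps = P \<and> (\<forall>k. set (take k ps) \<in> L) \<and>
      (\<forall>t. \<exists>k. {p \<in> P. t \<le> x p} = set (take k ps))"
    by (rule ex_linear_extension) (use finP partial_order_onD[OF po] assms in auto)
  then obtain ps where ps: "distinct ps" "set ps = P" "\<forall>k. set (take k ps) \<in> L"
    "\<forall>t. \<exists>k. {p \<in> P. t \<le> x p} = set (take k ps)" by blast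
  have "\<exists>g. supporting g \<and> (\<forall>k. set (take k ps) \<in> cell g)"
    by (rule ex_supporting[OF ps(1,2)]) (use ps(3) in blast)
  then obtain g where "supporting g" "\<forall>k. set (take k ps) \<in> cell g" by (elim exE conjE)
  moreover have "{p \<in> P. t \<le> x p} \<in> cell g" for t
  proof -
    obtain k where "{p \<in> P. t \<le> x p} = set (take k ps)" using ps(4) by blast
    then show ?thesis using \<open>\<forall>k. set (take k ps) \<in> cell g\<close> by simp
  qed
  ultimately show ?thesis by blast
qed

text \<open>The level set of \<open>x\<close> at the height of \<open>q\<close> is in the cell and
  contains \<open>q\<close>. A relation of \<open>p\<close> below \<open>q\<close> in the cell order
  therefore puts \<open>p\<close> into it, which is the required inequality.\<close>

lemma Q_covered: "x \<in> Q \<Longrightarrow> \<exists>g. supporting g \<and> x \<in> cell_Q g"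
proof -
  assume "x \<in> Q"
  then have x: "order_reversing x" "marks_eq x 1" using Q_iff by blast+
  have rev: "Poly_Mapping.lookup x q \<le> Poly_Mapping.lookup x p" if "(p, q) \<in> r" for p q
    using x(1) that unfolding order_reversing_def by blast
  have "\<exists>g. supporting g \<and> (\<forall>t. {p \<in> P. t \<le> Poly_Mapping.lookup x p} \<in> cell g)"
    by (rule ex_cell_levels) (rule rev)
  then obtain g where g: "supporting g" "\<forall>t. {p \<in> P. t \<le> Poly_Mapping.lookup x p} \<in> cell g"
    by (elim exE conjE)
  have "Poly_Mapping.lookup x q \<le> Poly_Mapping.lookup x p" if pq: "(p, q) \<in> cell_order (cell g)" for p q
  proof -
    let ?J = "{p \<in> P. Poly_Mapping.lookup x q \<le> Poly_Mapping.lookup x p}"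
    have J: "?J \<in> cell g" using g(2) by (rule spec)
    have qP: "q \<in> P" and all: "\<forall>J\<in>cell g. q \<in> J \<longrightarrow> p \<in> J"
      using pq unfolding cell_order_def by blast+
    from bspec[OF all J] show ?thesis using qP by simp
  qed
  moreover have "Poly_Mapping.keys x \<subseteq> P" using x(1) unfolding order_reversing_def by blast
  ultimately have "marked_poset.order_reversing P (cell_order (cell g)) x"
    unfolding marked_poset.order_reversing_def[OF marked_poset_cell[OF g(1)]] by blast
  then have "x \<in> cell_Q g"
    unfolding marked_poset.Q_iff[OF marked_poset_cell[OF g(1)]] using x(2) by blast
  then show ?thesis using g(1) by blast
qed

section \<open>Intersections of cell polytopes\<close>

definition height_diff :: "('a \<Rightarrow> real) \<Rightarrow> ('a \<Rightarrow> real) \<Rightarrow> ('a \<Rightarrow>\<^sub>0 real) \<Rightarrow> real" where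
  "height_diff g g' x = (\<Sum>p\<in>P. (g' p - g p) * Poly_Mapping.lookup x p)"

lemma linear_height_diff: "linear (height_diff g g')"
proof (rule linearI)
  fix x y :: "'a \<Rightarrow>\<^sub>0 real" and c :: real
  show "height_diff g g' (x + y) = height_diff g g' x + height_diff g g' y"
    unfolding height_diff_def lookup_add distrib_left by (rule sum.distrib)
  show "height_diff g g' (c *\<^sub>R x) = c *\<^sub>R height_diff g g' x"
    unfolding height_diff_def lookup_scaleR real_scaleR_def sum_distrib_left
    by (rule sum.cong) (simp_all only: mult.left_commute)
qed

lemma height_diff_swap: "height_diff g' g x = - height_diff g g' x"
  unfolding height_diff_def sum_negf[symmetric] by (rule sum.cong) (simp_all add: algebra_simps)

lemma height_diff_vertex:
  assumes "J \<in> tuples"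
  shows "height_diff g g' (vertex J) = (\<Sum>i\<in>{1..l}. lin g' (J i) - lin g (J i))"
proof -
  have "height_diff g g' (vertex J) = (\<Sum>p\<in>P. \<Sum>i\<in>{1..l}. (g' p - g p) * of_bool (p \<in> J i))"
    unfolding height_diff_def lookup_vertex[OF assms] sum_distrib_left ..
  also have "\<dots> = (\<Sum>i\<in>{1..l}. \<Sum>p\<in>P. (g' p - g p) * of_bool (p \<in> J i))" by (rule sum.swap)
  also have "\<dots> = (\<Sum>i\<in>{1..l}. lin g' (J i) - lin g (J i))"
  proof (rule sum.cong[OF refl])
    fix i assume "i \<in> {1..l}"
    then have "J i \<subseteq> P" using assms L_subset unfolding tuples_def by blast
    then have "(\<Sum>p\<in>P. (g' p - g p) * of_bool (p \<in> J i)) = (\<Sum>p\<in>J i. g' p - g p)"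
      using finP by (intro sum.mono_neutral_cong_right) auto
    then show "(\<Sum>p\<in>P. (g' p - g p) * of_bool (p \<in> J i)) = lin g' (J i) - lin g (J i)"
      by (simp add: lin_def sum_subtractf)
  qed
  finally show ?thesis .
qed

context
  fixes g g' assumes g: "supporting g" and g': "supporting g'"
begin

lemma height_diff_terms:
  assumes "J \<in> cell_tuples g" "i \<in> {1..l}"
  shows "0 \<le> lin g' (J i) - lin g (J i)"
proof -
  have "J i \<in> cell g" using assms cell_tuples_iff[OF g] by blast
  then show ?thesis
    using cell_w[OF g, of "J i"] supporting_le[OF g', of "J i"] cell_subset[OF g] by auto
qed

lemma height_diff_vertex_nonneg: "v \<in> vertex ` cell_tuples g \<Longrightarrow> 0 \<le> height_diff g g' v"
proof -
  assume "v \<in> vertex ` cell_tuples g"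
  then obtain J where J: "J \<in> cell_tuples g" "v = vertex J" by blast
  then have "J \<in> tuples" using cell_tuples_subset[OF g] by blast
  then show ?thesis
    unfolding J(2) height_diff_vertex[OF \<open>J \<in> tuples\<close>] by (intro sum_nonneg height_diff_terms[OF J(1)])
qed

text \<open>On the cell of \<open>g\<close> the function \<open>lin g\<close> equals
  \<open>w\<close>, which \<open>lin g'\<close> dominates; the constants \<open>w {}\<close> cancel.
  The functional thus supports the first polytope along its intersection with the second.\<close>

lemma height_diff_nonneg: "x \<in> cell_Q g \<Longrightarrow> 0 \<le> height_diff g g' x"
  unfolding cell_Q_eq_hull[OF g]
  by (rule nonneg_on_convex_hull[OF linear_height_diff height_diff_vertex_nonneg])

lemma height_diff_zero_vertex:
  assumes "J \<in> cell_tuples g" "height_diff g g' (vertex J) = 0"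
  shows "J \<in> cell_tuples g'"
  unfolding cell_tuples_iff[OF g']
proof (intro ballI conjI)
  fix i assume i: "i \<in> {1..l}"
  have J: "J \<in> tuples" using cell_tuples_subset[OF g] assms(1) by blast
  have "\<forall>i\<in>{1..l}. lin g' (J i) - lin g (J i) = 0"
    using assms(2)[unfolded height_diff_vertex[OF J]] height_diff_terms[OF assms(1)]
    by (subst (asm) sum_nonneg_eq_0_iff) auto
  then have eq: "lin g' (J i) = lin g (J i)" using i by simp
  have Ji: "J i \<in> cell g" "in_block i (J i)" using assms(1) i cell_tuples_iff[OF g] by blast+
  then show "in_block i (J i)" by blast
  show "J i \<in> cell g'"
    using Ji(1) eq cell_w[OF g Ji(1)] unfolding cell_def by auto
qed

end

text \<open>The functional is nonnegative on one polytope and nonpositive on the other. A zero in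
  the first is a convex combination of generating points that are zeros, and all entries of their
  tuples are tight for both majorants.\<close>

lemma cell_Q_Int:
  assumes g: "supporting g" and g': "supporting g'"
  shows "cell_Q g \<inter> cell_Q g' = {x \<in> cell_Q g. height_diff g g' x = 0}"
proof (intro equalityI subsetI)
  fix x assume x: "x \<in> cell_Q g \<inter> cell_Q g'"
  then have "0 \<le> height_diff g g' x" "0 \<le> height_diff g' g x"
    using height_diff_nonneg[OF g g'] height_diff_nonneg[OF g' g] by blast+
  then have "height_diff g g' x = 0" unfolding height_diff_swap[of g' g] by simp
  then show "x \<in> {x \<in> cell_Q g. height_diff g g' x = 0}" using x by blast
next
  fix x assume x: "x \<in> {x \<in> cell_Q g. height_diff g g' x = 0}"
  then have "x \<in> convex hull (vertex ` cell_tuples g)" "height_diff g g' x = 0"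
    unfolding cell_Q_eq_hull[OF g] by blast+
  then have "x \<in> convex hull {v \<in> vertex ` cell_tuples g. height_diff g g' v = 0}"
    using height_diff_vertex_nonneg[OF g g']
    by (intro convex_hull_zeros_of_nonneg[OF linear_height_diff]) blast+
  moreover have "{v \<in> vertex ` cell_tuples g. height_diff g g' v = 0} \<subseteq> vertex ` cell_tuples g'"
    using height_diff_zero_vertex[OF g g'] by blast
  ultimately have "x \<in> cell_Q g'" unfolding cell_Q_eq_hull[OF g'] using hull_mono by blast
  then show "x \<in> cell_Q g \<inter> cell_Q g'" using x by blast
qed

lemma cell_Q_Int_face:
  assumes "supporting g" "supporting g'"
  shows "cell_Q g \<inter> cell_Q g' face_of cell_Q g"
  unfolding cell_Q_Int[OF assms]
proof (rule face_of_zeros_of_nonneg[OF linear_height_diff _ height_diff_nonneg[OF assms]])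
  show "convex (cell_Q g)" unfolding cell_Q_eq_hull[OF assms(1)] by (rule convex_convex_hull)
qed

text \<open>An ideal of the first cell is completed to a tuple. The functional vanishes at its
  generating point, which lies in both polytopes, so every entry is tight for \<open>g'\<close>.
  Block 0 has only the empty ideal and is treated apart.\<close>

lemma cell_Q_inj:
  assumes g: "supporting g" and g': "supporting g'" and eq: "cell_Q g = cell_Q g'"
  shows "cell g = cell g'"
proof (rule cell_mono_eq[OF g g'], rule subsetI)
  fix J assume J: "J \<in> cell g"
  then have JL: "J \<in> L" using cell_subset[OF g] by blast
  obtain i where i: "i \<le> l" "in_block i J" using ex_block[OF JL] by blast
  show "J \<in> cell g'"
  proof (cases "i = 0")
    case True
    then show ?thesis using i(2) block_0[OF JL] cell_empty[OF g'] by simp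
  next
    case False
    let ?J = "\<lambda>j. if j = i then J else marked_poset.down (cell_order (cell g)) (mk j)"
    have t: "?J \<in> cell_tuples g"
      by (rule marked_poset.ex_tuple[OF marked_poset_cell[OF g]])
        (use J i False order_ideals_cell_order[OF g] in auto)
    then have "vertex ?J \<in> cell_Q g" unfolding cell_Q_eq_hull[OF g] by (intro hull_inc imageI)
    then have "vertex ?J \<in> cell_Q g \<inter> cell_Q g'" using eq by blast
    then have "height_diff g g' (vertex ?J) = 0" unfolding cell_Q_Int[OF g g'] by blast
    then have "?J \<in> cell_tuples g'" by (rule height_diff_zero_vertex[OF g g' t])
    then have "\<forall>j\<in>{1..l}. ?J j \<in> cell g' \<and> in_block j (?J j)" unfolding cell_tuples_iff[OF g'] .
    moreover have "i \<in> {1..l}" using i(1) False by simp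
    ultimately have "?J i \<in> cell g'" by blast
    then show ?thesis by simp
  qed
qed

lemma affine_dim_cell_Q: "supporting g \<Longrightarrow> affine_dim (cell_Q g) = affine_dim Q"
  by (rule affine_dim_eqI)
    (simp_all only: marked_poset.span_differences_Q[OF marked_poset_cell] span_differences_Q
      marked_poset.Q_ne[OF marked_poset_cell] Q_ne not_False_eq_True)

theorem polyhedral_subdivision_cells:
  "polyhedral_subdivision {cell_Q g | g. supporting g} Q"
  unfolding polyhedral_subdivision_def
proof (intro conjI ballI)
  let ?S = "{cell_Q g | g. supporting g}"
  fix C assume "C \<in> ?S"
  then obtain g where g: "supporting g" "C = cell_Q g" by blast
  show "polytope C" unfolding g(2) by (rule marked_poset.polytope_Q[OF marked_poset_cell[OF g(1)]])
  show "affine_dim C = affine_dim Q" unfolding g(2) by (rule affine_dim_cell_Q[OF g(1)])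
next
  show "\<Union>{cell_Q g | g. supporting g} = Q"
    using Q_covered cell_Q_subset by blast
next
  let ?S = "{cell_Q g | g. supporting g}"
  have finS: "finite ?S"
  proof -
    have "?S \<subseteq> (\<lambda>M. marked_polytope P Pm (cell_order M) marked_weight) ` cells"
      unfolding cells_def by blast
    then show ?thesis using finite_cells finite_subset by blast
  qed
  have fin_vert: "finite (vertex ` cell_tuples g)" if "supporting g" for g
    by (rule marked_poset.finite_vertices[OF marked_poset_cell[OF that]])
  show "polyhedral_complex {F. \<exists>C\<in>?S. F face_of C}"
    unfolding polyhedral_complex_def
  proof (intro conjI ballI allI impI)
    have "finite {F. F face_of C}" if "C \<in> ?S" for C
    proof -
      obtain g where g: "supporting g" "C = cell_Q g" using \<open>C \<in> ?S\<close> by blast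
      show ?thesis unfolding g(2) cell_Q_eq_hull[OF g(1)] by (rule finite_faces_convex_hull[OF fin_vert[OF g(1)]])
    qed
    then have "finite (\<Union>C\<in>?S. {F. F face_of C})" using finS by blast
    moreover have "{F. \<exists>C\<in>?S. F face_of C} = (\<Union>C\<in>?S. {F. F face_of C})" by blast
    ultimately show "finite {F. \<exists>C\<in>?S. F face_of C}" by simp
  next
    fix F assume "F \<in> {F. \<exists>C\<in>?S. F face_of C}"
    then obtain g where g: "supporting g" "F face_of cell_Q g" by blast
    show "polytope F"
      using face_of_convex_hull_polytope[OF fin_vert[OF g(1)]] g(2) unfolding cell_Q_eq_hull[OF g(1)] by blast
  next
    fix F G assume "F \<in> {F. \<exists>C\<in>?S. F face_of C}" "G face_of F"
    then show "G \<in> {F. \<exists>C\<in>?S. F face_of C}" using face_of_trans by blast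
  next
    \<comment> \<open>Both faces are first cut down to the common face of the two cells, where they
      are faces of one polytope and can be intersected.\<close>
    have half: "F \<inter> G face_of F"
      if g: "supporting g" "F face_of cell_Q g" and g': "supporting g'" "G face_of cell_Q g'" for F G g g'
    proof -
      let ?I = "cell_Q g \<inter> cell_Q g'"
      have I: "convex ?I" using cell_Q_Int_face[OF g(1) g'(1)] by (rule face_of_imp_convex)
      have "F \<inter> ?I face_of cell_Q g \<inter> ?I" by (rule face_of_slice[OF g(2) I])
      moreover have "cell_Q g \<inter> ?I = ?I" by blast
      ultimately have FI: "F \<inter> ?I face_of ?I" by (simp only:)
      have "G \<inter> ?I face_of cell_Q g' \<inter> ?I" by (rule face_of_slice[OF g'(2) I])
      moreover have "cell_Q g' \<inter> ?I = ?I" by blast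
      ultimately have "G \<inter> ?I face_of ?I" by (simp only:)
      with FI have "(F \<inter> ?I) \<inter> (G \<inter> ?I) face_of ?I" by (rule face_of_Int)
      moreover have "(F \<inter> ?I) \<inter> (G \<inter> ?I) = F \<inter> G"
        using face_of_imp_subset[OF g(2)] face_of_imp_subset[OF g'(2)] by blast
      ultimately have "F \<inter> G face_of ?I" by (simp only:)
      then have "F \<inter> G face_of cell_Q g" using cell_Q_Int_face[OF g(1) g'(1)] by (rule face_of_trans)
      then show ?thesis by (rule face_of_subset) (use face_of_imp_subset[OF g(2)] in blast)+
    qed
    fix F G assume "F \<in> {F. \<exists>C\<in>?S. F face_of C}" "G \<in> {F. \<exists>C\<in>?S. F face_of C}"
    then obtain g g' where *: "supporting g" "F face_of cell_Q g" "supporting g'" "G face_of cell_Q g'" by blast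
    show "F \<inter> G face_of F" by (rule half[OF *])
    show "F \<inter> G face_of G" using half[OF *(3,4,1,2)] by (simp add: Int_commute)
  qed
qed

end

section \<open>Initial degenerations of Hibi ideals\<close>

lemma lookup_initial_form:
  "Poly_Mapping.lookup (initial_form w p) m =
     (if m \<in> Poly_Mapping.keys p \<and> monom_weight w m = Min (monom_weight w ` Poly_Mapping.keys p)
      then Poly_Mapping.lookup p m else 0)"
proof -
  let ?S = "{m \<in> Poly_Mapping.keys p. monom_weight w m = Min (monom_weight w ` Poly_Mapping.keys p)}"
  have "Poly_Mapping.lookup (initial_form w p) m = (\<Sum>m'\<in>?S. if m' = m then Poly_Mapping.lookup p m' else 0)"
    unfolding initial_form_def lookup_sum lookup_single when_def by (rule sum.cong) auto
  also have "\<dots> = (if m \<in> ?S then Poly_Mapping.lookup p m else 0)"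
    by (rule sum.delta) simp
  finally show ?thesis by simp
qed

lemma keys_initial_form:
  "Poly_Mapping.keys (initial_form w p) =
     {m \<in> Poly_Mapping.keys p. monom_weight w m = Min (monom_weight w ` Poly_Mapping.keys p)}"
  by (auto simp: in_keys_iff lookup_initial_form split: if_splits)

lemma monom_weight_add: "monom_weight w (m + m') = monom_weight w m + monom_weight w m'"
  unfolding monom_weight_def by (rule setsum_keys_plus_distrib) (simp_all add: algebra_simps)

lemma monom_weight_monom_of: "monom_weight w (monom_of us) = (\<Sum>v\<leftarrow>us. w v)"
proof (induction us)
  case (Cons v us)
  have "monom_weight w (Poly_Mapping.single v 1) = w v" by (simp add: monom_weight_def)
  then show ?case using Cons unfolding monom_of_simps monom_weight_add by simp
qed (simp add: monom_weight_def)

lemma initial_form_in_initial_ideal: "f \<in> I \<Longrightarrow> initial_form w f \<in> initial_ideal w I"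
  unfolding initial_ideal_def lin_combs_def
  by (intro CollectI exI[of _ "{initial_form w f}"] exI[of _ "\<lambda>_. Const 1"])
    (auto simp: Const_def intro!: range_eqI[of _ _ 1])

lemma Var_mult: "Var u * Var v = Poly_Mapping.single (monom_of [u, v]) 1"
  by (simp add: Var_def mult_single)

lemma initial_form_binomial:
  assumes "monom_of us \<noteq> monom_of us'"
  defines "f \<equiv> Poly_Mapping.single (monom_of us) 1 - Poly_Mapping.single (monom_of us') (1::complex)"
  shows "(\<Sum>v\<leftarrow>us. w v) < (\<Sum>v\<leftarrow>us'. w v) \<Longrightarrow> initial_form w f = Poly_Mapping.single (monom_of us) 1"
    and "(\<Sum>v\<leftarrow>us. w v) = (\<Sum>v\<leftarrow>us'. w v) \<Longrightarrow> initial_form w f = f"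
    and "(\<Sum>v\<leftarrow>us'. w v) < (\<Sum>v\<leftarrow>us. w v) \<Longrightarrow> initial_form w f = - Poly_Mapping.single (monom_of us') 1"
proof -
  let ?m = "monom_of us" and ?m' = "monom_of us'"
  have lf: "Poly_Mapping.lookup f m = (if m = ?m then 1 else if m = ?m' then - 1 else 0)" for m
    using assms(1) by (auto simp: f_def lookup_minus lookup_single when_def)
  have keys: "Poly_Mapping.keys f = {?m, ?m'}"
    by (auto simp: in_keys_iff lf split: if_splits)
  have min: "Min (monom_weight w ` Poly_Mapping.keys f) = min (\<Sum>v\<leftarrow>us. w v) (\<Sum>v\<leftarrow>us'. w v)"
    unfolding keys by (simp add: monom_weight_monom_of)
  have li: "Poly_Mapping.lookup (initial_form w f) m =
      (if (m = ?m \<or> m = ?m') \<and> monom_weight w m = min (\<Sum>v\<leftarrow>us. w v) (\<Sum>v\<leftarrow>us'. w v)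
       then Poly_Mapping.lookup f m else 0)" for m
    unfolding lookup_initial_form min unfolding keys by simp
  show "(\<Sum>v\<leftarrow>us. w v) < (\<Sum>v\<leftarrow>us'. w v) \<Longrightarrow> initial_form w f = Poly_Mapping.single ?m 1"
    by (rule poly_mapping_eqI) (auto simp: li lf monom_weight_monom_of lookup_single when_def)
  show "(\<Sum>v\<leftarrow>us. w v) = (\<Sum>v\<leftarrow>us'. w v) \<Longrightarrow> initial_form w f = f"
    by (rule poly_mapping_eqI) (auto simp: li lf monom_weight_monom_of)
  show "(\<Sum>v\<leftarrow>us'. w v) < (\<Sum>v\<leftarrow>us. w v) \<Longrightarrow> initial_form w f = - Poly_Mapping.single ?m' 1"
    by (rule poly_mapping_eqI)
      (use assms(1) in \<open>auto simp: li lf monom_weight_monom_of lookup_single when_def\<close>)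
qed

text \<open>The ideal is known only through \<open>quadric\<close> and \<open>torus\<close>, an
  inner and an outer bound. \<open>\<beta>\<close> names the projective factor of each block, and
  \<open>w\<close> is the coordinate weight \<open>wt\<close> transported to order ideals.\<close>

locale hibi_degeneration = supermodular_poset P r l mk w
  for P :: "'a set" and r :: "'a rel" and l :: nat and mk :: "nat \<Rightarrow> 'a" and w :: "'a set \<Rightarrow> real" +
  fixes V :: "'v set" and bl :: "'v \<Rightarrow> 'b" and jj :: "'v \<Rightarrow> 'a set" and \<beta> :: "nat \<Rightarrow> 'b"
    and wt :: "'v \<Rightarrow> real" and I :: "'v cpoly set"
  assumes finV: "finite V" and jj: "bij_betw jj V L" and \<beta>: "inj_on \<beta> {0..l}"
    and bl: "\<And>v i. v \<in> V \<Longrightarrow> i \<le> l \<Longrightarrow> in_block i (jj v) \<Longrightarrow> bl v = \<beta> i"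
    and wt: "\<And>v. v \<in> V \<Longrightarrow> wt v = w (jj v)"
    and quadric: "\<And>u v. u \<in> V \<Longrightarrow> v \<in> V \<Longrightarrow> \<exists>u'\<in>V. \<exists>v'\<in>V. jj u' = jj u \<inter> jj v \<and> jj v' = jj u \<union> jj v \<and>
      Var u * Var v - Var u' * Var v' \<in> I"
    and torus: "\<And>f t. f \<in> I \<Longrightarrow> (\<forall>i. t i \<noteq> 0) \<Longrightarrow>
      poly_eval (torus_point V (P <+> bl ` V) (multideg bl (\<lambda>v p. of_bool (p \<in> jj v))) t) f = 0"
begin

abbreviation ideal_deg :: "'v \<Rightarrow> 'a \<Rightarrow> nat" where "ideal_deg \<equiv> \<lambda>v p. of_bool (p \<in> jj v)"
abbreviation "index \<equiv> P <+> bl ` V"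
abbreviation "mdeg \<equiv> multideg bl ideal_deg"

definition cell_vars :: "'a set set \<Rightarrow> 'v set" where
  "cell_vars M = {v \<in> V. jj v \<in> M}"

definition cell_locus :: "'a set set \<Rightarrow> ('v \<Rightarrow> complex) set set" where
  "cell_locus M = toric_locus V bl (cell_vars M) P ideal_deg"

lemma jj_L: "v \<in> V \<Longrightarrow> jj v \<in> L"
  using jj unfolding bij_betw_def by blast

lemma jj_inj: "u \<in> V \<Longrightarrow> v \<in> V \<Longrightarrow> jj u = jj v \<Longrightarrow> u = v"
  using jj unfolding bij_betw_def inj_on_def by blast

lemma ex_var:
  assumes "J \<in> L" shows "\<exists>v\<in>V. jj v = J"
proof -
  have "J \<in> jj ` V" using assms bij_betw_imp_surj_on[OF jj] by simp
  then show ?thesis by auto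
qed

lemma cell_vars_subset: "cell_vars M \<subseteq> V"
  unfolding cell_vars_def by blast

lemma V_ne: "V \<noteq> {}"
  using ex_var[OF empty_L] by blast

lemma finite_index: "finite index"
  using finP finV by simp

lemma count_in_map_jj: "count_in (map jj us) p = (\<Sum>v\<leftarrow>us. ideal_deg v p)"
  by (simp add: count_in_def comp_def)

lemma mdeg_eqD:
  assumes "set us \<subseteq> V" "set us' \<subseteq> V" "\<forall>i\<in>index. (\<Sum>v\<leftarrow>us. mdeg v i) = (\<Sum>v\<leftarrow>us'. mdeg v i)"
  shows "count_in (map jj us) p = count_in (map jj us') p" "length us = length us'"
proof -
  show "count_in (map jj us) p = count_in (map jj us') p"
  proof (cases "p \<in> P")
    case True
    from bspec[OF assms(3) InlI[OF True]] show ?thesis unfolding count_in_map_jj multideg_simps .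
  next
    case False
    have zero: "count_in (map jj xs) p = 0" if "set xs \<subseteq> V" for xs
      using that False jj_L L_subset by (induction xs) auto
    show ?thesis unfolding zero[OF assms(1)] zero[OF assms(2)] ..
  qed
  have "count (mset (map bl us)) b = count (mset (map bl us')) b" for b
  proof (cases "b \<in> bl ` V")
    case True
    from bspec[OF assms(3) InrI[OF True]] show ?thesis
      unfolding count_map_block_deg multideg_simps .
  next
    case False
    then have "b \<notin># mset (map bl us)" "b \<notin># mset (map bl us')" using assms(1,2) by auto
    then show ?thesis by (simp only: not_in_iff)
  qed
  then have "mset (map bl us) = mset (map bl us')" by (rule multiset_eqI)
  from mset_eq_length[OF this] show "length us = length us'" by simp
qed

text \<open>The degrees of a monomial give its length and its element counts, which are the
  hypotheses of the straightening argument, so quadrics within the cell suffice for all toric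
  equations.\<close>

lemma toric_vec_if_quadrics:
  assumes g: "supporting g" and off: "\<And>v. v \<notin> cell_vars (cell g) \<Longrightarrow> x v = (0::complex)"
    and quad: "\<And>u v u' v'. \<lbrakk>u \<in> V; v \<in> V; u' \<in> V; v' \<in> V; jj u \<in> cell g; jj v \<in> cell g;
      jj u' = jj u \<inter> jj v; jj v' = jj u \<union> jj v\<rbrakk> \<Longrightarrow> x u * x v = x u' * x v'"
  shows "toric_vec (cell_vars (cell g)) index mdeg x"
  unfolding toric_vec_def
proof (intro conjI allI impI)
  show "v \<notin> cell_vars (cell g) \<Longrightarrow> x v = 0" for v by (rule off)
  fix us us' assume us: "set us \<subseteq> cell_vars (cell g)" "set us' \<subseteq> cell_vars (cell g)"
    "\<forall>i\<in>index. (\<Sum>v\<leftarrow>us. mdeg v i) = (\<Sum>v\<leftarrow>us'. mdeg v i)"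
  define F where "F J = x (inv_into V jj J)" for J
  have inv: "inv_into V jj (jj v) = v" if "v \<in> V" for v
    using that jj unfolding bij_betw_def by (intro inv_into_f_f) auto
  have F_eq: "map F (map jj xs) = map x xs" if "set xs \<subseteq> cell_vars (cell g)" for xs
    using that inv by (auto simp: F_def cell_vars_def)
  have usV: "set us \<subseteq> V" "set us' \<subseteq> V" using us(1,2) cell_vars_subset by blast+
  note d = mdeg_eqD[OF usV us(3)]
  have "prod_list (map F (map jj us)) = prod_list (map F (map jj us'))"
  proof (rule prod_eq_if_count_eq[where M="cell g"])
    show "set (map jj us) \<subseteq> cell g" "set (map jj us') \<subseteq> cell g"
      using us(1,2) unfolding cell_vars_def by auto
    show "length (map jj us) = length (map jj us')" using d(2) by simp
    show "count_in (map jj us) p = count_in (map jj us') p" for p by (rule d(1))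
    show "J \<inter> J' \<in> cell g" "J \<union> J' \<in> cell g" if "J \<in> cell g" "J' \<in> cell g" for J J'
      using cell_Int_Un[OF g that] by blast+
    show "F J * F J' = F (J \<inter> J') * F (J \<union> J')" if J: "J \<in> cell g" "J' \<in> cell g" for J J'
    proof -
      note IU = cell_Int_Un[OF g J]
      have inv': "inv_into V jj K \<in> V" "jj (inv_into V jj K) = K" if "K \<in> cell g" for K
      proof -
        have "K \<in> jj ` V" using that cell_subset[OF g] jj unfolding bij_betw_def by blast
        then show "inv_into V jj K \<in> V" "jj (inv_into V jj K) = K"
          by (rule inv_into_into, rule f_inv_into_f)
      qed
      show ?thesis unfolding F_def
        by (rule quad) (simp_all add: inv' J IU)
    qed
  qed
  then show "prod_list (map x us) = prod_list (map x us')"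
    unfolding F_eq[OF us(1)] F_eq[OF us(2)] .
qed

section \<open>The zero set of the initial ideal as a union of cell loci\<close>

abbreviation "degeneration \<equiv> zero_set V bl (initial_ideal wt I)"

text \<open>The right-hand side involves only length and element counts, so the majorant is constant
  on each multidegree.\<close>

lemma sum_list_lin:
  assumes "set us \<subseteq> V"
  shows "(\<Sum>v\<leftarrow>us. lin g (jj v)) = real (length us) * w {} + (\<Sum>p\<in>P. g p * real (count_in (map jj us) p))"
  using assms
proof (induction us)
  case (Cons v us)
  have "sum g (jj v) = (\<Sum>p\<in>P. g p * of_bool (p \<in> jj v))"
    by (rule sum.mono_neutral_cong_left) (use finP L_subset[OF jj_L, of v] Cons.prems in auto)
  moreover have "(\<Sum>p\<in>P. g p * real (count_in (map jj (v # us)) p)) =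
      (\<Sum>p\<in>P. g p * of_bool (p \<in> jj v)) + (\<Sum>p\<in>P. g p * real (count_in (map jj us) p))"
    unfolding sum.distrib[symmetric] by (rule sum.cong) (simp_all add: algebra_simps)
  ultimately show ?case using Cons by (simp add: lin_def algebra_simps)
qed simp

lemma sum_list_wt_le:
  assumes "supporting g" "set us \<subseteq> V"
  shows "(\<Sum>v\<leftarrow>us. wt v) \<le> (\<Sum>v\<leftarrow>us. lin g (jj v))"
  using assms(2) by (induction us) (auto simp: wt intro!: add_mono supporting_le[OF assms(1)] jj_L)

lemma sum_list_wt_eqD:
  assumes "supporting g" "set us \<subseteq> V" "(\<Sum>v\<leftarrow>us. wt v) = (\<Sum>v\<leftarrow>us. lin g (jj v))"
  shows "set us \<subseteq> cell_vars (cell g)"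
  using assms(2,3)
proof (induction us)
  case (Cons v us)
  have "wt v \<le> lin g (jj v)" using Cons.prems supporting_le[OF assms(1) jj_L, of v] wt by simp
  moreover have "(\<Sum>v\<leftarrow>us. wt v) \<le> (\<Sum>v\<leftarrow>us. lin g (jj v))"
    using Cons.prems by (intro sum_list_wt_le[OF assms(1)]) simp
  ultimately have "wt v = lin g (jj v)" "(\<Sum>v\<leftarrow>us. wt v) = (\<Sum>v\<leftarrow>us. lin g (jj v))"
    using Cons.prems(2) by simp_all
  then show ?case
    using Cons wt jj_L unfolding cell_vars_def cell_def by auto
qed simp

lemma sum_list_wt_cell:
  assumes "supporting g" "set us \<subseteq> cell_vars (cell g)"
  shows "(\<Sum>v\<leftarrow>us. wt v) = (\<Sum>v\<leftarrow>us. lin g (jj v))"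
  using assms(2) by (induction us) (auto simp: wt cell_vars_def cell_def)

text \<open>
  On each multidegree the weights of the monomials are bounded by a linear function of the degree,
  with equality for the monomials in the variables of the cell.  Hence an initial form either involves
  no such monomial of the given degree or contains the whole component of that degree.
\<close>

lemma fiber_sums_zero_initial_form:
  assumes f: "f \<in> I" and g: "supporting g"
  shows "fiber_sums_zero (cell_vars (cell g)) index mdeg (initial_form wt f)"
  unfolding fiber_sums_zero_def
proof
  fix m0
  let ?W = "cell_vars (cell g)"
  let ?A = "Poly_Mapping.keys (initial_form wt f) \<inter> fiber ?W index mdeg m0"
  show "(\<Sum>m\<in>?A. Poly_Mapping.lookup (initial_form wt f) m) = 0"
  proof (cases "?A = {}")
    case True
    show ?thesis unfolding True by (rule sum.empty)
  next
    case False
    then obtain m1 where m1: "m1 \<in> Poly_Mapping.keys (initial_form wt f)" "m1 \<in> fiber ?W index mdeg m0"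
      by blast
    let ?B = "Poly_Mapping.keys f \<inter> fiber V index mdeg m1"
    have min1: "monom_weight wt m1 = Min (monom_weight wt ` Poly_Mapping.keys f)"
      using m1(1) unfolding keys_initial_form by blast
    obtain us1 where us1: "m1 = monom_of us1" using ex_monom_of by blast
    have us1W: "set us1 \<subseteq> ?W" using m1(2) by (simp add: us1 fiber_def keys_monom_of)
    \<comment> \<open>The essential inclusion is from \<open>?B\<close> to \<open>?A\<close>. A term
      of \<open>f\<close> in this degree weighs at least as much as \<open>m1\<close>, which has
      minimal weight, and at most as much, since the majorant is the same on the whole degree and is
      attained at \<open>m1\<close>. Equality puts all its variables into the cell.\<close>
    have AB: "?A = ?B"
    proof (intro equalityI subsetI)
      fix m assume "m \<in> ?A"
      then have "m \<in> Poly_Mapping.keys f" "Poly_Mapping.keys m \<subseteq> V"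
        "\<forall>i\<in>index. monom_deg mdeg m i = monom_deg mdeg m0 i"
        unfolding keys_initial_form fiber_def using cell_vars_subset by blast+
      then show "m \<in> ?B" using m1(2) unfolding fiber_def by simp
    next
      fix m assume m: "m \<in> ?B"
      then obtain us where us: "m = monom_of us" using ex_monom_of by blast
      have usV: "set us \<subseteq> V" using m by (simp add: us fiber_def keys_monom_of)
      have us1V: "set us1 \<subseteq> V" using us1W cell_vars_subset by blast
      have deg: "\<forall>i\<in>index. (\<Sum>v\<leftarrow>us. mdeg v i) = (\<Sum>v\<leftarrow>us1. mdeg v i)"
        
      proof
        fix i assume "i \<in> index"
        then have "monom_deg mdeg m i = monom_deg mdeg m1 i" using m unfolding fiber_def by simp
        then show "(\<Sum>v\<leftarrow>us. mdeg v i) = (\<Sum>v\<leftarrow>us1. mdeg v i)" unfolding us us1 monom_deg_monom_of .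
      qed
      have "(\<Sum>v\<leftarrow>us. lin g (jj v)) = (\<Sum>v\<leftarrow>us1. lin g (jj v))"
        unfolding sum_list_lin[OF usV] sum_list_lin[OF us1V]
        using mdeg_eqD[OF usV us1V deg] by simp
      moreover have "monom_weight wt m1 \<le> monom_weight wt m"
        unfolding min1 using m by (intro Min_le) auto
      ultimately have "(\<Sum>v\<leftarrow>us. wt v) = (\<Sum>v\<leftarrow>us. lin g (jj v))"
        and eq: "monom_weight wt m = monom_weight wt m1"
        using sum_list_wt_le[OF g usV] sum_list_wt_cell[OF g us1W]
        unfolding us us1 monom_weight_monom_of by linarith+
      then have "set us \<subseteq> ?W" using sum_list_wt_eqD[OF g usV] by blast
      then have "m \<in> fiber ?W index mdeg m0"
        using m m1(2) by (simp add: fiber_def us keys_monom_of)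
      moreover have "m \<in> Poly_Mapping.keys (initial_form wt f)"
        using m eq min1 unfolding keys_initial_form by simp
      ultimately show "m \<in> ?A" by blast
    qed
    have "(\<Sum>m\<in>?A. Poly_Mapping.lookup (initial_form wt f) m) = (\<Sum>m\<in>?A. Poly_Mapping.lookup f m)"
    proof (rule sum.cong[OF refl])
      fix m assume "m \<in> ?A"
      then have "m \<in> Poly_Mapping.keys f \<and> monom_weight wt m = Min (monom_weight wt ` Poly_Mapping.keys f)"
        unfolding keys_initial_form by blast
      then show "Poly_Mapping.lookup (initial_form wt f) m = Poly_Mapping.lookup f m"
        unfolding lookup_initial_form by (rule if_P)
    qed
    also have "\<dots> = (\<Sum>m\<in>?B. Poly_Mapping.lookup f m)" unfolding AB ..
    also have "\<dots> = 0"
    proof -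
      \<comment> \<open>\<open>?B\<close> is a complete degree component of \<open>f\<close>, whose
        coefficients cancel because \<open>f\<close> vanishes on the whole torus.\<close>
      have "fiber_sums_zero V index mdeg f"
        by (rule fiber_sums_zero_of_torus_zero[OF finite_index]) (rule torus[OF f])
      then show ?thesis unfolding fiber_sums_zero_def by (rule spec)
    qed
    finally show ?thesis .
  qed
qed

lemma cell_locus_subset:
  assumes g: "supporting g"
  shows "cell_locus (cell g) \<subseteq> degeneration"
proof
  fix c assume c: "c \<in> cell_locus (cell g)"
  have "poly_eval x p = 0" if x: "x \<in> c" and p: "p \<in> initial_ideal wt I" for x p
  proof (rule poly_eval_lin_combs[OF p[unfolded initial_ideal_def]])
    fix h assume "h \<in> initial_form wt ` I"
    then obtain f where f: "f \<in> I" "h = initial_form wt f" by blast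
    have "toric_vec (cell_vars (cell g)) index mdeg x"
      using c x unfolding cell_locus_def toric_locus_def by blast
    from poly_eval_toric_vec[OF this fiber_sums_zero_initial_form[OF f(1) g]]
    show "poly_eval x h = 0" unfolding f(2) .
  qed
  then show "c \<in> degeneration"
    using c unfolding cell_locus_def toric_locus_def zero_set_def by blast
qed

text \<open>The initial form of the Hibi binomial is its first monomial if that one is strictly
  lighter, and the whole binomial if the weights agree.\<close>

lemma degeneration_quadric:
  assumes x: "\<forall>p\<in>initial_ideal wt I. poly_eval x p = 0"
    and uv: "u \<in> V" "v \<in> V"
  shows "\<exists>u'\<in>V. \<exists>v'\<in>V. jj u' = jj u \<inter> jj v \<and> jj v' = jj u \<union> jj v \<and>
    (w (jj u) + w (jj v) < w (jj u \<inter> jj v) + w (jj u \<union> jj v) \<longrightarrow> x u * x v = 0) \<and>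
    (w (jj u) + w (jj v) = w (jj u \<inter> jj v) + w (jj u \<union> jj v) \<longrightarrow> x u * x v = x u' * x v')"
proof -
  from quadric[OF uv] obtain u' v' where uv': "u' \<in> V" "v' \<in> V" "jj u' = jj u \<inter> jj v" "jj v' = jj u \<union> jj v"
    and f: "Var u * Var v - Var u' * Var v' \<in> I" by blast
  let ?f = "Poly_Mapping.single (monom_of [u, v]) 1 - Poly_Mapping.single (monom_of [u', v']) (1::complex)"
  have fI: "?f \<in> I" using f unfolding Var_mult .
  have zero: "poly_eval x (initial_form wt ?f) = 0"
    by (rule bspec[OF x initial_form_in_initial_ideal[OF fI]])
  have ev: "monom_eval x (monom_of [a, b]) = x a * x b" for a b
    unfolding monom_eval_monom_of by simp
  have wts: "(\<Sum>v\<leftarrow>[u, v]. wt v) = w (jj u) + w (jj v)"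
    "(\<Sum>v\<leftarrow>[u', v']. wt v) = w (jj u \<inter> jj v) + w (jj u \<union> jj v)"
    using uv uv' by (simp_all add: wt)
  show ?thesis
  proof (rule bexI[OF _ uv'(1)], rule bexI[OF _ uv'(2)], intro conjI impI uv'(3,4))
    assume lt: "w (jj u) + w (jj v) < w (jj u \<inter> jj v) + w (jj u \<union> jj v)"
    have ne: "monom_of [u, v] \<noteq> monom_of [u', v']"
    proof
      assume "monom_of [u, v] = monom_of [u', v']"
      then have "monom_weight wt (monom_of [u, v]) = monom_weight wt (monom_of [u', v'])" by (rule arg_cong)
      then show False using lt unfolding monom_weight_monom_of wts by simp
    qed
    have "initial_form wt ?f = Poly_Mapping.single (monom_of [u, v]) 1"
      by (rule initial_form_binomial(1)[OF ne]) (simp only: wts lt)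
    with zero show "x u * x v = 0" unfolding poly_eval_ring_hom(7)[of x] by (simp only: ev poly_eval_ring_hom(7) mult_1)
  next
    assume eq: "w (jj u) + w (jj v) = w (jj u \<inter> jj v) + w (jj u \<union> jj v)"
    show "x u * x v = x u' * x v'"
    \<comment> \<open>For comparable ideals the two monomials coincide and the binomial is zero, so
      its initial form says nothing; the equation is then trivial.\<close>
    proof (cases "monom_of [u, v] = monom_of [u', v']")
      case True
      then have "monom_eval x (monom_of [u, v]) = monom_eval x (monom_of [u', v'])" by (rule arg_cong)
      then show ?thesis unfolding ev .
    next
      case False
      have "initial_form wt ?f = ?f"
        by (rule initial_form_binomial(2)[OF False]) (simp only: wts eq)
      with zero have "poly_eval x ?f = 0" by (simp only:)
      then show ?thesis by (simp only: poly_eval_ring_hom(3,7) ev mult_1 right_minus_eq)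
    qed
  qed
qed

text \<open>The vanishing conditions make the support closed under meets and joins and
  \<open>w\<close> modular on it; this keeps sorting inside the support and preserves the total
  weight.\<close>

lemma degeneration_support:
  assumes x: "\<forall>p\<in>initial_ideal wt I. poly_eval x p = 0"
  shows "\<exists>g. supporting g \<and> {v \<in> V. x v \<noteq> 0} \<subseteq> cell_vars (cell g)"
proof -
  define S where "S = jj ` {v \<in> V. x v \<noteq> 0}"
  have SL: "S \<subseteq> L" unfolding S_def using jj_L by blast
  have S: "J \<inter> J' \<in> S \<and> J \<union> J' \<in> S \<and> w J + w J' = w (J \<inter> J') + w (J \<union> J')" if JS: "J \<in> S" "J' \<in> S" for J J'
  proof -
    obtain u v where uv: "u \<in> V" "v \<in> V" "x u \<noteq> 0" "x v \<noteq> 0" "jj u = J" "jj v = J'"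
      using JS unfolding S_def by blast
    from degeneration_quadric[OF x uv(1,2)] obtain u' v' where
      uv': "u' \<in> V" "v' \<in> V" "jj u' = J \<inter> J'" "jj v' = J \<union> J'"
      and lt: "w J + w J' < w (J \<inter> J') + w (J \<union> J') \<longrightarrow> x u * x v = 0"
      and eq: "w J + w J' = w (J \<inter> J') + w (J \<union> J') \<longrightarrow> x u * x v = x u' * x v'"
      unfolding uv(5,6) by (elim bexE conjE)
    have "w J + w J' \<le> w (J \<inter> J') + w (J \<union> J')"
      using SL JS by (intro supermodular) blast+
    moreover have "\<not> w J + w J' < w (J \<inter> J') + w (J \<union> J')" using lt uv(3,4) by auto
    ultimately have e: "w J + w J' = w (J \<inter> J') + w (J \<union> J')" by simp
    then have "x u' \<noteq> 0" "x v' \<noteq> 0" using mp[OF eq e] uv(3,4) by auto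
    then show ?thesis using e uv' unfolding S_def by blast
  qed
  have "finite S" unfolding S_def using finV by simp
  then obtain Js where Js: "set Js = S" using finite_list by blast
  define Cs where "Cs = chain_sort Js"
  \<comment> \<open>The exponential puts the additive weights into the multiplicative form in which
    the sorting lemma is stated.\<close>
  have "prod_list (map (\<lambda>J. exp (w J)) Cs) = prod_list (map (\<lambda>J. exp (w J)) Js)"
    unfolding Cs_def
  proof (rule prod_chain_sort[where M=S])
    show "J \<inter> J' \<in> S" "J \<union> J' \<in> S" if "J \<in> S" "J' \<in> S" for J J' using S[OF that] by blast+
    show "exp (w J) * exp (w J') = exp (w (J \<inter> J')) * exp (w (J \<union> J'))" if "J \<in> S" "J' \<in> S" for J J'
      using S[OF that] by (simp flip: exp_add)
  qed (use Js in simp)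
  moreover have "prod_list (map (\<lambda>J. exp (w J)) Ks) = exp (\<Sum>J\<leftarrow>Ks. w J)" for Ks
    by (induction Ks) (simp_all add: exp_add)
  ultimately have sum_w: "(\<Sum>J\<leftarrow>Cs. w J) = (\<Sum>J\<leftarrow>Js. w J)" by simp
  \<comment> \<open>Closure under sorting concerns the sets alone; a constant function satisfies the
    multiplicativity assumption of the context.\<close>
  have CsS: "set Cs \<subseteq> S"
    unfolding Cs_def by (rule chain_sort_M[where F="\<lambda>_. 1 :: nat"]) (use S Js in auto)
  have sorted: "sorted_wrt (\<supseteq>) Cs" unfolding Cs_def by (rule sorted_chain_sort)
  have "\<exists>g. supporting g \<and> (\<forall>t. {p \<in> P. t \<le> real (count_in Cs p)} \<in> cell g)"
  proof (rule ex_cell_levels)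
    fix p q assume pq: "(p, q) \<in> r"
    have "set Cs \<subseteq> L" using CsS SL by blast
    then have "count_in Cs q \<le> count_in Cs p"
      using L_down[OF _ pq] by (induction Cs) (auto intro!: add_mono)
    then show "real (count_in Cs q) \<le> real (count_in Cs p)" by simp
  qed
  then obtain g where g: "supporting g" "\<forall>t. {p \<in> P. t \<le> real (count_in Cs p)} \<in> cell g" by (elim exE conjE)
  have CsM: "C \<in> cell g" if C: "C \<in> set Cs" for C
  proof -
    obtain t where t: "C = {p. t \<le> count_in Cs p}" using chain_levels[OF sorted C] by blast
    have "C \<subseteq> P" using C CsS SL L_subset by blast
    then have "C = {p \<in> P. real t \<le> real (count_in Cs p)}" using t by auto
    also have "\<dots> \<in> cell g" using g(2) by (rule spec)
    finally show ?thesis .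
  qed
  obtain us where us: "set us \<subseteq> V" "map jj us = Js"
  proof -
    have "\<exists>us. set us \<subseteq> V \<and> map jj us = Ks" if "set Ks \<subseteq> S" for Ks
      using that
    proof (induction Ks)
      case (Cons K Ks)
      then obtain us v where "set us \<subseteq> V" "map jj us = Ks" "v \<in> V" "jj v = K"
        unfolding S_def by auto
      then show ?case by (intro exI[of _ "v # us"]) simp
    qed simp
    from this[of Js] show thesis using that Js by blast
  qed
  obtain cs where cs: "set cs \<subseteq> V" "map jj cs = Cs"
  proof -
    have "\<exists>us. set us \<subseteq> V \<and> map jj us = Ks" if "set Ks \<subseteq> S" for Ks
      using that
    proof (induction Ks)
      case (Cons K Ks)
      then obtain us v where "set us \<subseteq> V" "map jj us = Ks" "v \<in> V" "jj v = K"
        unfolding S_def by auto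
      then show ?case by (intro exI[of _ "v # us"]) simp
    qed simp
    from this[of Cs] show thesis using that CsS by blast
  qed
  have wt_w: "(\<Sum>v\<leftarrow>xs. wt v) = (\<Sum>J\<leftarrow>map jj xs. w J)" if "set xs \<subseteq> V" for xs
    using that by (induction xs) (auto simp: wt)
  have "length us = length cs"
    using length_chain_sort[of Js] us(2) cs(2) unfolding Cs_def by (metis length_map)
  moreover have "count_in (map jj us) p = count_in (map jj cs) p" for p
    unfolding us(2) cs(2) Cs_def count_in_chain_sort ..
  ultimately have lin_eq: "(\<Sum>v\<leftarrow>us. lin g (jj v)) = (\<Sum>v\<leftarrow>cs. lin g (jj v))"
    unfolding sum_list_lin[OF us(1)] sum_list_lin[OF cs(1)] by simp
  have "set cs \<subseteq> cell_vars (cell g)"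
    using CsM cs unfolding cell_vars_def by auto
  \<comment> \<open>Sorting changes neither the total weight nor the total majorant. Their equality
    on the sorted chain thus returns to the original list, where termwise domination makes every
    entry tight.\<close>
  then have "(\<Sum>v\<leftarrow>us. wt v) = (\<Sum>v\<leftarrow>us. lin g (jj v))"
    unfolding lin_eq sum_list_wt_cell[OF g(1), symmetric] wt_w[OF us(1)] us(2) sum_w[symmetric]
    using wt_w[OF cs(1)] sum_list_wt_cell[OF g(1), of cs] unfolding cs(2) by simp
  from sum_list_wt_eqD[OF g(1) us(1) this] have usW: "set us \<subseteq> cell_vars (cell g)" .
  have "{v \<in> V. x v \<noteq> 0} \<subseteq> cell_vars (cell g)"
  proof
    fix v assume v: "v \<in> {v \<in> V. x v \<noteq> 0}"
    then have "jj v \<in> set (map jj us)" unfolding us(2) Js S_def by blast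
    then obtain u where "u \<in> set us" "jj u = jj v" by auto
    then have "u = v" using us(1) v jj_inj[of u v] by blast
    then show "v \<in> cell_vars (cell g)" using \<open>u \<in> set us\<close> usW by blast
  qed
  then show ?thesis using g(1) by blast
qed

lemma degeneration_covered:
  assumes "c \<in> degeneration"
  shows "\<exists>g. supporting g \<and> c \<in> cell_locus (cell g)"
proof -
  have "c \<in> mproj V bl" using assms unfolding zero_set_def by blast
  then obtain x where x: "x \<in> mproj_vec V bl" "x \<in> c" "c = proj_class V bl x" by (rule mprojE)
  have zero: "\<forall>p\<in>initial_ideal wt I. poly_eval x p = 0"
    using assms x(2) unfolding zero_set_def by blast
  obtain g where g: "supporting g" and supp: "{v \<in> V. x v \<noteq> 0} \<subseteq> cell_vars (cell g)"
    using degeneration_support[OF zero] by blast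
  have "toric_vec (cell_vars (cell g)) index mdeg x"
  proof (rule toric_vec_if_quadrics[OF g])
    fix v assume v: "v \<notin> cell_vars (cell g)"
    show "x v = 0"
    proof (cases "v \<in> V")
      case True
      then show ?thesis using v supp by blast
    next
      case False
      then show ?thesis using x(1) unfolding mproj_vec_def by blast
    qed
  next
    fix u v u' v' assume *: "u \<in> V" "v \<in> V" "u' \<in> V" "v' \<in> V" "jj u \<in> cell g" "jj v \<in> cell g"
      "jj u' = jj u \<inter> jj v" "jj v' = jj u \<union> jj v"
    from degeneration_quadric[OF zero *(1,2)] obtain u'' v'' where
      **: "u'' \<in> V" "v'' \<in> V" "jj u'' = jj u \<inter> jj v" "jj v'' = jj u \<union> jj v"
      and eq: "w (jj u) + w (jj v) = w (jj u \<inter> jj v) + w (jj u \<union> jj v) \<longrightarrow> x u * x v = x u'' * x v''"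
      by (elim bexE conjE)
    have "u'' = u'" by (rule jj_inj[OF **(1) *(3) trans[OF **(3) *(7)[symmetric]]])
    moreover have "v'' = v'" by (rule jj_inj[OF **(2) *(4) trans[OF **(4) *(8)[symmetric]]])
    ultimately show "x u * x v = x u' * x v'" using mp[OF eq cell_modular[OF g *(5,6)]] by simp
  qed
  then have "c \<in> cell_locus (cell g)"
    unfolding cell_locus_def x(3) proj_class_in_toric_locus_iff(1)[OF finV finP cell_vars_subset x(1)] .
  then show ?thesis using g by blast
qed

lemma degeneration_eq: "degeneration = \<Union>(cell_locus ` cells)"
proof (intro equalityI subsetI)
  fix c assume "c \<in> degeneration"
  then show "c \<in> \<Union>(cell_locus ` cells)"
    using degeneration_covered unfolding cells_def by blast
next
  fix c assume "c \<in> \<Union>(cell_locus ` cells)"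
  then show "c \<in> degeneration" using cell_locus_subset unfolding cells_def by blast
qed

text \<open>Principal ideals of the marked elements in the cell order, together with the empty
  ideal, supply an ideal of the cell in each block.\<close>

lemma cell_hit:
  assumes g: "supporting g" and b: "b \<in> bl ` V"
  shows "\<exists>v\<in>cell_vars (cell g). bl v = b"
proof -
  obtain v0 where v0: "v0 \<in> V" "bl v0 = b" using b by blast
  obtain i where i: "i \<le> l" "in_block i (jj v0)" using ex_block[OF jj_L[OF v0(1)]] by blast
  have "\<exists>J\<in>cell g. in_block i J"
  proof (cases "i = 0")
    case True
    then show ?thesis using cell_empty[OF g] by (auto simp: in_block_def)
  next
    case False
    have "marked_poset.down (cell_order (cell g)) (mk i) \<in> order_ideals P (cell_order (cell g))"
      by (rule marked_poset.down_L[OF marked_poset_cell[OF g]])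
    moreover have "in_block i (marked_poset.down (cell_order (cell g)) (mk i))"
      by (rule marked_poset.down_mk_block[OF marked_poset_cell[OF g]]) (use i False in auto)
    ultimately show ?thesis unfolding order_ideals_cell_order[OF g] by blast
  qed
  then obtain J where J: "J \<in> cell g" "in_block i J" by blast
  then obtain v where v: "v \<in> V" "jj v = J" using ex_var cell_subset[OF g] by blast
  then have "bl v = b" using bl[OF v(1) i(1)] bl[OF v0(1) i] v0(2) J(2) by simp
  then show ?thesis using v J(1) unfolding cell_vars_def by blast
qed

text \<open>The point of the locus with parameter \<open>t = 1\<close> has all coordinates of its
  cell equal to 1; inclusion in the other locus requires these coordinates to belong to the other
  cell.\<close>

lemma cell_locus_mono_eq:
  assumes g: "supporting g" "supporting g'" and sub: "cell_locus (cell g) \<subseteq> cell_locus (cell g')"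
  shows "cell g = cell g'"
proof (rule cell_mono_eq[OF g], rule subsetI)
  fix J assume J: "J \<in> cell g"
  then obtain v where v: "v \<in> V" "jj v = J" using ex_var cell_subset[OF g(1)] by blast
  let ?x = "torus_point (cell_vars (cell g)) index mdeg (\<lambda>_. 1)"
  have x: "?x \<in> mproj_vec V bl"
    by (rule torus_point_in_mproj_vec[OF finV finP cell_vars_subset]) (use cell_hit[OF g(1)] in auto)
  have "proj_class V bl ?x \<in> cell_locus (cell g)"
    unfolding cell_locus_def
    by (rule torus_point_in_toric_locus[OF finV finP cell_vars_subset]) (use cell_hit[OF g(1)] in auto)
  then have "proj_class V bl ?x \<in> toric_locus V bl (cell_vars (cell g')) P ideal_deg"
    using sub unfolding cell_locus_def by blast
  then have "toric_vec (cell_vars (cell g')) index mdeg ?x"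
    unfolding proj_class_in_toric_locus_iff(1)[OF finV finP cell_vars_subset x] .
  moreover have "v \<in> cell_vars (cell g)" using v J unfolding cell_vars_def by blast
  then have "?x v \<noteq> 0" unfolding torus_point_def by simp
  ultimately have "v \<in> cell_vars (cell g')" using toric_vec_off[of _ _ _ ?x v] by blast
  then show "J \<in> cell g'" using v(2) unfolding cell_vars_def by blast
qed

lemma cell_locus_inj: "inj_on cell_locus cells"
proof (rule inj_onI)
  fix M M' assume "M \<in> cells" "M' \<in> cells" and eq: "cell_locus M = cell_locus M'"
  then obtain g g' where g: "supporting g" "M = cell g" "supporting g'" "M' = cell g'"
    unfolding cells_def by blast
  show "M = M'" unfolding g(2,4) by (rule cell_locus_mono_eq[OF g(1,3)]) (use eq g in simp)
qed

theorem irreducible_components_degeneration: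
  "irreducible_components V bl degeneration = cell_locus ` cells"
  unfolding degeneration_eq
proof (rule irreducible_components_Union[OF finV])
  show "finite (cell_locus ` cells)" using finite_cells by simp
  fix Z assume "Z \<in> cell_locus ` cells"
  then obtain g where g: "supporting g" "Z = cell_locus (cell g)" unfolding cells_def by blast
  show "zariski_closed V bl Z"
    unfolding g(2) cell_locus_def by (rule zariski_closed_toric_locus[OF finV finP cell_vars_subset])
  show "zariski_irreducible V bl Z"
    unfolding g(2) cell_locus_def
    by (rule zariski_irreducible_toric_locus[OF finV finP cell_vars_subset]) (rule cell_hit[OF g(1)])
  fix Z' assume "Z' \<in> cell_locus ` cells" "Z \<subseteq> Z'"
  then obtain g' where g': "supporting g'" "Z' = cell_locus (cell g')" unfolding cells_def by blast
  show "Z = Z'"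
    unfolding g(2) g'(2) using cell_locus_mono_eq[OF g(1) g'(1)] \<open>Z \<subseteq> Z'\<close> g(2) g'(2) by simp
qed

section \<open>Irreducible components as toric varieties of polytopes\<close>

lemma lattice_exponent_int_ind:
  fixes e :: "'a \<Rightarrow> 'q"
  assumes "inj e" "v \<in> V"
  shows "lattice_exponent (int_ind e (jj v)) (e p) = ideal_deg v p"
  using lookup_int_ind[OF L_finite[OF jj_L[OF assms(2)]] assms(1), of p] by (simp add: lattice_exponent_def)

lemma cell_locus_lattice:
  fixes e :: "'a \<Rightarrow> 'q"
  assumes "inj e"
  shows "toric_locus V bl (cell_vars M) (e ` P) (\<lambda>v. lattice_exponent (int_ind e (jj v))) = cell_locus M"
proof -
  let ?E = "multideg bl (\<lambda>v. lattice_exponent (int_ind e (jj v)))"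
  have eq: "(\<Sum>v\<leftarrow>us. lattice_exponent (int_ind e (jj v)) (e p)) = (\<Sum>v\<leftarrow>us. ideal_deg v p)"
    if "set us \<subseteq> cell_vars M" for us p
    using that lattice_exponent_int_ind[OF assms] cell_vars_subset[of M]
    by (intro arg_cong[where f=sum_list] map_cong refl) blast
  have iff: "(\<forall>i\<in>e ` P <+> bl ` V. (\<Sum>v\<leftarrow>us. ?E v i) = (\<Sum>v\<leftarrow>us'. ?E v i)) \<longleftrightarrow>
      (\<forall>i\<in>index. (\<Sum>v\<leftarrow>us. mdeg v i) = (\<Sum>v\<leftarrow>us'. mdeg v i))"
    if us: "set us \<subseteq> cell_vars M" "set us' \<subseteq> cell_vars M" for us us'
  proof -
    have "(\<forall>i\<in>A <+> B. Q i) \<longleftrightarrow> (\<forall>a\<in>A. Q (Inl a)) \<and> (\<forall>b\<in>B. Q (Inr b))"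
      for A B and Q :: "'x + 'y \<Rightarrow> bool" by blast
    note split = this
    show ?thesis unfolding split multideg_simps ball_simps(9) eq[OF us(1)] eq[OF us(2)] ..
  qed
  have "toric_vec (cell_vars M) (e ` P <+> bl ` V) ?E x \<longleftrightarrow> toric_vec (cell_vars M) index mdeg x" for x
    unfolding toric_vec_def by (simp only: iff cong: imp_cong conj_cong)
  then show ?thesis unfolding cell_locus_def toric_locus_def by simp
qed

text \<open>A section of the locus chooses one ideal of the cell per block, so apart from block 0 it
  is a tuple, and its exponent is the lattice point of that tuple.\<close>

lemma isomorphic_cell_locus:
  fixes e :: "'a \<Rightarrow> 'q"
  assumes e: "inj e" and g: "supporting g"
  defines "A \<equiv> int_vertex e ` cell_tuples g"
  shows "finite A" "A \<noteq> {}"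
    "isomorphic_varieties V bl (cell_locus (cell g)) A (\<lambda>_. ()) (toric_closure A)"
proof -
  let ?W = "cell_vars (cell g)" and ?ev = "\<lambda>v. int_ind e (jj v)"
  have fin_jj: "finite (jj v)" if "v \<in> V" for v using L_finite[OF jj_L[OF that]] .
  interpret S: segre V bl ?W ?ev "e ` P"
  proof
    show "finite V" "finite (e ` P)" "?W \<subseteq> V" "V \<noteq> {}"
      using finV finP cell_vars_subset V_ne by auto
    show "\<exists>v\<in>?W. bl v = b" if "b \<in> bl ` V" for b by (rule cell_hit[OF g that])
    fix v assume v: "v \<in> ?W"
    then have vV: "v \<in> V" using cell_vars_subset by blast
    show "0 \<le> Poly_Mapping.lookup (int_ind e (jj v)) q" for q
      unfolding int_ind_def lookup_sum lookup_single when_def by (intro sum_nonneg) simp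
    show "Poly_Mapping.keys (int_ind e (jj v)) \<subseteq> e ` P"
    proof
      fix q assume "q \<in> Poly_Mapping.keys (int_ind e (jj v))"
      then have "q \<in> e ` jj v" using lookup_int_ind_notin[of q e "jj v"] by (auto simp: in_keys_iff)
      then show "q \<in> e ` P" using L_subset[OF jj_L[OF vV]] by blast
    qed
  qed
  have labels_eq: "bl ` V = \<beta> ` {0..l}"
  proof (intro equalityI subsetI)
    fix b assume "b \<in> bl ` V"
    then obtain v where v: "v \<in> V" "b = bl v" by blast
    obtain i where "i \<le> l" "in_block i (jj v)" using ex_block[OF jj_L[OF v(1)]] by blast
    then show "b \<in> \<beta> ` {0..l}" using bl[OF v(1)] v(2) by auto
  next
    fix b assume "b \<in> \<beta> ` {0..l}"
    then obtain i where i: "i \<le> l" "b = \<beta> i" by auto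
    have "\<exists>J\<in>L. in_block i J"
    proof (cases "i = 0")
      case True
      then show ?thesis using empty_L by (auto simp: in_block_def)
    next
      case False
      then show ?thesis using down_L down_mk_block[of i] i(1) by auto
    qed
    then obtain J where "J \<in> L" "in_block i J" by blast
    then obtain v where v: "v \<in> V" "in_block i (jj v)" using ex_var[of J] by auto
    from bl[OF v(1) i(1) v(2)] show "b \<in> bl ` V" unfolding i(2) using v(1) by (metis imageI)
  qed
  have sec_block: "in_block i (jj (u (\<beta> i)))" "jj (u (\<beta> i)) \<in> cell g" "u (\<beta> i) \<in> V"
    if u: "u \<in> S.sections" and i: "i \<le> l" for u i
  proof -
    have b: "\<beta> i \<in> bl ` V" using i unfolding labels_eq by simp
    have uW: "u (\<beta> i) \<in> ?W" "bl (u (\<beta> i)) = \<beta> i" using S.sectionsD[OF u b] .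
    then show uV: "u (\<beta> i) \<in> V" "jj (u (\<beta> i)) \<in> cell g" unfolding cell_vars_def by blast+
    obtain j where j: "j \<le> l" "in_block j (jj (u (\<beta> i)))" using ex_block[OF jj_L[OF uV(1)]] by blast
    then have "\<beta> j = \<beta> i" using bl[OF uV(1) j] uW(2) by simp
    then have "j = i" using inj_onD[OF \<beta>, of j i] i j(1) by simp
    then show "in_block i (jj (u (\<beta> i)))" using j(2) by simp
  qed
  have sum_eq: "S.section_sum u = int_vertex e (\<lambda>i. jj (u (\<beta> i)))" if u: "u \<in> S.sections" for u
  proof -
    have "S.section_sum u = (\<Sum>i\<in>{0..l}. int_ind e (jj (u (\<beta> i))))"
      unfolding S.section_sum_def labels_eq sum.reindex[OF \<beta>] comp_def ..
    also have "\<dots> = int_ind e (jj (u (\<beta> 0))) + (\<Sum>i\<in>{1..l}. int_ind e (jj (u (\<beta> i))))"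
      by (simp add: sum.atLeast_Suc_atMost)
    \<comment> \<open>The factor of block 0 carries only the empty ideal, so the sum over the labels
      of \<open>0..l\<close> reduces to the blocks \<open>1..l\<close> of
      \<open>int_vertex\<close>.\<close>
    also have "jj (u (\<beta> 0)) = {}"
      using sec_block[OF u, of 0] block_0[OF jj_L] by blast
    finally show ?thesis unfolding int_vertex_def int_ind_def by simp
  qed
  have A_eq: "S.segre_exponents = A"
  proof (intro equalityI subsetI)
    fix a assume "a \<in> S.segre_exponents"
    then obtain u where u: "u \<in> S.sections" "a = S.section_sum u" unfolding S.segre_exponents_def by blast
    have "(\<lambda>i. jj (u (\<beta> i))) \<in> cell_tuples g"
      unfolding cell_tuples_iff[OF g] using sec_block[OF u(1)] by auto
    then show "a \<in> A" unfolding A_def u(2) sum_eq[OF u(1)] by blast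
  next
    fix a assume "a \<in> A"
    then obtain J where J: "J \<in> cell_tuples g" "a = int_vertex e J" unfolding A_def by blast
    have JM: "J i \<in> cell g" "in_block i (J i)" if "1 \<le> i" "i \<le> l" for i
      using J(1) that unfolding cell_tuples_iff[OF g] by auto
    \<comment> \<open>Tuples start at block 1, whereas a section needs a coordinate in block 0 as
      well.\<close>
    define J' where "J' i = (if i = 0 then {} else J i)" for i
    have J': "J' i \<in> cell g" "in_block i (J' i)" if "i \<le> l" for i
      using JM[of i] that cell_empty[OF g] by (auto simp: J'_def in_block_def)
    define u where "u b = inv_into V jj (J' (inv_into {0..l} \<beta> b))" for b
    have u\<beta>: "jj (u (\<beta> i)) = J' i" "u (\<beta> i) \<in> V" if i: "i \<le> l" for i
    proof -
      have "inv_into {0..l} \<beta> (\<beta> i) = i" using \<beta> i by (intro inv_into_f_f) auto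
      moreover have "J' i \<in> jj ` V" using J'(1)[OF i] cell_subset[OF g] jj unfolding bij_betw_def by blast
      ultimately show "jj (u (\<beta> i)) = J' i" "u (\<beta> i) \<in> V"
        unfolding u_def using f_inv_into_f[of "J' i" jj V] inv_into_into[of "J' i" jj V] by simp_all
    qed
    have u: "u \<in> S.sections"
      unfolding S.sections_def labels_eq
    proof (intro CollectI ballI conjI)
      fix b assume "b \<in> \<beta> ` {0..l}"
      then obtain i where i: "i \<le> l" "b = \<beta> i" by auto
      show "u b \<in> ?W" using u\<beta>[OF i(1)] J'(1)[OF i(1)] unfolding cell_vars_def i(2) by simp
      show "bl (u b) = b" unfolding i(2) by (rule bl[OF u\<beta>(2)[OF i(1)] i(1)]) (use u\<beta>[OF i(1)] J'(2)[OF i(1)] in simp)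
    qed
    have "S.section_sum u = a"
      unfolding sum_eq[OF u] J(2) int_vertex_def by (rule sum.cong) (auto simp: u\<beta> J'_def)
    then show "a \<in> S.segre_exponents" unfolding S.segre_exponents_def using u by blast
  qed
  show "finite A" "A \<noteq> {}" using S.finite_A S.A_ne unfolding A_eq by blast+
  show "isomorphic_varieties V bl (cell_locus (cell g)) A (\<lambda>_. ()) (toric_closure A)"
    using S.isomorphic_toric_locus unfolding A_eq cell_locus_lattice[OF e] .
qed

text \<open>\<open>e\<close> serves only the notion of toric variety in \<open>semitoric\<close>,
  whose exponents are indexed by natural numbers; the comparison with the polytopes uses the
  identity in its place.\<close>

theorem degeneration_subdivision:
  fixes e :: "'a \<Rightarrow> nat"
  assumes "inj e"
  shows "\<exists>(m::nat) (s :: nat \<Rightarrow> 'a rel) Z.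
    (\<forall>i\<in>{1..m}. stronger_order P r (s i)) \<and>
    semitoric V bl degeneration \<and>
    bij_betw Z {1..m} (irreducible_components V bl degeneration) \<and>
    (\<forall>i\<in>{1..m}. isomorphic_to_toric_variety_of V bl (Z i) (marked_polytope P Pm (s i) marked_weight)) \<and>
    inj_on (\<lambda>i. marked_polytope P Pm (s i) marked_weight) {1..m} \<and>
    polyhedral_subdivision ((\<lambda>i. marked_polytope P Pm (s i) marked_weight) ` {1..m}) Q"
proof -
  obtain h where h: "bij_betw h {1..card cells} cells"
    using ex_bij_betw_nat_finite_1[OF finite_cells] by blast
  let ?m = "card cells" and ?s = "\<lambda>i. cell_order (h i)" and ?Z = "\<lambda>i. cell_locus (h i)"
  have hg: "\<exists>g. supporting g \<and> h i = cell g" if "i \<in> {1..?m}" for i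
    using bij_betwE[OF h] that unfolding cells_def by blast
  have "stronger_order P r (?s i)" if i: "i \<in> {1..?m}" for i
  proof -
    obtain g where g: "supporting g" "h i = cell g" using hg[OF i] by blast
    show ?thesis unfolding g(2) by (rule stronger_cell_order[OF g(1)])
  qed
  moreover have "semitoric V bl degeneration"
    unfolding semitoric_def irreducible_components_degeneration
  proof
    fix Z assume "Z \<in> cell_locus ` cells"
    then obtain g where g: "supporting g" "Z = cell_locus (cell g)" unfolding cells_def by blast
    show "toric_variety V bl Z"
      unfolding toric_variety_def g(2) using isomorphic_cell_locus[OF assms g(1)] by blast
  qed
  moreover have "bij_betw ?Z {1..?m} (irreducible_components V bl degeneration)"
  proof -
    have "bij_betw cell_locus cells (cell_locus ` cells)" using cell_locus_inj by (rule inj_on_imp_bij_betw)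
    from bij_betw_trans[OF h this] show ?thesis
      unfolding irreducible_components_degeneration comp_def .
  qed
  moreover have "isomorphic_to_toric_variety_of V bl (?Z i) (marked_polytope P Pm (?s i) marked_weight)"
    if i: "i \<in> {1..?m}" for i
  proof -
    obtain g where g: "supporting g" "h i = cell g" using hg[OF i] by blast
    have "inj (\<lambda>p::'a. p)" by simp
    from isomorphic_cell_locus(3)[OF this g(1)] show ?thesis
      unfolding isomorphic_to_toric_variety_of_def g(2)
        marked_poset.toric_exponents_Q[OF marked_poset_cell[OF g(1)]] .
  qed
  moreover have "inj_on (\<lambda>i. marked_polytope P Pm (?s i) marked_weight) {1..?m}"
  proof (rule inj_onI)
    fix i j assume ij: "i \<in> {1..?m}" "j \<in> {1..?m}"
      and eq: "marked_polytope P Pm (?s i) marked_weight = marked_polytope P Pm (?s j) marked_weight"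
    obtain g g' where g: "supporting g" "h i = cell g" and g': "supporting g'" "h j = cell g'"
      using hg[OF ij(1)] hg[OF ij(2)] by blast
    have "cell g = cell g'" by (rule cell_Q_inj[OF g(1) g'(1)]) (use eq g g' in simp)
    then have "h i = h j" using g g' by simp
    then show "i = j" by (rule inj_onD[OF bij_betw_imp_inj_on[OF h] _ ij])
  qed
  moreover have S_eq: "(\<lambda>i. marked_polytope P Pm (?s i) marked_weight) ` {1..?m} = {cell_Q g | g. supporting g}"
  proof -
    have "(\<lambda>i. marked_polytope P Pm (?s i) marked_weight) ` {1..?m} =
        (\<lambda>M. marked_polytope P Pm (cell_order M) marked_weight) ` h ` {1..?m}"
      by (simp only: image_image)
    also have "h ` {1..?m} = cells" using h by (rule bij_betw_imp_surj_on)
    also have "(\<lambda>M. marked_polytope P Pm (cell_order M) marked_weight) ` cells = {cell_Q g | g. supporting g}"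
      unfolding cells_def by blast
    finally show ?thesis .
  qed
  moreover have "polyhedral_subdivision ((\<lambda>i. marked_polytope P Pm (?s i) marked_weight) ` {1..?m}) Q"
    unfolding S_eq by (rule polyhedral_subdivision_cells)
  ultimately show ?thesis
    by (intro exI[of _ ?m] exI[of _ ?s] exI[of _ ?Z] conjI ballI)
qed

end

section \<open>Gelfand--Tsetlin posets\<close>

locale flag_dimensions =
  fixes n l :: nat and d :: "nat \<Rightarrow> nat"
  assumes n_pos: "1 \<le> n" and d_mono: "strict_mono_on {0..l} d" and d_0: "d 0 = 0" and d_l: "d l = n"
begin

abbreviation "GP \<equiv> gt_poset n l d"
abbreviation "GR \<equiv> gt_order n l d"
abbreviation "PV \<equiv> pl_vars n l d"
abbreviation "ideal_of \<equiv> gt_order_ideal n l d"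
abbreviation "me \<equiv> gt_marked_elem d"

lemma d_less: "i < j \<Longrightarrow> j \<le> l \<Longrightarrow> d i < d j"
  using d_mono by (auto simp: strict_mono_on_def)

lemma d_le: "i \<le> j \<Longrightarrow> j \<le> l \<Longrightarrow> d i \<le> d j"
  using d_less[of i j] by (cases "i = j") auto

lemma d_less_iff: "i \<le> l \<Longrightarrow> j \<le> l \<Longrightarrow> d i < d j \<longleftrightarrow> i < j"
  using d_less[of i j] d_le[of j i] by (cases "i < j") auto

lemma d_le_n: "i \<le> l \<Longrightarrow> d i \<le> n"
  using d_le[of i l] d_l by simp

lemma l_pos: "1 \<le> l"
  using n_pos d_0 d_l by (cases l) auto

lemma GP_iff: "(i, j) \<in> GP \<longleftrightarrow> (\<exists>s\<in>{1..l}. i = d (s - 1) + 1 \<and> j = d s) \<or>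
    (\<exists>k\<in>{1..<l}. 1 \<le> i \<and> i \<le> d k \<and> d k < j \<and> j \<le> n)"
  unfolding gt_poset_def gt_marked_def gt_marked_elem_def by auto

lemma GP_bounds: "(i, j) \<in> GP \<Longrightarrow> 1 \<le> i \<and> i \<le> n \<and> 1 \<le> j \<and> j \<le> n"
proof -
  assume "(i, j) \<in> GP"
  then consider s where "s \<in> {1..l}" "i = d (s - 1) + 1" "j = d s"
    | k where "k \<in> {1..<l}" "1 \<le> i" "i \<le> d k" "d k < j" "j \<le> n"
    unfolding GP_iff by blast
  then show ?thesis
  proof cases
    case 1
    have "d (s - 1) < d s" using 1(1) by (intro d_less) auto
    moreover have "d s \<le> n" using 1(1) by (intro d_le_n) auto
    ultimately show ?thesis using 1(2,3) by simp
  next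
    case 2
    then show ?thesis by linarith
  qed
qed

lemma finite_GP: "finite GP"
  by (rule finite_subset[of _ "{1..n} \<times> {1..n}"]) (use GP_bounds in auto)

lemma GR_iff: "((i, j), (i', j')) \<in> GR \<longleftrightarrow> (i, j) \<in> GP \<and> (i', j') \<in> GP \<and> i \<le> i' \<and> j \<le> j'"
  unfolding gt_order_def by auto

text \<open>Since \<open>me (k + 1)\<close> is the pair \<open>(d k + 1, d (k + 1))\<close>, an
  element in a row beyond \<open>d k\<close> lies above that mark.\<close>

lemma GP_above:
  assumes "(i, j) \<in> GP" "k < l" "d k < i"
  shows "d k + 1 \<le> i" "d (k + 1) \<le> j"
proof -
  show "d k + 1 \<le> i" using assms(3) by simp
  from assms(1) consider s where "s \<in> {1..l}" "i = d (s - 1) + 1" "j = d s"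
    | k' where "k' \<in> {1..<l}" "i \<le> d k'" "d k' < j"
    unfolding GP_iff by blast
  then show "d (k + 1) \<le> j"
  proof cases
    case 1
    then have "d k \<le> d (s - 1)" using assms(3) by simp
    then have "\<not> s - 1 < k" using d_less_iff[of "s - 1" k] 1(1) assms(2) by auto
    then have "k + 1 \<le> s" using 1(1) by (cases s) simp_all
    then show ?thesis using 1 by (simp add: d_le)
  next
    case 2
    then have "d k < d k'" using assms(3) by simp
    then have "k < k'" using d_less_iff[of k k'] 2(1) assms(2) by simp
    then have "d (k + 1) \<le> d k'" using 2(1) by (intro d_le) auto
    then show ?thesis using 2 by simp
  qed
qed

text \<open>An element whose coordinates are both at most \<open>d k\<close> lies below the mark
  \<open>me k\<close>, and hence in every ideal of block \<open>k\<close>.\<close>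

lemma GP_below:
  assumes "(i, j) \<in> GP" "1 \<le> k" "k \<le> l" "i \<le> d k" "j \<le> d k"
  shows "i \<le> d (k - 1) + 1"
proof -
  from assms(1) consider s where "s \<in> {1..l}" "i = d (s - 1) + 1" "j = d s"
    | k' where "k' \<in> {1..<l}" "i \<le> d k'" "d k' < j"
    unfolding GP_iff by blast
  then show ?thesis
  proof cases
    case 1
    then have "\<not> k < s" using d_less_iff[of k s] assms(3,5) by auto
    then have "d (s - 1) \<le> d (k - 1)" using assms(3) by (intro d_le) auto
    then show ?thesis using 1 by simp
  next
    case 2
    then have "d k' < d k" using assms(5) by simp
    then have "k' < k" using d_less_iff[of k' k] 2(1) assms(3) by simp
    then have "d k' \<le> d (k - 1)" using assms(3) by (intro d_le) auto
    then show ?thesis using 2 by simp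
  qed
qed

lemma me_in: "1 \<le> i \<Longrightarrow> i \<le> l \<Longrightarrow> me i \<in> GP"
  unfolding gt_poset_def gt_marked_def by auto

sublocale marked_poset GP GR l me
proof
  show "finite GP" by (rule finite_GP)
  show "partial_order_on GP GR"
    unfolding partial_order_on_def preorder_on_def refl_on_def trans_def antisym_def gt_order_def by auto
  show "1 \<le> l" by (rule l_pos)
  show "me i \<in> GP" if "1 \<le> i" "i \<le> l" for i by (rule me_in[OF that])
  show "(me i, me j) \<in> GR" if "1 \<le> i" "i \<le> j" "j \<le> l" for i j
  proof -
    have "d (i - 1) \<le> d (j - 1)" "d i \<le> d j" using that by (auto intro!: d_le)
    then show ?thesis using me_in[of i] me_in[of j] that unfolding gt_marked_elem_def GR_iff by simp
  qed
  show "inj_on me {1..l}"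
  proof (rule inj_onI)
    fix i j assume ij: "i \<in> {1..l}" "j \<in> {1..l}" "me i = me j"
    then have "d i = d j" unfolding gt_marked_elem_def by simp
    then have "\<not> i < j" "\<not> j < i" using d_less_iff[of i j] d_less_iff[of j i] ij by auto
    then show "i = j" by simp
  qed
  fix p assume p: "p \<in> GP"
  obtain i j where ij: "p = (i, j)" by (cases p)
  have b: "1 \<le> i" "i \<le> n" "1 \<le> j" "j \<le> n" using GP_bounds p unfolding ij by blast+
  have "d (0 + 1) \<le> j" using GP_above(2)[of i j 0] p l_pos b(1) d_0 unfolding ij by simp
  then show "(me 1, p) \<in> GR"
    using p me_in[of 1] l_pos b d_0 unfolding ij gt_marked_elem_def GR_iff by simp
  have "i \<le> d (l - 1) + 1" using GP_below[of i j l] p l_pos b d_l unfolding ij by simp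
  then show "(p, me l) \<in> GR"
    using p me_in[of l] l_pos b d_l unfolding ij gt_marked_elem_def GR_iff by simp
qed

section \<open>Pluecker indices and order ideals\<close>

lemma PV_iff: "a \<in> PV \<longleftrightarrow> sorted_wrt (<) a \<and> set a \<subseteq> {1..n} \<and> (\<exists>k\<le>l. length a = d k)"
  unfolding pl_vars_def by auto

lemma finite_PV: "finite PV"
proof (rule finite_subset)
  show "PV \<subseteq> {a. set a \<subseteq> {1..n} \<and> length a \<le> n}" 
  proof
    fix a assume "a \<in> PV"
    then obtain k where "set a \<subseteq> {1..n}" "k \<le> l" "length a = d k" unfolding PV_iff by blast
    then show "a \<in> {a. set a \<subseteq> {1..n} \<and> length a \<le> n}" using d_le_n[of k] by simp
  qed
  show "finite {a. set a \<subseteq> {1..n} \<and> length a \<le> n}" by (rule finite_lists_length_le) simp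
qed

text \<open>The last column allowed in row \<open>i\<close>. Subtracting the staircase turns
  strictly increasing indices into row bounds that decrease weakly and stay between the length of
  \<open>a\<close> and \<open>n\<close>.\<close>

definition bound :: "nat list \<Rightarrow> nat \<Rightarrow> nat" where
  "bound a i = a ! (length a - i) + i - 1"

lemma ideal_of_iff: "(i, j) \<in> ideal_of a \<longleftrightarrow> (i, j) \<in> GP \<and> i \<le> length a \<and> j \<le> bound a i"
  unfolding gt_order_ideal_def bound_def by auto

lemma sorted_nth_ge:
  assumes "sorted_wrt (<) a" "set a \<subseteq> {1..n}" "t < length a"
  shows "t + 1 \<le> a ! t"
  using assms(3)
proof (induction t)
  case 0
  then have "a ! 0 \<in> set a" by (rule nth_mem)
  then show ?case using assms(2) by auto
next
  case (Suc t)
  then have "a ! t < a ! Suc t" using assms(1) by (simp add: sorted_wrt_iff_nth_less)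
  then show ?case using Suc by simp
qed

lemma sorted_nth_le:
  assumes "sorted_wrt (<) a" "set a \<subseteq> {1..n}" "t < length a"
  shows "a ! (length a - 1 - t) + t \<le> n"
  using assms(3)
proof (induction t)
  case 0
  then have "a ! (length a - 1) \<in> set a" by (intro nth_mem) simp
  then show ?case using assms(2) by auto
next
  case (Suc t)
  have "a ! (length a - 1 - Suc t) < a ! (length a - 1 - t)"
    using assms(1) Suc.prems by (auto simp: sorted_wrt_iff_nth_less)
  then show ?case using Suc by simp
qed

lemma bound_ge:
  assumes "a \<in> PV" "1 \<le> i" "i \<le> length a"
  shows "length a \<le> bound a i"
  using sorted_nth_ge[of a "length a - i"] assms by (auto simp: PV_iff bound_def)

lemma bound_le:
  assumes "a \<in> PV" "1 \<le> i" "i \<le> length a"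
  shows "bound a i \<le> n"
  using sorted_nth_le[of a "i - 1"] assms by (auto simp: PV_iff bound_def)

lemma bound_antimono:
  assumes "a \<in> PV" "1 \<le> i'" "i' \<le> i" "i \<le> length a"
  shows "bound a i \<le> bound a i'"
  using assms(3,4)
proof (induction i rule: dec_induct)
  case (step i)
  have "a ! (length a - Suc i) < a ! (length a - i)"
    using assms(1,2) step by (auto simp: PV_iff sorted_wrt_iff_nth_less)
  then have "bound a (Suc i) \<le> bound a i" by (simp add: bound_def)
  then show ?case using step by simp
qed simp

lemma ideal_of_L: "a \<in> PV \<Longrightarrow> ideal_of a \<in> L"
proof (rule L_I)
  assume a: "a \<in> PV"
  show "ideal_of a \<subseteq> GP" unfolding gt_order_ideal_def by auto
  fix p q assume pq: "(p, q) \<in> GR" "q \<in> ideal_of a"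
  obtain i j i' j' where ij: "p = (i, j)" "q = (i', j')" by (cases p, cases q)
  have "1 \<le> i" using GP_bounds pq unfolding ij GR_iff by blast
  then have "bound a i' \<le> bound a i"
    using pq bound_antimono[OF a] unfolding ij GR_iff ideal_of_iff by simp
  then show "p \<in> ideal_of a" using pq unfolding ij GR_iff ideal_of_iff by linarith
qed

lemma ideal_of_block:
  assumes "a \<in> PV" "k \<le> l" "length a = d k"
  shows "in_block k (ideal_of a)"
  unfolding in_block_iff[OF assms(2)]
proof
  fix s assume s: "s \<in> {1..l}"
  show "me s \<in> ideal_of a \<longleftrightarrow> s \<le> k"
  proof
    assume "me s \<in> ideal_of a"
    then have "d (s - 1) < d k" unfolding gt_marked_elem_def ideal_of_iff assms(3) by simp
    then have "s - 1 < k" using d_less_iff[of "s - 1" k] s assms(2) by auto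
    then show "s \<le> k" by simp
  next
    assume sk: "s \<le> k"
    have lt: "d (s - 1) < d k" using s sk assms(2) by (intro d_less) auto
    then have "d k \<le> bound a (d (s - 1) + 1)"
      using bound_ge[OF assms(1), of "d (s - 1) + 1"] assms(3) by simp
    moreover have "d s \<le> d k" using sk assms(2) by (intro d_le)
    ultimately show "me s \<in> ideal_of a"
      using me_in[of s] s lt unfolding gt_marked_elem_def ideal_of_iff assms(3) by simp
  qed
qed

text \<open>The block of the ideal gives the length of the index. If two bounds differ in some row,
  the larger one marks a position of the poset that lies in only one of the ideals.\<close>

lemma ideal_of_inj: "inj_on ideal_of PV"
proof (rule inj_onI)
  fix a b assume a: "a \<in> PV" and b: "b \<in> PV" and eq: "ideal_of a = ideal_of b"
  obtain k k' where k: "k \<le> l" "length a = d k" "k' \<le> l" "length b = d k'" using a b unfolding PV_iff by blast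
  have "k = k'"
    using block_unique[of k "ideal_of a" k'] ideal_of_block[OF a k(1,2)] ideal_of_block[OF b k(3,4)] eq k by simp
  then have len: "length a = d k" "length b = d k" using k by simp_all
  have le: "bound a' i \<le> bound b' i"
    if *: "a' \<in> PV" "b' \<in> PV" "length a' = d k" "length b' = d k" "ideal_of a' = ideal_of b'" "1 \<le> i" "i \<le> d k" for a' b' i
  proof (rule ccontr)
    assume "\<not> ?thesis"
    then have lt: "bound b' i < bound a' i" by simp
    have "d k \<le> bound b' i" "bound a' i \<le> n" using bound_ge[OF *(2), of i] bound_le[OF *(1), of i] * by simp_all
    then have kn: "d k < bound a' i" "bound a' i \<le> n" "d k < d l" using lt d_l by simp_all
    then have "k < l" using d_less_iff[of k l] k(1) by simp
    moreover have "k \<noteq> 0" using *(6,7) d_0 by (intro notI) simp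
    ultimately have "k \<in> {1..<l}" by simp
    \<comment> \<open>The larger bound exceeds \<open>d k\<close> and is at most \<open>n\<close>,
      so \<open>0 < k < l\<close>, and the position belongs to the rectangle of \<open>d k\<close>
      that is part of the poset.\<close>
    then have "(i, bound a' i) \<in> GP" unfolding GP_iff using *(6,7) kn by blast
    then have "(i, bound a' i) \<in> ideal_of a'" using * unfolding ideal_of_iff by simp
    then have "(i, bound a' i) \<in> ideal_of b'" unfolding *(5) .
    then show False using lt unfolding ideal_of_iff by simp
  qed
  show "a = b"
  proof (rule nth_equalityI)
    show "length a = length b" using len by simp
    fix t assume t: "t < length a"
    define i where "i = length a - t"
    have i: "1 \<le> i" "i \<le> d k" "t = length a - i" "t = length b - i" using t len by (auto simp: i_def)
    have "bound a i = bound b i"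
      using le[OF a b len eq i(1,2)] le[OF b a len(2,1) eq[symmetric] i(1,2)] by simp
    then show "a ! t = b ! t" using i unfolding bound_def by simp
  qed
qed

text \<open>The index is read off from the row ends \<open>c i\<close> of the ideal. These are
  raised to at least \<open>d k\<close>: earlier columns are filled automatically and carry no
  information.\<close>

lemma ideal_of_surj:
  assumes J: "J \<in> L" shows "\<exists>a\<in>PV. ideal_of a = J"
proof -
  obtain k where k: "k \<le> l" "in_block k J" using ex_block[OF J] by blast
  define c where "c i = Max (insert (d k) {j. (i, j) \<in> J})" for i
  have fin: "finite {j. (i, j) \<in> J}" for i
    by (rule finite_subset[of _ "{1..n}"]) (use L_subset[OF J] GP_bounds in auto)
  have c_ge: "d k \<le> c i" "(i, j) \<in> J \<Longrightarrow> j \<le> c i" for i j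
    unfolding c_def using fin by (auto intro!: Max_ge)
  have c_cases: "c i = d k \<or> (i, c i) \<in> J" for i
    using Max_in[of "insert (d k) {j. (i, j) \<in> J}"] fin unfolding c_def by blast
  have c_le: "c i \<le> n" for i
    using c_cases[of i] d_le_n[OF k(1)] L_subset[OF J] GP_bounds by fastforce
  have c_anti: "c i \<le> c i'" if i: "1 \<le> i'" "i' \<le> i" "i \<le> d k" for i i'
  proof (cases "c i = d k")
    case True
    then show ?thesis using c_ge(1) by simp
  next
    case False
    then have iJ: "(i, c i) \<in> J" "d k < c i" using c_cases[of i] c_ge(1)[of i] by auto
    then have "d k < d l" using c_le[of i] d_l by simp
    then have "k < l" using d_less_iff[of k l] k(1) by simp
    moreover have "k \<noteq> 0" using i d_0 by (intro notI) simp
    ultimately have "k \<in> {1..<l}" by simp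
    then have "(i', c i) \<in> GP" unfolding GP_iff using i iJ(2) c_le[of i] by (intro disjI2 bexI[of _ k]) auto
    then have "((i', c i), (i, c i)) \<in> GR" unfolding GR_iff using i(2) L_subset[OF J] iJ(1) by auto
    then have "(i', c i) \<in> J" using L_down[OF J] iJ(1) by blast
    then show ?thesis by (rule c_ge(2))
  qed
  \<comment> \<open>The inverse of \<open>bound\<close>: entry \<open>t\<close> counted from 0
    belongs to row \<open>d k - t\<close>, and solving for it gives
    \<open>c (d k - t) + t + 1 - d k\<close>.\<close>
  define a where "a = map (\<lambda>t. c (d k - t) + t + 1 - d k) [0..<d k]"
  have len: "length a = d k" by (simp add: a_def)
  have nth: "a ! t = c (d k - t) + t + 1 - d k" if "t < d k" for t using that by (simp add: a_def)
  have aPV: "a \<in> PV"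
    unfolding PV_iff
  proof (intro conjI)
    show "sorted_wrt (<) a"
      unfolding sorted_wrt_iff_nth_less
    proof (intro allI impI)
      fix t t' assume t: "t < t'" "t' < length a"
      then have "c (d k - t) \<le> c (d k - t')" by (intro c_anti) (auto simp: len)
      then show "a ! t < a ! t'"
        using t c_ge(1)[of "d k - t"] c_ge(1)[of "d k - t'"] by (simp add: nth len)
    qed
    show "set a \<subseteq> {1..n}"
    proof
      fix x assume "x \<in> set a"
      then obtain t where t: "t < d k" "x = a ! t" using len by (metis in_set_conv_nth)
      then show "x \<in> {1..n}"
        using nth[OF t(1)] c_ge(1)[of "d k - t"] c_le[of "d k - t"] unfolding atLeastAtMost_iff by linarith
    qed
    show "\<exists>k\<le>l. length a = d k" using k(1) len by blast
  qed
  have bound: "bound a i = c i" if "1 \<le> i" "i \<le> d k" for i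
    using that c_ge(1)[of i] nth[of "d k - i"] unfolding bound_def len by simp
  have "(i, j) \<in> ideal_of a \<longleftrightarrow> (i, j) \<in> J" for i j
  proof
    assume "(i, j) \<in> ideal_of a"
    then have ij: "(i, j) \<in> GP" "i \<le> d k" "j \<le> bound a i" unfolding ideal_of_iff len by blast+
    have i1: "1 \<le> i" using GP_bounds ij(1) by blast
    then have jc: "j \<le> c i" using ij bound by simp
    show "(i, j) \<in> J"
    proof (cases "j \<le> d k")
      case True
      have k1: "1 \<le> k" using i1 ij(2) d_0 by (cases k) auto
      \<comment> \<open>Up to column \<open>d k\<close> membership does not depend on the row end,
        because such positions lie below the mark \<open>me k\<close>, which the ideal
        contains.\<close>
      have "i \<le> d (k - 1) + 1" by (rule GP_below[OF ij(1) k1 k(1) ij(2) True])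
      then have "((i, j), me k) \<in> GR"
        using True ij(1) me_in[OF k1 k(1)] unfolding gt_marked_elem_def GR_iff by simp
      moreover have "me k \<in> J" using k(2) k1 k(1) unfolding in_block_iff[OF k(1)] by auto
      ultimately show ?thesis using L_down[OF J] by blast
    next
      case False
      then have "(i, c i) \<in> J" using c_cases[of i] jc by auto
      moreover from this have "((i, j), (i, c i)) \<in> GR"
        unfolding GR_iff using ij(1) jc L_subset[OF J] by auto
      ultimately show ?thesis using L_down[OF J] by blast
    qed
  next
    assume ij: "(i, j) \<in> J"
    then have ijP: "(i, j) \<in> GP" using L_subset[OF J] by blast
    have i1: "1 \<le> i" "i \<le> n" using GP_bounds ijP by blast+
    have "i \<le> d k"
    proof (rule ccontr)
      assume "\<not> i \<le> d k"
      then have i: "d k < i" "d k < d l" using i1 d_l by simp_all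
      then have kl: "k < l" using d_less_iff[of k l] k(1) by simp
      have "(me (k + 1), (i, j)) \<in> GR"
        using GP_above[OF ijP kl i(1)] me_in[of "k + 1"] kl ijP unfolding gt_marked_elem_def GR_iff by simp
      then have "me (k + 1) \<in> J" using L_down[OF J] ij by blast
      then show False using k(2) kl unfolding in_block_iff[OF k(1)] by auto
    qed
    then show "(i, j) \<in> ideal_of a"
      unfolding ideal_of_iff len using ijP c_ge(2)[OF ij] bound[OF i1(1)] by simp
  qed
  then have "ideal_of a = J" by auto
  then show ?thesis using aPV by blast
qed

lemma bij_ideal_of: "bij_betw ideal_of PV L"
  unfolding bij_betw_def using ideal_of_inj ideal_of_L ideal_of_surj by blast

section \<open>Meets and joins of Pluecker indices\<close>

definition gt_meet :: "nat list \<Rightarrow> nat list \<Rightarrow> nat list" where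
  "gt_meet a b = map2 min (drop (length a - length b) a) b"

definition gt_join :: "nat list \<Rightarrow> nat list \<Rightarrow> nat list" where
  "gt_join a b = take (length a - length b) a @ map2 max (drop (length a - length b) a) b"

lemma gt_binomial_eq: "gt_binomial a b = Var a * Var b - Var (gt_meet a b) * Var (gt_join a b)"
  unfolding gt_binomial_def gt_meet_def gt_join_def Let_def ..

context
  fixes a b assumes a: "a \<in> PV" and b: "b \<in> PV" and ab: "length b \<le> length a"
begin

lemma length_gt_meet: "length (gt_meet a b) = length b" and length_gt_join: "length (gt_join a b) = length a"
  using ab by (simp_all add: gt_meet_def gt_join_def)

lemma nth_gt_meet: "t < length b \<Longrightarrow> gt_meet a b ! t = min (a ! (length a - length b + t)) (b ! t)"
  using ab by (simp add: gt_meet_def)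

lemma nth_gt_join: "t < length a \<Longrightarrow> gt_join a b ! t =
    (if t < length a - length b then a ! t else max (a ! t) (b ! (t - (length a - length b))))"
  using ab by (simp add: gt_join_def nth_append)

lemma nth_range:
  assumes "c \<in> PV" "t < length c" shows "c ! t \<in> {1..n}"
  using assms nth_mem[of t c] unfolding PV_iff by blast

lemma nth_less:
  assumes "c \<in> PV" "t < t'" "t' < length c" shows "c ! t < c ! t'"
  using assms by (simp add: PV_iff sorted_wrt_iff_nth_less)

lemma gt_meet_PV: "gt_meet a b \<in> PV"
  unfolding PV_iff
proof (intro conjI)
  show "sorted_wrt (<) (gt_meet a b)"
    unfolding sorted_wrt_iff_nth_less length_gt_meet
  proof (intro allI impI)
    fix t t' assume t: "t < t'" "t' < length b"
    have "a ! (length a - length b + t) < a ! (length a - length b + t')"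
      by (rule nth_less[OF a]) (use t ab in auto)
    moreover have "b ! t < b ! t'" by (rule nth_less[OF b t])
    ultimately show "gt_meet a b ! t < gt_meet a b ! t'" using t by (auto simp: nth_gt_meet min_def)
  qed
  show "set (gt_meet a b) \<subseteq> {1..n}"
  proof
    fix x assume "x \<in> set (gt_meet a b)"
    then obtain t where t: "t < length b" "x = gt_meet a b ! t"
      unfolding in_set_conv_nth length_gt_meet by blast
    have "a ! (length a - length b + t) \<in> {1..n}" by (rule nth_range[OF a]) (use t ab in auto)
    moreover have "b ! t \<in> {1..n}" by (rule nth_range[OF b t(1)])
    ultimately show "x \<in> {1..n}" using t by (simp add: nth_gt_meet min_def)
  qed
  show "\<exists>k\<le>l. length (gt_meet a b) = d k" using b unfolding length_gt_meet PV_iff by blast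
qed

lemma gt_join_PV: "gt_join a b \<in> PV"
  unfolding PV_iff
proof (intro conjI)
  let ?s = "length a - length b"
  show "sorted_wrt (<) (gt_join a b)"
    unfolding sorted_wrt_iff_nth_less length_gt_join
  proof (intro allI impI)
    fix t t' assume t: "t < t'" "t' < length a"
    have 1: "a ! t < a ! t'" by (rule nth_less[OF a t])
    show "gt_join a b ! t < gt_join a b ! t'"
    proof (cases "t < ?s")
      case True
      then show ?thesis using 1 t by (auto simp: nth_gt_join max_def)
    next
      case False
      then have "b ! (t - ?s) < b ! (t' - ?s)" by (intro nth_less[OF b]) (use t ab in auto)
      then show ?thesis using 1 t False by (auto simp: nth_gt_join max_def)
    qed
  qed
  show "set (gt_join a b) \<subseteq> {1..n}"
  proof
    fix x assume "x \<in> set (gt_join a b)"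
    then obtain t where t: "t < length a" "x = gt_join a b ! t"
      unfolding in_set_conv_nth length_gt_join by blast
    have 1: "a ! t \<in> {1..n}" by (rule nth_range[OF a t(1)])
    show "x \<in> {1..n}"
    proof (cases "t < ?s")
      case True
      then show ?thesis using 1 t by (auto simp: nth_gt_join max_def)
    next
      case False
      then have "b ! (t - ?s) \<in> {1..n}" by (intro nth_range[OF b]) (use t ab in auto)
      then show ?thesis using 1 t False by (auto simp: nth_gt_join max_def)
    qed
  qed
  show "\<exists>k\<le>l. length (gt_join a b) = d k" using a unfolding length_gt_join PV_iff by blast
qed

lemma bound_gt_meet:
  assumes "1 \<le> i" "i \<le> length b"
  shows "bound (gt_meet a b) i = min (bound a i) (bound b i)"
proof -
  have "length a - length b + (length b - i) = length a - i" using ab assms by simp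
  moreover have "length b - i < length b" using assms by simp
  ultimately have "gt_meet a b ! (length b - i) = min (a ! (length a - i)) (b ! (length b - i))"
    using nth_gt_meet[of "length b - i"] by simp
  then show ?thesis unfolding bound_def length_gt_meet by (auto simp: min_def)
qed

lemma bound_gt_join:
  assumes "1 \<le> i" "i \<le> length a"
  shows "bound (gt_join a b) i = (if i \<le> length b then max (bound a i) (bound b i) else bound a i)"
proof -
  have t: "length a - i < length a" using assms by simp
  have iff: "length a - i < length a - length b \<longleftrightarrow> \<not> i \<le> length b" using ab assms by auto
  have idx: "length a - i - (length a - length b) = length b - i" using ab by simp
  have "gt_join a b ! (length a - i) =
      (if i \<le> length b then max (a ! (length a - i)) (b ! (length b - i)) else a ! (length a - i))"
    unfolding nth_gt_join[OF t] iff idx by simp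
  then show ?thesis unfolding bound_def length_gt_join by (auto simp: max_def)
qed

text \<open>Counted from the end, entries with the same position give the same row, so entrywise
  minima are minima of row bounds. With its counterpart for joins this makes the defining binomials
  Hibi relations.\<close>

lemma ideal_of_gt_meet: "ideal_of (gt_meet a b) = ideal_of a \<inter> ideal_of b"
proof (rule set_eqI)
  fix p :: "nat \<times> nat"
  obtain i j where p: "p = (i, j)" by (cases p)
  show "p \<in> ideal_of (gt_meet a b) \<longleftrightarrow> p \<in> ideal_of a \<inter> ideal_of b"
  proof (cases "(i, j) \<in> GP \<and> i \<le> length b")
    case True
    then have "1 \<le> i" using GP_bounds by blast
    then show ?thesis
      using True ab unfolding p Int_iff ideal_of_iff length_gt_meet by (simp add: bound_gt_meet)
  next
    case False
    then show ?thesis unfolding p Int_iff ideal_of_iff length_gt_meet by blast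
  qed
qed

lemma ideal_of_gt_join: "ideal_of (gt_join a b) = ideal_of a \<union> ideal_of b"
proof (rule set_eqI)
  fix p :: "nat \<times> nat"
  obtain i j where p: "p = (i, j)" by (cases p)
  show "p \<in> ideal_of (gt_join a b) \<longleftrightarrow> p \<in> ideal_of a \<union> ideal_of b"
  proof (cases "(i, j) \<in> GP \<and> i \<le> length a")
    case True
    then have "1 \<le> i" using GP_bounds by blast
    then show ?thesis
      using True ab unfolding p Un_iff ideal_of_iff length_gt_join by (auto simp: bound_gt_join)
  next
    case False
    then show ?thesis using ab unfolding p Un_iff ideal_of_iff length_gt_join by auto
  qed
qed

lemma gt_binomial_in_ideal: "gt_binomial a b \<in> gt_ideal n l d"
  unfolding gt_ideal_def lin_combs_def
proof (intro CollectI exI[of _ "{gt_binomial a b}"] exI[of _ "\<lambda>_. 1"] conjI)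
  show "{gt_binomial a b} \<subseteq> {gt_binomial a b | a b. a \<in> PV \<and> b \<in> PV \<and> length b \<le> length a}"
    using a b ab by blast
  show "(\<lambda>_. 1) ` {gt_binomial a b} \<subseteq> polys PV" by (simp add: polys_def)
qed simp_all

end

lemma ex_meet_join:
  assumes "a \<in> PV" "b \<in> PV"
  shows "\<exists>a'\<in>PV. \<exists>b'\<in>PV. ideal_of a' = ideal_of a \<inter> ideal_of b \<and> ideal_of b' = ideal_of a \<union> ideal_of b \<and>
    Var a * Var b - Var a' * Var b' \<in> gt_ideal n l d"
proof (cases "length b \<le> length a")
  case True
  show ?thesis
    by (rule bexI[OF _ gt_meet_PV[OF assms True]], rule bexI[OF _ gt_join_PV[OF assms True]])
      (simp add: ideal_of_gt_meet[OF assms True] ideal_of_gt_join[OF assms True]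
        gt_binomial_in_ideal[OF assms True, unfolded gt_binomial_eq])
next
  case False
  then have ba: "length a \<le> length b" by simp
  have "Var a * Var b - Var (gt_meet b a) * Var (gt_join b a) \<in> gt_ideal n l d"
    using gt_binomial_in_ideal[OF assms(2,1) ba, unfolded gt_binomial_eq] by (simp only: mult.commute)
  then show ?thesis
    by (intro bexI[OF _ gt_meet_PV[OF assms(2,1) ba]] bexI[OF _ gt_join_PV[OF assms(2,1) ba]])
      (simp add: ideal_of_gt_meet[OF assms(2,1) ba] ideal_of_gt_join[OF assms(2,1) ba] Int_commute Un_commute)
qed

lemma of_bool_sums_Int_Un: "of_bool (p \<in> A) + of_bool (p \<in> B) = of_bool (p \<in> A \<inter> B) + (of_bool (p \<in> A \<union> B) :: nat)"
  by auto

text \<open>Both monomials of a generator have the same multidegree: intersection and union preserve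
  the counts of elements, and meet and join have the lengths of the two factors.\<close>

lemma gt_ideal_torus:
  assumes "f \<in> gt_ideal n l d"
  shows "poly_eval (torus_point PV (GP <+> length ` PV)
    (multideg length (\<lambda>v p. of_bool (p \<in> ideal_of v))) t) f = 0"
proof (rule poly_eval_lin_combs[OF assms[unfolded gt_ideal_def]])
  let ?E = "multideg length (\<lambda>v p. of_bool (p \<in> ideal_of v))"
  let ?x = "torus_point PV (GP <+> length ` PV) ?E t"
  have fin: "finite (GP <+> length ` PV)" using finite_GP finite_PV by simp
  fix h assume "h \<in> {gt_binomial a b | a b. a \<in> PV \<and> b \<in> PV \<and> length b \<le> length a}"
  then obtain a b where ab: "a \<in> PV" "b \<in> PV" "length b \<le> length a" "h = gt_binomial a b" by blast
  have "prod_list (map ?x [a, b]) = prod_list (map ?x [gt_meet a b, gt_join a b])"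
  proof (rule toric_vec_prod_eq[OF toric_vec_torus_point[OF fin]])
    show "set [a, b] \<subseteq> PV" "set [gt_meet a b, gt_join a b] \<subseteq> PV"
      using ab gt_meet_PV[OF ab(1-3)] gt_join_PV[OF ab(1-3)] by simp_all
    fix i assume "i \<in> GP <+> length ` PV"
    then show "(\<Sum>v\<leftarrow>[a, b]. ?E v i) = (\<Sum>v\<leftarrow>[gt_meet a b, gt_join a b]. ?E v i)"
    proof (elim PlusE)
      fix p assume i: "i = Inl p"
      show ?thesis
        unfolding i using of_bool_sums_Int_Un[of p "ideal_of a" "ideal_of b"]
        by (simp add: ideal_of_gt_meet[OF ab(1-3)] ideal_of_gt_join[OF ab(1-3)])
    next
      fix k assume i: "i = Inr k"
      show ?thesis
        unfolding i by (simp add: block_deg_def length_gt_meet[OF ab(1-3)] length_gt_join[OF ab(1-3)])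
    qed
  qed
  then show "poly_eval ?x h = 0"
    unfolding ab(4) gt_binomial_eq by (simp add: poly_eval_ring_hom)
qed

section \<open>The weight cone\<close>

text \<open>The test point is supported on a comparable pair, so at least one factor of each
  incomparable product vanishes there.\<close>

lemma gt_monomial_ideal_vanishes:
  assumes p: "p \<in> gt_monomial_ideal n l d" and c: "K \<subseteq> K'"
  shows "poly_eval (\<lambda>a. of_bool (ideal_of a \<in> {K, K'})) p = 0"
proof -
  let ?y = "\<lambda>J. of_bool (J \<in> {K, K'}) :: complex"
  have "poly_eval ?y (psi_GT n l d p) = 0"
  proof (rule poly_eval_lin_combs)
    show "psi_GT n l d p \<in> lin_combs (polys (order_ideals GP GR)) {Var J * Var J' | J J'.
        J \<in> order_ideals GP GR \<and> J' \<in> order_ideals GP GR \<and> \<not> J \<subseteq> J' \<and> \<not> J' \<subseteq> J}"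
      using p unfolding gt_monomial_ideal_def incomparable_ideal_def by blast
    fix h :: "(nat \<times> nat) set cpoly"
    assume "h \<in> {Var J * Var J' | J J'.
        J \<in> order_ideals GP GR \<and> J' \<in> order_ideals GP GR \<and> \<not> J \<subseteq> J' \<and> \<not> J' \<subseteq> J}"
    then obtain J J' where J: "h = Var J * Var J'" "\<not> J \<subseteq> J'" "\<not> J' \<subseteq> J" by blast
    then have "J \<notin> {K, K'} \<or> J' \<notin> {K, K'}" using c by auto
    then show "poly_eval ?y h = 0" unfolding J(1) by (auto simp: poly_eval_ring_hom)
  qed
  then show ?thesis unfolding psi_GT_def poly_eval_poly_subst_Const poly_eval_Var .
qed

text \<open>Otherwise the initial form of the Hibi binomial contains the monomial of meet and join,
  which equals 1 at the test point of that comparable pair, although every element of the monomial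
  ideal vanishes there.\<close>

lemma weight_cone_strict:
  assumes w: "w \<in> weight_cone (gt_ideal n l d) (gt_monomial_ideal n l d)"
    and V: "a \<in> PV" "b \<in> PV" "a' \<in> PV" "b' \<in> PV"
    and ideals: "ideal_of a' = ideal_of a \<inter> ideal_of b" "ideal_of b' = ideal_of a \<union> ideal_of b"
    and I: "Var a * Var b - Var a' * Var b' \<in> gt_ideal n l d"
    and inc: "\<not> ideal_of a \<subseteq> ideal_of b" "\<not> ideal_of b \<subseteq> ideal_of a"
  shows "w a + w b < w a' + w b'"
proof (rule ccontr)
  assume "\<not> ?thesis"
  then have le: "(\<Sum>v\<leftarrow>[a', b']. w v) \<le> (\<Sum>v\<leftarrow>[a, b]. w v)" by simp
  let ?f = "Poly_Mapping.single (monom_of [a, b]) 1 - Poly_Mapping.single (monom_of [a', b']) (1::complex)"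
  let ?x = "\<lambda>v. of_bool (ideal_of v \<in> {ideal_of a', ideal_of b'}) :: complex"
  have a0: "?x a = 0" "?x b = 0" and a1: "?x a' = 1" "?x b' = 1"
    using inc unfolding ideals by auto
  have ne: "monom_of [a, b] \<noteq> monom_of [a', b']"
  proof
    assume "monom_of [a, b] = monom_of [a', b']"
    then have "monom_eval ?x (monom_of [a, b]) = monom_eval ?x (monom_of [a', b'])" by (rule arg_cong)
    then show False unfolding monom_eval_monom_of using a0 a1 by simp
  qed
  have "initial_form w ?f \<in> gt_monomial_ideal n l d"
    using initial_form_in_initial_ideal[of ?f "gt_ideal n l d" w] I w
    unfolding Var_mult weight_cone_def by blast
  then have zero: "poly_eval ?x (initial_form w ?f) = 0"
    by (rule gt_monomial_ideal_vanishes) (use ideals in blast)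
  have ev: "poly_eval ?x (Poly_Mapping.single (monom_of [a, b]) 1) = 0"
    "poly_eval ?x (Poly_Mapping.single (monom_of [a', b']) 1) = 1"
    unfolding poly_eval_ring_hom(7) monom_eval_monom_of using a0 a1 by simp_all
  show False
  proof (cases "(\<Sum>v\<leftarrow>[a, b]. w v) = (\<Sum>v\<leftarrow>[a', b']. w v)")
    case True
    show False using zero unfolding initial_form_binomial(2)[OF ne True] poly_eval_ring_hom(3) ev by simp
  next
    case False
    then have lt: "(\<Sum>v\<leftarrow>[a', b']. w v) < (\<Sum>v\<leftarrow>[a, b]. w v)" using le by simp
    show False using zero unfolding initial_form_binomial(3)[OF ne lt] poly_eval_ring_hom(4) ev by simp
  qed
qed

text \<open>Passing to the closure weakens the strict inequality, each inequality defining a closed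
  half-space in the product topology. For comparable ideals both sides are equal.\<close>

lemma weight_cone_closure:
  assumes w: "w \<in> closure (weight_cone (gt_ideal n l d) (gt_monomial_ideal n l d))"
    and V: "a \<in> PV" "b \<in> PV" "a' \<in> PV" "b' \<in> PV"
    and ideals: "ideal_of a' = ideal_of a \<inter> ideal_of b" "ideal_of b' = ideal_of a \<union> ideal_of b"
  shows "w a + w b \<le> w a' + w b'"
proof -
  obtain a'' b'' where ab'': "a'' \<in> PV" "b'' \<in> PV" "ideal_of a'' = ideal_of a \<inter> ideal_of b"
    "ideal_of b'' = ideal_of a \<union> ideal_of b" and I'': "Var a * Var b - Var a'' * Var b'' \<in> gt_ideal n l d"
    using ex_meet_join[OF V(1,2)] by blast
  have eq: "a'' = a'" "b'' = b'"
    using inj_onD[OF ideal_of_inj trans[OF ab''(3) ideals(1)[symmetric]] ab''(1) V(3)]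
      inj_onD[OF ideal_of_inj trans[OF ab''(4) ideals(2)[symmetric]] ab''(2) V(4)] by blast+
  have I: "Var a * Var b - Var a' * Var b' \<in> gt_ideal n l d" using I'' unfolding eq .
  show ?thesis
  proof (cases "ideal_of a \<subseteq> ideal_of b \<or> ideal_of b \<subseteq> ideal_of a")
    case True
    then show ?thesis
    proof
      assume sub: "ideal_of a \<subseteq> ideal_of b"
      have "ideal_of a' = ideal_of a" "ideal_of b' = ideal_of b" using sub ideals by blast+
      then have "a' = a" "b' = b" using inj_onD[OF ideal_of_inj] V by blast+
      then show ?thesis by simp
    next
      assume sub: "ideal_of b \<subseteq> ideal_of a"
      have "ideal_of a' = ideal_of b" "ideal_of b' = ideal_of a" using sub ideals by blast+
      then have "a' = b" "b' = a" using inj_onD[OF ideal_of_inj] V by blast+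
      then show ?thesis by simp
    qed
  next
    case False
    let ?C = "{w :: nat list \<Rightarrow> real. w a + w b \<le> w a' + w b'}"
    have "closed ?C"
      by (intro closed_Collect_le continuous_intros continuous_on_product_coordinates)
    moreover have "weight_cone (gt_ideal n l d) (gt_monomial_ideal n l d) \<subseteq> ?C"
    proof
      fix v assume "v \<in> weight_cone (gt_ideal n l d) (gt_monomial_ideal n l d)"
      from weight_cone_strict[OF this V ideals I] show "v \<in> ?C" using False by simp
    qed
    ultimately have "closure (weight_cone (gt_ideal n l d) (gt_monomial_ideal n l d)) \<subseteq> ?C"
      by (intro closure_minimal)
    then show ?thesis using w by blast
  qed
qed

lemma hibi_degeneration_gt:
  assumes w: "w \<in> closure (weight_cone (gt_ideal n l d) (gt_monomial_ideal n l d))"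
  shows "hibi_degeneration GP GR l me (\<lambda>J. w (inv_into PV ideal_of J)) PV length ideal_of d w (gt_ideal n l d)"
proof
  have inv: "inv_into PV ideal_of J \<in> PV" "ideal_of (inv_into PV ideal_of J) = J" if "J \<in> L" for J
  proof -
    have "J \<in> ideal_of ` PV" using that bij_betw_imp_surj_on[OF bij_ideal_of] by simp
    then show "inv_into PV ideal_of J \<in> PV" "ideal_of (inv_into PV ideal_of J) = J"
      by (rule inv_into_into, rule f_inv_into_f)
  qed
  show "w (inv_into PV ideal_of J) + w (inv_into PV ideal_of J')
      \<le> w (inv_into PV ideal_of (J \<inter> J')) + w (inv_into PV ideal_of (J \<union> J'))"
    if J: "J \<in> L" "J' \<in> L" for J J'
    by (rule weight_cone_closure[OF w]) (simp_all add: inv J L_Int[OF J] L_Un[OF J])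
  show "finite PV" by (rule finite_PV)
  show "bij_betw ideal_of PV L" by (rule bij_ideal_of)
  show "inj_on d {0..l}"
  proof (rule inj_onI)
    fix i j assume ij: "i \<in> {0..l}" "j \<in> {0..l}" "d i = d j"
    then have "\<not> i < j" "\<not> j < i" using d_less_iff[of i j] d_less_iff[of j i] by auto
    then show "i = j" by simp
  qed
  show "length v = d i" if v: "v \<in> PV" "i \<le> l" "in_block i (ideal_of v)" for v i
  proof -
    obtain k where k: "k \<le> l" "length v = d k" using v(1) unfolding PV_iff by blast
    have "k = i" by (rule block_unique[OF ideal_of_block[OF v(1) k] v(3) k(1) v(2)])
    then show ?thesis using k(2) by simp
  qed
  show "w v = w (inv_into PV ideal_of (ideal_of v))" if "v \<in> PV" for v
    using inv_into_f_f[OF ideal_of_inj that] by simp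
qed (use ex_meet_join gt_ideal_torus in auto)

end

theorem theorem3p4p4:
  fixes n l :: nat and d :: "nat \<Rightarrow> nat" and w :: "nat list \<Rightarrow> real"
  assumes "n \<ge> 1"
    and "strict_mono_on {0..l} d" and "d 0 = 0" and "d l = n"
    and "w \<in> closure (weight_cone (gt_ideal n l d) (gt_monomial_ideal n l d))"
  shows "\<exists>(m::nat) (r :: nat \<Rightarrow> (nat \<times> nat) rel) Z.
           (\<forall>i\<in>{1..m}. stronger_order (gt_poset n l d) (gt_order n l d) (r i)) \<and>
           semitoric (pl_vars n l d) length (gt_degeneration n l d w) \<and>
           bij_betw Z {1..m}
             (irreducible_components (pl_vars n l d) length (gt_degeneration n l d w)) \<and>
           (\<forall>i\<in>{1..m}. isomorphic_to_toric_variety_of (pl_vars n l d) length (Z i)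
                         (gt_polytope n l d (r i))) \<and>
           inj_on (\<lambda>i. gt_polytope n l d (r i)) {1..m} \<and>
           polyhedral_subdivision ((\<lambda>i. gt_polytope n l d (r i)) ` {1..m})
             (gt_polytope n l d (gt_order n l d))"
proof -
  interpret flag_dimensions n l d using assms(1-4) by unfold_locales
  interpret hibi_degeneration "gt_poset n l d" "gt_order n l d" l "gt_marked_elem d"
    "\<lambda>J. w (inv_into (pl_vars n l d) (gt_order_ideal n l d) J)" "pl_vars n l d" length
    "gt_order_ideal n l d" d w "gt_ideal n l d"
    by (rule hibi_degeneration_gt[OF assms(5)])
  \<comment> \<open>The poset consists of pairs; the pairing function provides the relabelling by
    natural numbers.\<close>
  have "inj prod_encode" by (rule inj_prod_encode)
  from degeneration_subdivision[OF this] show ?thesis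
    unfolding gt_degeneration_def gt_polytope_def gt_marked_def gt_weight_def .
qed

end
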